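(* Let $\Gamma=R_n(2,1)$ be a Rose Window graph with $n\ge3$. Then $\Gamma$ is the underlying graph of a map of class $2_{\{0,1\}}$ if and only if $\gcd(n,6)\ne1$. Moreover, letting $n_0\in\{0,2,3,4,6,8,9,10\}$ be the residue of $n$ modulo $12$: (i) if $n=4$, $\Gamma$ is the underlying graph of exactly one map of class $2_{\{0,1\}}$, with face lengths $4$ and $8$; (ii) if $n_0\in\{3,9\}$, $\Gamma$ is the underlying graph of a unique map of class $2_{\{0,1\}}$, with faces of lengths $4$ and $n$; (iii) if $n_0\in\{4,8\}$ and $n\ne4$, $\Gamma$ is the underlying graph of exactly two nonisomorphic maps of class $2_{\{0,1\}}$: one with faces of lengths $4$ and $n$, the other with faces of lengths $4$ and $2n$; (iv) if $n_0\in\{2,10\}$, $\Gamma$ is the underlying graph of exactly three nonisomorphic maps of class $2_{\{0,1\}}$: one with faces of lengths $4$ and $n$, one with faces of lengths $4$ and $2n$, and one with faces of lengths $n$ and $2n$; (v) if $n_0=0$, $\Gamma$ is the underlying graph of exactly three nonisomorphic maps of class $2_{\{0,1\}}$: two with faces of lengths $4$ and $n$, and one with faces of lengths $4$ and $2n$; (vi) if $n_0=6$, $\Gamma$ is the underlying graph of exactly four nonisomorphic maps of class $2_{\{0,1\}}$: two with faces of lengths $4$ and $n$, one with faces of lengths $4$ and $2n$, and one with faces of lengths $n$ and $2n$.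
   Context: For $n\ge3$, $1\le r\le n-1$ with $r\ne n/2$, and $0\le a\le n-1$, the Rose Window graph $R_n(a,r)$ has vertex set $\{x_i,y_i: i\in\mathbb Z_n\}$ and edges $x_ix_{i+1}$, $y_iy_{i+r}$, $x_iy_i$, $x_iy_{i-a}$ for $i\in\mathbb Z_n$ (indices mod $n$). A map is a $2$-cell embedding of a connected simple graph (its underlying graph) in a closed surface; the components of the complement are the faces, and the length of a face is the length of its boundary walk. All maps considered are polytopal: flags correspond bijectively to incident triples (vertex, edge, face). For a flag $\Phi$ and $i\in\{0,1,2\}$, $\Phi^i$ is the unique flag differing from $\Phi$ exactly in its vertex ($i=0$), edge ($i=1$) or face ($i=2$). $\mathrm{Aut}(\mathcal M)$ is the group of automorphisms of the underlying graph preserving the set of faces. A map is in class $2_{\{0,1\}}$ if $\mathrm{Aut}(\mathcal M)$ has exactly two orbits on flags and for every flag $\Phi$, the flags $\Phi^0,\Phi^1$ lie in the orbit of $\Phi$ while $\Phi^2$ does not. Maps are counted up to map isomorphism. *)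

theory Defs
  imports Main
begin

section \<open>Rose Window graphs\<close>

text \<open>Vertex (False, i) is x_i, vertex (True, i) is y_i, for i in Z_n represented by {0..<n}.
  Edges are 2-element sets of vertices.\<close>

definition rw_vertices :: "nat \<Rightarrow> (bool \<times> nat) set" where
  "rw_vertices n = UNIV \<times> {..<n}"

definition rw_edges :: "nat \<Rightarrow> nat \<Rightarrow> nat \<Rightarrow> (bool \<times> nat) set set" where
  "rw_edges n a r = (\<Union>i\<in>{..<n}.
     { {(False, i), (False, (i + 1) mod n)},
       {(True, i), (True, (i + r) mod n)},
       {(False, i), (True, i)},
       {(False, i), (True, (i + n - a) mod n)} })"

section \<open>Graphs and (polytopal) maps, combinatorially\<close>

definition simple_graph :: "'v set \<Rightarrow> 'v set set \<Rightarrow> bool" where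
  "simple_graph V E \<longleftrightarrow> finite V \<and>
     E \<subseteq> {e. \<exists>u w. u \<in> V \<and> w \<in> V \<and> u \<noteq> w \<and> e = {u, w}}"

definition graph_connected :: "'v set \<Rightarrow> 'v set set \<Rightarrow> bool" where
  "graph_connected V E \<longleftrightarrow>
     (\<forall>u\<in>V. \<forall>w\<in>V. (u, w) \<in> {(x, y). {x, y} \<in> E}\<^sup>*)"

text \<open>A face of a polytopal map is a cycle of the graph, represented by its edge set.\<close>
definition is_cycle_face :: "'v set set \<Rightarrow> 'v set set \<Rightarrow> bool" where
  "is_cycle_face E C \<longleftrightarrow> C \<subseteq> E \<and> C \<noteq> {} \<and> finite C \<and>
     (\<forall>v\<in>\<Union>C. card {e\<in>C. v \<in> e} = 2) \<and>
     (\<forall>e1\<in>C. \<forall>e2\<in>C. (e1, e2) \<in> {(x, y). x \<in> C \<and> y \<in> C \<and> x \<inter> y \<noteq> {}}\<^sup>*)"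

text \<open>A polytopal map with underlying graph (V,E), given by its set F of faces:
  faces are cycles, every edge lies on exactly two faces, and the faces around each
  vertex form a single cycle (so that the glued complex is a closed surface).\<close>
definition is_polytopal_map :: "'v set \<Rightarrow> 'v set set \<Rightarrow> 'v set set set \<Rightarrow> bool" where
  "is_polytopal_map V E F \<longleftrightarrow> simple_graph V E \<and> graph_connected V E \<and>
     (\<forall>f\<in>F. is_cycle_face E f) \<and>
     (\<forall>e\<in>E. card {f\<in>F. e \<in> f} = 2) \<and>
     (\<forall>v\<in>V. \<forall>e1\<in>{e\<in>E. v \<in> e}. \<forall>e2\<in>{e\<in>E. v \<in> e}.
        (e1, e2) \<in> {(x, y). v \<in> x \<and> v \<in> y \<and> (\<exists>f\<in>F. x \<in> f \<and> y \<in> f)}\<^sup>*)"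

definition flags :: "'v set set set \<Rightarrow> ('v \<times> 'v set \<times> 'v set set) set" where
  "flags F = {(v, e, f). f \<in> F \<and> e \<in> f \<and> v \<in> e}"

definition face_img :: "('v \<Rightarrow> 'v) \<Rightarrow> 'v set set \<Rightarrow> 'v set set" where
  "face_img \<sigma> f = (\<lambda>e. \<sigma> ` e) ` f"

definition flag_act :: "('v \<Rightarrow> 'v) \<Rightarrow> 'v \<times> 'v set \<times> 'v set set \<Rightarrow> 'v \<times> 'v set \<times> 'v set set" where
  "flag_act \<sigma> \<Phi> = (case \<Phi> of (v, e, f) \<Rightarrow> (\<sigma> v, \<sigma> ` e, face_img \<sigma> f))"

definition graph_aut :: "'v set \<Rightarrow> 'v set set \<Rightarrow> ('v \<Rightarrow> 'v) \<Rightarrow> bool" where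
  "graph_aut V E \<sigma> \<longleftrightarrow> bij_betw \<sigma> V V \<and>
     (\<forall>u\<in>V. \<forall>w\<in>V. {u, w} \<in> E \<longleftrightarrow> {\<sigma> u, \<sigma> w} \<in> E)"

text \<open>Aut(M): graph automorphisms preserving the set of faces.\<close>
definition map_aut :: "'v set \<Rightarrow> 'v set set \<Rightarrow> 'v set set set \<Rightarrow> ('v \<Rightarrow> 'v) \<Rightarrow> bool" where
  "map_aut V E F \<sigma> \<longleftrightarrow> graph_aut V E \<sigma> \<and> face_img \<sigma> ` F = F"

definition flag_orbit_rel :: "'v set \<Rightarrow> 'v set set \<Rightarrow> 'v set set set
    \<Rightarrow> (('v \<times> 'v set \<times> 'v set set) \<times> ('v \<times> 'v set \<times> 'v set set)) set" where
  "flag_orbit_rel V E F = {(\<Phi>, \<Psi>). \<Phi> \<in> flags F \<and> \<Psi> \<in> flags F \<and>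
     (\<exists>\<sigma>. map_aut V E F \<sigma> \<and> flag_act \<sigma> \<Phi> = \<Psi>)}"

text \<open>Class 2_{0,1}: exactly two flag orbits; Phi^0 and Phi^1 in the orbit of Phi, Phi^2 not.\<close>
definition class_2_01 :: "'v set \<Rightarrow> 'v set set \<Rightarrow> 'v set set set \<Rightarrow> bool" where
  "class_2_01 V E F \<longleftrightarrow>
     card (flags F // flag_orbit_rel V E F) = 2 \<and>
     (\<forall>v e f. (v, e, f) \<in> flags F \<longrightarrow>
        (\<forall>v'. v' \<noteq> v \<and> (v', e, f) \<in> flags F \<longrightarrow> ((v, e, f), (v', e, f)) \<in> flag_orbit_rel V E F) \<and>
        (\<forall>e'. e' \<noteq> e \<and> (v, e', f) \<in> flags F \<longrightarrow> ((v, e, f), (v, e', f)) \<in> flag_orbit_rel V E F) \<and>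
        (\<forall>f'. f' \<noteq> f \<and> (v, e, f') \<in> flags F \<longrightarrow> ((v, e, f), (v, e, f')) \<notin> flag_orbit_rel V E F))"

text \<open>Map isomorphism between two maps with the same underlying graph.\<close>
definition map_iso :: "'v set \<Rightarrow> 'v set set \<Rightarrow> 'v set set set \<Rightarrow> 'v set set set \<Rightarrow> bool" where
  "map_iso V E F1 F2 \<longleftrightarrow> (\<exists>\<sigma>. graph_aut V E \<sigma> \<and> face_img \<sigma> ` F1 = F2)"

definition class201_maps :: "'v set \<Rightarrow> 'v set set \<Rightarrow> 'v set set set set" where
  "class201_maps V E = {F. is_polytopal_map V E F \<and> class_2_01 V E F}"

definition iso_classes :: "'v set \<Rightarrow> 'v set set \<Rightarrow> 'v set set set set \<Rightarrow> 'v set set set set set" where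
  "iso_classes V E S = S // {(F1, F2). F1 \<in> S \<and> F2 \<in> S \<and> map_iso V E F1 F2}"

text \<open>Number of isomorphism classes of class 2_{0,1} maps on R_n(2,1), and those
  whose set of face lengths is L.\<close>
definition num_maps :: "nat \<Rightarrow> nat" where
  "num_maps n = card (iso_classes (rw_vertices n) (rw_edges n 2 1)
                        (class201_maps (rw_vertices n) (rw_edges n 2 1)))"

definition num_maps_len :: "nat \<Rightarrow> nat set \<Rightarrow> nat" where
  "num_maps_len n L = card (iso_classes (rw_vertices n) (rw_edges n 2 1)
     {F \<in> class201_maps (rw_vertices n) (rw_edges n 2 1). card ` F = L})"

end

theory Submission
  imports Defs
begin

text \<open>Putting x_i and y_{i-1} into the i-th fibre identifies R_n(2,1) with the wreath graph
  C_n[2K_1], in which two vertices are adjacent exactly when their fibres are consecutive.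
  In a map of class 2_{0,1} the faces split into two kinds A and B, each edge lies on one face of
  either kind, and the automorphism group preserves both kinds and is transitive on arcs. The fibres
  may be taken to be blocks (for n = 4, where the graph is K_{4,4}, after choosing the fibres
  suitably), so at all corners faces of one kind either turn back into the same fibre or pass
  straight on. If they turn back, they are the 4-cycles between consecutive fibres. If they
  pass straight on, they are the paths of the four solutions t of a recursion
  t(i+1) = t(i-1) + b(i) or t(i+1) = t(i-1) + t(i) + b(i) modulo 2, that is, of a coset of the 2-periodic
  or of the Fibonacci sequences; as faces are cycles, each t satisfies t(i+n) = t(i) for all i, or
  t(i+n) = t(i) + 1 for all i. Relabelling the fibres brings b to one of few normal forms, and the
  cases in which A and B can be interchanged are not of class 2_{0,1}.\<close>

section \<open>Isomorphisms of maps\<close>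

text \<open>A straight face entering the vertex s of fibre i from fibre i-1 leaves by a bijection of
  two-element fibres, so the exit is the entry plus some b(i,s) modulo 2. In b(i,s) = b(i) + c(i) s,
  arc-transitivity and invariant fibres force c(i) to be one constant c; hence just two recursions.
  Their homogeneous solutions have periods 2 and 3, and closing up after n fibres needs 2 | n or 3 |
  n, which is the condition on gcd(n,6). For c = 1 a flip t(i+n) = t(i) + 1 contradicts the
  recursion. Relabelling the fibres by an n-periodic r turns a particular solution g into g + r, so
  only c and the bit \<open>\<kappa>\<close>, telling whether sequences flip after n steps, survive
  in the normal form. If both kinds are straight, their exits disagree at every corner, so they have
  the same c and complementary b; a periodic relabelling then swaps A and B unless c = 0 and n is 2
  modulo 4. For n = 4 and \<open>\<kappa>\<close> = 0 the swap comes from a symmetry that does not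
  preserve the fibres. Lengths separate the remaining maps except the two with lengths 4 and n;
  these differ in whether disjoint faces of length n exist.\<close>

lemma card_quotient_eq_card_reps:
  assumes eq: "equiv S r" and R: "R \<subseteq> S"
    and ex: "\<And>x. x \<in> S \<Longrightarrow> \<exists>y\<in>R. (x, y) \<in> r"
    and un: "\<And>x y. x \<in> R \<Longrightarrow> y \<in> R \<Longrightarrow> (x, y) \<in> r \<Longrightarrow> x = y"
  shows "card (S // r) = card R"
proof -
  have "bij_betw (\<lambda>x. r `` {x}) R (S // r)"
    unfolding bij_betw_def
  proof
    show "inj_on (\<lambda>x. r `` {x}) R"
      using R un eq_equiv_class_iff[OF eq] by (auto simp: inj_on_def subset_iff)
    show "(\<lambda>x. r `` {x}) ` R = S // r"
    proof
      show "(\<lambda>x. r `` {x}) ` R \<subseteq> S // r"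
        using R by (auto intro: quotientI)
      show "S // r \<subseteq> (\<lambda>x. r `` {x}) ` R"
      proof
        fix X assume "X \<in> S // r"
        then obtain x where x: "x \<in> S" "X = r `` {x}" by (auto elim: quotientE)
        then obtain y where "y \<in> R" "(x, y) \<in> r" using ex by blast
        then show "X \<in> (\<lambda>x. r `` {x}) ` R"
          using x equiv_class_eq[OF eq] by auto
      qed
    qed
  qed
  then show ?thesis by (simp add: bij_betw_same_card)
qed

lemma face_img_comp: "face_img \<sigma> (face_img \<tau> f) = face_img (\<sigma> \<circ> \<tau>) f"
  by (simp add: face_img_def image_comp comp_def)

lemma face_img_id_on:
  assumes "f \<subseteq> Pow V" "\<And>v. v \<in> V \<Longrightarrow> \<sigma> v = v"
  shows "face_img \<sigma> f = f"
proof -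
  have "\<sigma> ` e = e" if "e \<in> f" for e
  proof -
    have "\<sigma> v = v" if "v \<in> e" for v using assms \<open>e \<in> f\<close> that by blast
    then show ?thesis by (auto simp: image_iff)
  qed
  then show ?thesis by (simp add: face_img_def)
qed

lemma card_face_img:
  assumes "f \<subseteq> Pow V" "inj_on \<sigma> V"
  shows "card (face_img \<sigma> f) = card f"
  unfolding face_img_def
  by (rule card_image) (meson assms inj_on_image_Pow inj_on_subset)

lemma simple_graph_Pow: "simple_graph V E \<Longrightarrow> E \<subseteq> Pow V"
  unfolding simple_graph_def by auto

lemma simple_graph_edgeE:
  assumes "simple_graph V E" "e \<in> E"
  obtains u w where "u \<in> V" "w \<in> V" "u \<noteq> w" "e = {u, w}"
  using assms unfolding simple_graph_def by auto

lemma graph_aut_id: "graph_aut V E id"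
  by (simp add: graph_aut_def bij_betw_def)

lemma graph_aut_comp:
  assumes "graph_aut V E \<sigma>" "graph_aut V E \<tau>"
  shows "graph_aut V E (\<sigma> \<circ> \<tau>)"
proof -
  have b: "bij_betw \<sigma> V V" "bij_betw \<tau> V V" using assms by (simp_all add: graph_aut_def)
  have "{u, w} \<in> E \<longleftrightarrow> {\<sigma> (\<tau> u), \<sigma> (\<tau> w)} \<in> E" if "u \<in> V" "w \<in> V" for u w
  proof -
    have "\<tau> u \<in> V" "\<tau> w \<in> V" using that bij_betwE[OF b(2)] by auto
    then show ?thesis using assms that by (simp add: graph_aut_def)
  qed
  then show ?thesis using bij_betw_trans[OF b(2,1)] by (simp add: graph_aut_def)
qed

lemma graph_aut_inverse:
  assumes "graph_aut V E \<sigma>"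
  obtains \<tau> where "graph_aut V E \<tau>" "\<And>v. v \<in> V \<Longrightarrow> \<tau> (\<sigma> v) = v" "\<And>v. v \<in> V \<Longrightarrow> \<sigma> (\<tau> v) = v"
proof
  let ?t = "inv_into V \<sigma>"
  have b: "bij_betw \<sigma> V V" using assms by (simp add: graph_aut_def)
  then show 1: "?t (\<sigma> v) = v" if "v \<in> V" for v
    using that by (simp add: bij_betw_inv_into_left)
  show 2: "\<sigma> (?t v) = v" if "v \<in> V" for v
    using b that by (simp add: bij_betw_inv_into_right)
  have b': "bij_betw ?t V V" using b by (rule bij_betw_inv_into)
  moreover have "{u, w} \<in> E \<longleftrightarrow> {?t u, ?t w} \<in> E" if "u \<in> V" "w \<in> V" for u w
  proof -
    have "?t u \<in> V" "?t w \<in> V" using that bij_betwE[OF b'] by auto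
    then have "{?t u, ?t w} \<in> E \<longleftrightarrow> {\<sigma> (?t u), \<sigma> (?t w)} \<in> E"
      using assms by (simp add: graph_aut_def)
    then show ?thesis using that by (simp add: 2)
  qed
  ultimately show "graph_aut V E ?t" by (simp add: graph_aut_def)
qed

lemma graph_aut_inj: "graph_aut V E \<sigma> \<Longrightarrow> inj_on \<sigma> V"
  by (simp add: graph_aut_def bij_betw_def)

lemma face_img_inverse:
  assumes "\<And>v. v \<in> V \<Longrightarrow> \<tau> (\<sigma> v) = v" "f \<subseteq> Pow V"
  shows "face_img \<tau> (face_img \<sigma> f) = f"
  unfolding face_img_comp using assms by (intro face_img_id_on) auto

lemma face_img_image_inverse:
  assumes "\<And>v. v \<in> V \<Longrightarrow> \<tau> (\<sigma> v) = v" "F \<subseteq> Pow (Pow V)"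
  shows "face_img \<tau> ` face_img \<sigma> ` F = F"
proof -
  have "face_img \<tau> (face_img \<sigma> f) = f" if "f \<in> F" for f
    using assms that by (intro face_img_inverse[of V]) auto
  then show ?thesis by (simp add: image_image)
qed

lemma map_aut_comp:
  assumes "map_aut V E F \<sigma>" "map_aut V E F \<tau>"
  shows "map_aut V E F (\<sigma> \<circ> \<tau>)"
proof -
  have "face_img (\<sigma> \<circ> \<tau>) ` F = face_img \<sigma> ` face_img \<tau> ` F"
    by (simp add: image_image face_img_comp)
  then show ?thesis using assms by (simp add: map_aut_def graph_aut_comp)
qed

lemma map_aut_inverse:
  assumes "map_aut V E F \<sigma>" "F \<subseteq> Pow (Pow V)"
  obtains \<tau> where "map_aut V E F \<tau>" "\<And>v. v \<in> V \<Longrightarrow> \<tau> (\<sigma> v) = v" "\<And>v. v \<in> V \<Longrightarrow> \<sigma> (\<tau> v) = v"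
proof -
  obtain \<tau> where t: "graph_aut V E \<tau>" "\<And>v. v \<in> V \<Longrightarrow> \<tau> (\<sigma> v) = v" "\<And>v. v \<in> V \<Longrightarrow> \<sigma> (\<tau> v) = v"
    using assms(1) graph_aut_inverse[of V E \<sigma>] unfolding map_aut_def by blast
  have "face_img \<tau> ` F = F"
    using face_img_image_inverse[of V \<tau> \<sigma> F, OF t(2) assms(2)] assms(1) by (simp add: map_aut_def)
  with t show thesis by (intro that) (auto simp: map_aut_def)
qed

lemma polytopal_faces:
  assumes "is_polytopal_map V E F"
  shows "simple_graph V E" "\<And>f. f \<in> F \<Longrightarrow> f \<subseteq> E" "F \<subseteq> Pow (Pow V)"
proof -
  show g: "simple_graph V E" using assms by (simp add: is_polytopal_map_def)
  show f: "f \<subseteq> E" if "f \<in> F" for f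
    using assms that by (simp add: is_polytopal_map_def is_cycle_face_def)
  show "F \<subseteq> Pow (Pow V)"
    using f simple_graph_Pow[OF g] by auto
qed

text \<open>Polytopality places every face inside \<open>Pow V\<close>. A graph automorphism is
  controlled on \<open>V\<close> only, so its inverse undoes it just on such faces.\<close>

lemma equiv_map_iso:
  assumes "\<And>F. F \<in> S \<Longrightarrow> is_polytopal_map V E F"
  shows "equiv S {(F1, F2). F1 \<in> S \<and> F2 \<in> S \<and> map_iso V E F1 F2}"
proof (rule equivI)
  have "map_iso V E F F" if "F \<in> S" for F
  proof -
    have "face_img id ` F = F"
      using face_img_image_inverse[of V id id F] polytopal_faces(3)[OF assms[OF that]]
      by (simp add: face_img_def)
    then show ?thesis unfolding map_iso_def using graph_aut_id by blast
  qed
  then show "refl_on S {(F1, F2). F1 \<in> S \<and> F2 \<in> S \<and> map_iso V E F1 F2}"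
    by (auto simp: refl_on_def)
  have "map_iso V E F2 F1" if h: "F1 \<in> S" "map_iso V E F1 F2" for F1 F2
  proof -
    obtain \<sigma> where s: "graph_aut V E \<sigma>" "face_img \<sigma> ` F1 = F2" using h unfolding map_iso_def by blast
    obtain \<tau> where t: "graph_aut V E \<tau>" "\<And>v. v \<in> V \<Longrightarrow> \<tau> (\<sigma> v) = v" "\<And>v. v \<in> V \<Longrightarrow> \<sigma> (\<tau> v) = v"
      using graph_aut_inverse[OF s(1)] by blast
    have "face_img \<tau> ` F2 = F1"
      using face_img_image_inverse[of V \<tau> \<sigma> F1, OF t(2) polytopal_faces(3)[OF assms[OF h(1)]]] s(2) by simp
    then show ?thesis using t(1) by (auto simp: map_iso_def)
  qed
  then show "sym {(F1, F2). F1 \<in> S \<and> F2 \<in> S \<and> map_iso V E F1 F2}"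
    by (auto simp: sym_def)
  have "map_iso V E F1 F3" if h: "map_iso V E F1 F2" "map_iso V E F2 F3" for F1 F2 F3
  proof -
    obtain \<sigma> \<tau> where "graph_aut V E \<sigma>" "face_img \<sigma> ` F1 = F2" "graph_aut V E \<tau>" "face_img \<tau> ` F2 = F3"
      using h unfolding map_iso_def by blast
    moreover have "face_img (\<tau> \<circ> \<sigma>) ` F1 = face_img \<tau> ` face_img \<sigma> ` F1"
      by (simp add: image_image face_img_comp)
    ultimately show ?thesis
      unfolding map_iso_def using graph_aut_comp by metis
  qed
  then show "trans {(F1, F2). F1 \<in> S \<and> F2 \<in> S \<and> map_iso V E F1 F2}"
    unfolding trans_def by blast
qed auto

lemma map_iso_card_faces:
  assumes "map_iso V E F1 F2" "F1 \<subseteq> Pow (Pow V)"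
  shows "card ` F2 = card ` F1"
proof -
  obtain \<sigma> where s: "graph_aut V E \<sigma>" "face_img \<sigma> ` F1 = F2" using assms unfolding map_iso_def by blast
  have "card (face_img \<sigma> f) = card f" if "f \<in> F1" for f
    using that assms(2) graph_aut_inj[OF s(1)] by (intro card_face_img[of _ V]) auto
  then show ?thesis unfolding s(2)[symmetric] by (simp add: image_image)
qed

section \<open>Flag orbits\<close>

lemma equiv_flag_orbit_rel:
  assumes "F \<subseteq> Pow (Pow V)"
  shows "equiv (flags F) (flag_orbit_rel V E F)"
proof (rule equivI)
  have sub: "v \<in> V" "e \<subseteq> V" "f \<subseteq> Pow V" if "(v, e, f) \<in> flags F" for v e f
    using that assms unfolding flags_def by auto
  have act_id: "flag_act \<sigma> \<Phi> = \<Phi>" if "\<Phi> \<in> flags F" "\<And>v. v \<in> V \<Longrightarrow> \<sigma> v = v" for \<sigma> \<Phi>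
  proof -
    obtain v e f where p: "\<Phi> = (v, e, f)" by (cases \<Phi>)
    have "\<sigma> v = v" using sub that p by blast
    moreover have "\<sigma> ` e = e"
      using face_img_id_on[of "{e}" V \<sigma>] sub(2)[of v e f] that p by (auto simp: face_img_def)
    moreover have "face_img \<sigma> f = f"
      using sub(3)[of v e f] that p by (intro face_img_id_on[of _ V]) auto
    ultimately show ?thesis by (simp add: p flag_act_def)
  qed
  have act_comp: "flag_act \<sigma> (flag_act \<tau> \<Phi>) = flag_act (\<sigma> \<circ> \<tau>) \<Phi>" for \<sigma> \<tau> \<Phi>
    by (simp add: flag_act_def face_img_comp image_comp split: prod.split)
  have "map_aut V E F id"
    using face_img_image_inverse[of V id id F] assms
    by (simp add: map_aut_def graph_aut_id) (simp add: face_img_def)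
  then show "refl_on (flags F) (flag_orbit_rel V E F)"
    using act_id[of _ id] unfolding flag_orbit_rel_def refl_on_def by auto
  show "sym (flag_orbit_rel V E F)"
  proof (rule symI)
    fix \<Phi> \<Psi> assume "(\<Phi>, \<Psi>) \<in> flag_orbit_rel V E F"
    then obtain \<sigma> where s: "\<Phi> \<in> flags F" "\<Psi> \<in> flags F" "map_aut V E F \<sigma>" "flag_act \<sigma> \<Phi> = \<Psi>"
      by (auto simp: flag_orbit_rel_def)
    obtain \<tau> where t: "map_aut V E F \<tau>" "\<And>v. v \<in> V \<Longrightarrow> \<tau> (\<sigma> v) = v" "\<And>v. v \<in> V \<Longrightarrow> \<sigma> (\<tau> v) = v"
      using map_aut_inverse[OF s(3) assms] by blast
    have "flag_act \<tau> \<Psi> = \<Phi>" unfolding s(4)[symmetric] act_comp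
      by (rule act_id) (use s t in auto)
    with s t show "(\<Psi>, \<Phi>) \<in> flag_orbit_rel V E F"
      by (auto simp: flag_orbit_rel_def)
  qed
  show "trans (flag_orbit_rel V E F)"
  proof (rule transI)
    fix \<Phi> \<Psi> \<Theta> assume "(\<Phi>, \<Psi>) \<in> flag_orbit_rel V E F" "(\<Psi>, \<Theta>) \<in> flag_orbit_rel V E F"
    then obtain \<sigma> \<tau> where "\<Phi> \<in> flags F" "\<Theta> \<in> flags F" "map_aut V E F \<sigma>" "map_aut V E F \<tau>"
       "flag_act \<tau> (flag_act \<sigma> \<Phi>) = \<Theta>"
      by (auto simp: flag_orbit_rel_def)
    then show "(\<Phi>, \<Theta>) \<in> flag_orbit_rel V E F"
      unfolding flag_orbit_rel_def act_comp using map_aut_comp by blast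
  qed
qed (auto simp: flag_orbit_rel_def)

section \<open>Splitting the faces into two kinds\<close>

text \<open>A and B are the faces with a flag in the first and in the second flag orbit.\<close>
definition split_map :: "'v set \<Rightarrow> 'v set set \<Rightarrow> 'v set set set \<Rightarrow> 'v set set set \<Rightarrow> 'v set set set \<Rightarrow> bool" where
  "split_map V E F A B \<longleftrightarrow> F = A \<union> B \<and> A \<inter> B = {} \<and>
     (\<forall>e\<in>E. \<exists>!f. f \<in> A \<and> e \<in> f) \<and> (\<forall>e\<in>E. \<exists>!f. f \<in> B \<and> e \<in> f) \<and>
     (\<forall>\<sigma>. map_aut V E F \<sigma> \<longrightarrow> face_img \<sigma> ` A = A \<and> face_img \<sigma> ` B = B) \<and>
     (\<forall>u v u' v'. {u, v} \<in> E \<longrightarrow> {u', v'} \<in> E \<longrightarrow> (\<exists>\<sigma>. map_aut V E F \<sigma> \<and> \<sigma> u = u' \<and> \<sigma> v = v'))"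

lemma split_map_sym: "split_map V E F A B \<Longrightarrow> split_map V E F B A"
  unfolding split_map_def by (simp only: Un_commute[of A B] Int_commute[of A B]) (elim conjE, intro conjI; simp)

text \<open>Any two edges of a face are linked by a chain of edges with common vertices. Changing
  the vertex on an edge and changing the edge at a common vertex both stay in one orbit, so the
  chain does too.\<close>

lemma class_2_01_face_orbit:
  assumes pm: "is_polytopal_map V E F" and cl: "class_2_01 V E F"
    and fl: "(v, e, f) \<in> flags F" "(v', e', f) \<in> flags F"
  shows "((v, e, f), (v', e', f)) \<in> flag_orbit_rel V E F"
proof -
  let ?R = "flag_orbit_rel V E F"
  have eq: "equiv (flags F) ?R"
    using equiv_flag_orbit_rel polytopal_faces(3)[OF pm] by blast
  have tr: "(x, z) \<in> ?R" if "(x, y) \<in> ?R" "(y, z) \<in> ?R" for x y z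
    using eq that by (meson equivE transE)
  have a0: "((x, e, f), (y, e, f)) \<in> ?R" if "(x, e, f) \<in> flags F" "(y, e, f) \<in> flags F" for x y e
  proof (cases "x = y")
    case True
    then show ?thesis using eq that by (meson equivE refl_onD)
  next
    case False
    then show ?thesis using cl that unfolding class_2_01_def by metis
  qed
  have a1: "((x, d, f), (x, d', f)) \<in> ?R" if "(x, d, f) \<in> flags F" "(x, d', f) \<in> flags F" for x d d'
  proof (cases "d = d'")
    case True
    then show ?thesis using eq that by (meson equivE refl_onD)
  next
    case False
    then show ?thesis using cl that unfolding class_2_01_def by metis
  qed
  have f: "f \<in> F" "e \<in> f" "e' \<in> f" "v \<in> e" "v' \<in> e'" using fl by (auto simp: flags_def)
  have cyc: "(e, e') \<in> {(x, y). x \<in> f \<and> y \<in> f \<and> x \<inter> y \<noteq> {}}\<^sup>*"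
    using pm f by (simp add: is_polytopal_map_def is_cycle_face_def)
  then have "\<forall>w\<in>e'. ((v, e, f), (w, e', f)) \<in> ?R"
  proof (induction rule: rtrancl_induct)
    case base
    show ?case using a0 f by (auto simp: flags_def)
  next
    case (step d d')
    then obtain w where w: "w \<in> d" "w \<in> d'" "d \<in> f" "d' \<in> f" by auto
    show ?case
    proof
      fix u assume "u \<in> d'"
      have "((v, e, f), (w, d, f)) \<in> ?R" using step.IH w by blast
      moreover have "((w, d, f), (w, d', f)) \<in> ?R" using a1 w f by (auto simp: flags_def)
      moreover have "((w, d', f), (u, d', f)) \<in> ?R" using a0 w f \<open>u \<in> d'\<close> by (auto simp: flags_def)
      ultimately show "((v, e, f), (u, d', f)) \<in> ?R" using tr by blast
    qed
  qed
  then show ?thesis using f by blast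
qed

text \<open>The two faces at one edge give flags that differ only in the face, hence representatives
  of the two orbits. As all flags of a face lie in one orbit, the orbits sort the faces
  themselves.\<close>

lemma class_2_01_imp_split:
  assumes pm: "is_polytopal_map V E F" and cl: "class_2_01 V E F" and ne: "E \<noteq> {}"
  obtains A B where "split_map V E F A B"
proof -
  let ?R = "flag_orbit_rel V E F"
  have sg: "simple_graph V E" using polytopal_faces(1)[OF pm] .
  have eq: "equiv (flags F) ?R"
    using equiv_flag_orbit_rel polytopal_faces(3)[OF pm] by blast
  have tr: "(x, z) \<in> ?R" if "(x, y) \<in> ?R" "(y, z) \<in> ?R" for x y z
    using eq that by (meson equivE transE)
  have sy: "(y, x) \<in> ?R" if "(x, y) \<in> ?R" for x y
    using eq that by (meson equivE symE)
  have two: "\<exists>f1 f2. f1 \<noteq> f2 \<and> {f \<in> F. e \<in> f} = {f1, f2}" if "e \<in> E" for e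
    using pm that unfolding is_polytopal_map_def by (metis (no_types, lifting) card_2_iff)
  have n2: "((v, e, f), (v, e, f')) \<notin> ?R" if "(v, e, f) \<in> flags F" "(v, e, f') \<in> flags F" "f \<noteq> f'" for v e f f'
    using cl that unfolding class_2_01_def by metis
  obtain e0 where e0: "e0 \<in> E" using ne by auto
  obtain v0 where v0: "v0 \<in> e0" using sg e0 by (metis insertI1 simple_graph_edgeE)
  obtain f1 f2 where f12: "f1 \<noteq> f2" "{f \<in> F. e0 \<in> f} = {f1, f2}" using two[OF e0] by blast
  define P where "P = (v0, e0, f1)"
  define Q where "Q = (v0, e0, f2)"
  have fl: "P \<in> flags F" "Q \<in> flags F" using f12 v0 by (auto simp: P_def Q_def flags_def)
  have PQ: "(P, Q) \<notin> ?R" using n2 fl f12(1) unfolding P_def Q_def by blast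
  have quo: "flags F // ?R = {?R `` {P}, ?R `` {Q}}"
  proof -
    have c: "card (flags F // ?R) = 2" using cl by (simp add: class_2_01_def)
    have "?R `` {P} \<noteq> ?R `` {Q}" using PQ fl eq_equiv_class_iff[OF eq] by blast
    then have "card {?R `` {P}, ?R `` {Q}} = 2" by simp
    moreover have "{?R `` {P}, ?R `` {Q}} \<subseteq> flags F // ?R" using fl by (auto intro: quotientI)
    moreover have "finite (flags F // ?R)" using c by (metis card.infinite zero_neq_numeral)
    ultimately show ?thesis using c by (metis card_subset_eq)
  qed
  have PorQ: "(P, x) \<in> ?R \<or> (Q, x) \<in> ?R" if "x \<in> flags F" for x
  proof -
    have "?R `` {x} \<in> {?R `` {P}, ?R `` {Q}}" unfolding quo[symmetric] using that by (rule quotientI)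
    then have "?R `` {x} = ?R `` {P} \<or> ?R `` {x} = ?R `` {Q}" by simp
    moreover have "x \<in> ?R `` {x}" using equiv_class_self[OF eq that] .
    ultimately show ?thesis by blast
  qed
  have nPQ: "\<not> ((P, x) \<in> ?R \<and> (Q, x) \<in> ?R)" for x using PQ tr sy by blast
  have relfl: "x \<in> flags F" "y \<in> flags F" if "(x, y) \<in> ?R" for x y
    using that by (auto simp: flag_orbit_rel_def)
  define A where "A = {f. \<exists>v e. (P, (v, e, f)) \<in> ?R}"
  define B where "B = {f. \<exists>v e. (Q, (v, e, f)) \<in> ?R}"
  have spread: "(p, (v, e, f)) \<in> ?R" if h: "(p, (v', e', f)) \<in> ?R" "(v, e, f) \<in> flags F" for p v e v' e' f
    using tr[OF h(1) class_2_01_face_orbit[OF pm cl relfl(2)[OF h(1)] h(2)]] .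
  have Aall: "(P, (v, e, f)) \<in> ?R" if fA: "f \<in> A" "(v, e, f) \<in> flags F" for v e f
    using fA(1) spread[OF _ fA(2)] unfolding A_def by blast
  have Ball: "(Q, (v, e, f)) \<in> ?R" if fB: "f \<in> B" "(v, e, f) \<in> flags F" for v e f
    using fB(1) spread[OF _ fB(2)] unfolding B_def by blast
  have Asub: "A \<subseteq> F" "B \<subseteq> F" unfolding A_def B_def flag_orbit_rel_def flags_def by auto
  have flex: "\<exists>v e. (v, e, f) \<in> flags F" if "f \<in> F" for f
  proof -
    have "f \<noteq> {}" using pm that by (simp add: is_polytopal_map_def is_cycle_face_def)
    then obtain e where "e \<in> f" by blast
    then have "e \<in> E" using polytopal_faces(2)[OF pm that] by blast
    then obtain v where "v \<in> e" using sg by (metis insertI1 simple_graph_edgeE)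
    with \<open>e \<in> f\<close> that show ?thesis by (auto simp: flags_def)
  qed
  have un: "F = A \<union> B"
    using Asub flex PorQ unfolding A_def B_def by blast
  have dis: "A \<inter> B = {}"
    using Asub flex Aall Ball nPQ by blast
  have uniq: "(\<exists>!f. f \<in> A \<and> e \<in> f) \<and> (\<exists>!f. f \<in> B \<and> e \<in> f)" if e: "e \<in> E" for e
  proof -
    obtain v where v: "v \<in> e" using sg e by (metis insertI1 simple_graph_edgeE)
    obtain g1 g2 where g: "g1 \<noteq> g2" "{f \<in> F. e \<in> f} = {g1, g2}" using two[OF e] by blast
    have gf: "(v, e, g1) \<in> flags F" "(v, e, g2) \<in> flags F" using g v by (auto simp: flags_def)
    have nr: "((v, e, g1), (v, e, g2)) \<notin> ?R" using n2 gf g(1) by blast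
    have "\<not> (g1 \<in> A \<and> g2 \<in> A)" "\<not> (g1 \<in> B \<and> g2 \<in> B)"
      using nr Aall Ball gf tr sy by blast+
    moreover have "g1 \<in> A \<or> g1 \<in> B" "g2 \<in> A \<or> g2 \<in> B" "e \<in> g1" "e \<in> g2" using g un by blast+
    moreover have "f = g1 \<or> f = g2" if "f \<in> A \<union> B" "e \<in> f" for f using g that un by blast
    ultimately show ?thesis by blast
  qed
  have inv: "face_img \<sigma> ` A = A \<and> face_img \<sigma> ` B = B" if s: "map_aut V E F \<sigma>" for \<sigma>
  proof -
    have act: "((v, e, f), (\<sigma> v, \<sigma> ` e, face_img \<sigma> f)) \<in> ?R" if "(v, e, f) \<in> flags F" for v e f
    proof -
      have "(\<sigma> v, \<sigma> ` e, face_img \<sigma> f) \<in> flags F"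
        using that s unfolding flags_def map_aut_def by (auto simp: face_img_def)
      then show ?thesis using s that unfolding flag_orbit_rel_def by (auto simp: flag_act_def)
    qed
    have iA: "face_img \<sigma> f \<in> A" if "f \<in> A" for f
    proof -
      obtain v e where ve: "(P, (v, e, f)) \<in> ?R" using \<open>f \<in> A\<close> unfolding A_def by blast
      then have "(P, (\<sigma> v, \<sigma> ` e, face_img \<sigma> f)) \<in> ?R" using act relfl(2) tr by blast
      then show ?thesis unfolding A_def by blast
    qed
    have iB: "face_img \<sigma> f \<in> B" if "f \<in> B" for f
    proof -
      obtain v e where ve: "(Q, (v, e, f)) \<in> ?R" using \<open>f \<in> B\<close> unfolding B_def by blast
      then have "(Q, (\<sigma> v, \<sigma> ` e, face_img \<sigma> f)) \<in> ?R" using act relfl(2) tr by blast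
      then show ?thesis unfolding B_def by blast
    qed
    \<comment> \<open>Two inclusions that together exhaust a disjoint union are equalities.\<close>
    have u: "X = A \<and> Y = B" if "X \<subseteq> A" "Y \<subseteq> B" "X \<union> Y = A \<union> B" for X Y
      using that dis by blast
    have "face_img \<sigma> ` A \<union> face_img \<sigma> ` B = A \<union> B"
      using s un by (simp add: map_aut_def image_Un)
    moreover have "face_img \<sigma> ` A \<subseteq> A" "face_img \<sigma> ` B \<subseteq> B" using iA iB by (auto intro: image_subsetI)
    ultimately show ?thesis by (intro u)
  qed
  \<comment> \<open>Each arc is completed to a flag by its A-face. The two flags share an orbit, and
    the image of the first endpoint determines that of the second.\<close>
  have arc: "\<exists>\<sigma>. map_aut V E F \<sigma> \<and> \<sigma> u = u' \<and> \<sigma> v = v'" if uv: "{u, v} \<in> E" "{u', v'} \<in> E" for u v u' v'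
  proof -
    obtain f where f1: "f \<in> A" "{u, v} \<in> f" using ex1_implies_ex[OF conjunct1[OF uniq[OF uv(1)]]] by auto
    obtain f' where f2: "f' \<in> A" "{u', v'} \<in> f'" using ex1_implies_ex[OF conjunct1[OF uniq[OF uv(2)]]] by auto
    note f = f1 f2
    have "(u, {u, v}, f) \<in> flags F" "(u', {u', v'}, f') \<in> flags F" using f Asub by (auto simp: flags_def)
    then have "((u, {u, v}, f), (u', {u', v'}, f')) \<in> ?R" using Aall f tr sy by blast
    then obtain \<sigma> where s: "map_aut V E F \<sigma>" "\<sigma> u = u'" "\<sigma> ` {u, v} = {u', v'}"
      by (auto simp: flag_orbit_rel_def flag_act_def)
    have "u' \<noteq> v'" using simple_graph_edgeE[OF sg uv(2)] by (auto simp: doubleton_eq_iff)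
    then have "\<sigma> v = v'" using s by (auto simp: doubleton_eq_iff)
    then show ?thesis using s by blast
  qed
  have "split_map V E F A B"
    unfolding split_map_def using un dis uniq inv arc by (intro conjI ballI allI impI) simp_all
  then show thesis by (rule that)
qed

text \<open>An automorphism moving one arc to another moves the A-face on the first to the A-face on
  the second, by uniqueness, and likewise for B. So the flags of each kind form one orbit, and the
  kinds never mix.\<close>

lemma split_imp_class_2_01:
  assumes pm: "is_polytopal_map V E F" and sp: "split_map V E F A B" and ne: "E \<noteq> {}"
  shows "class_2_01 V E F"
proof -
  let ?R = "flag_orbit_rel V E F"
  have sg: "simple_graph V E" using polytopal_faces(1)[OF pm] .
  note S = sp[unfolded split_map_def]
  note S2 = S[THEN conjunct2]
  note S3 = S2[THEN conjunct2]
  note S4 = S3[THEN conjunct2]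
  note S5 = S4[THEN conjunct2]
  have un: "F = A \<union> B" using S by (rule conjunct1)
  have dis: "A \<inter> B = {}" using S2 by (rule conjunct1)
  have uA: "\<exists>!f. f \<in> A \<and> e \<in> f" if "e \<in> E" for e using S3[THEN conjunct1] that by (rule bspec)
  have uB: "\<exists>!f. f \<in> B \<and> e \<in> f" if "e \<in> E" for e using S4[THEN conjunct1] that by (rule bspec)
  have inv: "face_img \<sigma> ` A = A" "face_img \<sigma> ` B = B" if "map_aut V E F \<sigma>" for \<sigma>
    using S5[THEN conjunct1, rule_format, OF that] by simp_all
  have arc: "\<exists>\<sigma>. map_aut V E F \<sigma> \<and> \<sigma> u = u' \<and> \<sigma> v = v'" if "{u, v} \<in> E" "{u', v'} \<in> E" for u v u' v'
    using S5[THEN conjunct2, rule_format, OF that] .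
  have fE: "f \<subseteq> E" if "f \<in> F" for f using polytopal_faces(2)[OF pm that] .
  have rel: "((v, e, f), (v', e', f')) \<in> ?R"
    if X: "X = A \<or> X = B" and f: "f \<in> X" "f' \<in> X" and fl: "(v, e, f) \<in> flags F" "(v', e', f') \<in> flags F"
    for X v e f v' e' f'
  proof -
    have e: "e \<in> E" "e' \<in> E" "v \<in> e" "v' \<in> e'" "e \<in> f" "e' \<in> f'" "f \<in> F" "f' \<in> F"
      using fl fE by (auto simp: flags_def)
    obtain w where w: "e = {v, w}" using simple_graph_edgeE[OF sg e(1)] e(3) by auto
    obtain w' where w': "e' = {v', w'}" using simple_graph_edgeE[OF sg e(2)] e(4) by auto
    obtain \<sigma> where s: "map_aut V E F \<sigma>" "\<sigma> v = v'" "\<sigma> w = w'"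
      using arc[of v w v' w'] e(1,2) unfolding w w' by blast
    have "\<sigma> ` e = e'" using s w w' by simp
    moreover have "face_img \<sigma> f \<in> X" using inv[OF s(1)] X f(1) by blast
    moreover have "e' \<in> face_img \<sigma> f" using e(5) \<open>\<sigma> ` e = e'\<close> by (auto simp: face_img_def)
    ultimately have "face_img \<sigma> f = f'" using uA[OF e(2)] uB[OF e(2)] X f(2) e(6) by blast
    then show ?thesis using s fl \<open>\<sigma> ` e = e'\<close> by (auto simp: flag_orbit_rel_def flag_act_def)
  qed
  have nrel: "f \<in> A \<longleftrightarrow> f' \<in> A" if r: "((v, e, f), (v', e', f')) \<in> ?R" for v e f v' e' f'
  proof -
    obtain \<sigma> where s: "map_aut V E F \<sigma>" "f' = face_img \<sigma> f" "f \<in> F"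
      using r by (auto simp: flag_orbit_rel_def flag_act_def flags_def)
    then show ?thesis using inv[OF s(1)] un dis by blast
  qed
  define XA where "XA = {(v, e, f). (v, e, f) \<in> flags F \<and> f \<in> A}"
  define XB where "XB = {(v, e, f). (v, e, f) \<in> flags F \<and> f \<in> B}"
  have inF: "f \<in> A \<or> f \<in> B" if "(v, e, f) \<in> flags F" for v e f using that un by (auto simp: flags_def)
  have clA: "?R `` {(v, e, f)} = XA" if h: "(v, e, f) \<in> XA" for v e f
  proof (intro equalityI subsetI)
    fix x assume "x \<in> ?R `` {(v, e, f)}"
    moreover obtain v' e' f' where "x = (v', e', f')" by (cases x)
    ultimately show "x \<in> XA" using h nrel by (auto simp: XA_def flag_orbit_rel_def)
  next
    fix x assume "x \<in> XA"
    moreover obtain v' e' f' where "x = (v', e', f')" by (cases x)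
    ultimately show "x \<in> ?R `` {(v, e, f)}" using h rel[of A f f' v e v' e'] by (auto simp: XA_def)
  qed
  have clB: "?R `` {(v, e, f)} = XB" if h: "(v, e, f) \<in> XB" for v e f
  proof (intro equalityI subsetI)
    fix x assume x: "x \<in> ?R `` {(v, e, f)}"
    obtain v' e' f' where x': "x = (v', e', f')" by (cases x)
    have "f \<notin> A" using h dis by (auto simp: XB_def)
    then have "f' \<notin> A" using nrel x x' by blast
    moreover have "x \<in> flags F" using x by (auto simp: flag_orbit_rel_def)
    ultimately show "x \<in> XB" using inF x' by (auto simp: XB_def)
  next
    fix x assume "x \<in> XB"
    moreover obtain v' e' f' where "x = (v', e', f')" by (cases x)
    ultimately show "x \<in> ?R `` {(v, e, f)}" using h rel[of B f f' v e v' e'] by (auto simp: XB_def)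
  qed
  obtain e0 where e0: "e0 \<in> E" using ne by auto
  obtain v0 where v0: "v0 \<in> e0" using sg e0 by (metis insertI1 simple_graph_edgeE)
  obtain f1 f2 where f12: "f1 \<in> A" "e0 \<in> f1" "f2 \<in> B" "e0 \<in> f2"
    using ex1_implies_ex[OF uA[OF e0]] ex1_implies_ex[OF uB[OF e0]] by auto
  have x1: "(v0, e0, f1) \<in> XA" and x2: "(v0, e0, f2) \<in> XB"
    using f12 v0 un by (auto simp: XA_def XB_def flags_def)
  have "flags F // ?R = {XA, XB}"
  proof (intro equalityI subsetI)
    fix X assume "X \<in> flags F // ?R"
    then obtain x where x: "x \<in> flags F" "X = ?R `` {x}" by (rule quotientE)
    obtain v e f where x': "x = (v, e, f)" by (cases x)
    then have "(v, e, f) \<in> XA \<or> (v, e, f) \<in> XB" using inF x by (auto simp: XA_def XB_def)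
    then show "X \<in> {XA, XB}" using clA clB x x' by blast
  next
    fix X assume "X \<in> {XA, XB}"
    then show "X \<in> flags F // ?R"
    proof -
      have fl: "(v0, e0, f1) \<in> flags F" "(v0, e0, f2) \<in> flags F" using x1 x2 by (auto simp: XA_def XB_def)
      have "XA \<in> flags F // ?R" "XB \<in> flags F // ?R"
        using quotientI[OF fl(1), of ?R] quotientI[OF fl(2), of ?R] unfolding clA[OF x1] clB[OF x2] by simp_all
      with \<open>X \<in> {XA, XB}\<close> show ?thesis by blast
    qed
  qed
  moreover have "(v0, e0, f1) \<notin> XB" using f12(1) dis by (auto simp: XB_def)
  then have "XA \<noteq> XB" using x1 by blast
  ultimately have c2: "card (flags F // ?R) = 2" by simp
  have same: "((v, e, f), (v', e', f)) \<in> ?R" if h: "(v, e, f) \<in> flags F" "(v', e', f) \<in> flags F" for v e v' e' f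
    using inF[OF h(1)] rel[of A f f v e v' e'] rel[of B f f v e v' e'] h by blast
  have diff: "((v, e, f), (v, e, f')) \<notin> ?R" if h: "(v, e, f) \<in> flags F" "(v, e, f') \<in> flags F" "f' \<noteq> f" for v e f f'
  proof
    assume "((v, e, f), (v, e, f')) \<in> ?R"
    then have "f \<in> A \<longleftrightarrow> f' \<in> A" by (rule nrel)
    moreover have "f \<in> F" "f' \<in> F" "e \<in> f" "e \<in> f'" using h by (auto simp: flags_def)
    moreover have "e \<in> E" using fE[of f] \<open>f \<in> F\<close> \<open>e \<in> f\<close> by blast
    moreover have "f = f'" if "f \<in> X" "f' \<in> X" "\<exists>!g. g \<in> X \<and> e \<in> g" for X
      using that \<open>e \<in> f\<close> \<open>e \<in> f'\<close> by (elim ex1E) auto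
    ultimately show False using uA[of e] uB[of e] un h(3) by blast
  qed
  show ?thesis unfolding class_2_01_def using c2 same diff by (intro conjI allI impI; (elim conjE)?; simp)
qed

section \<open>Wreath graph coordinates\<close>

text \<open>x i s is the vertex number s of the fibre i; fibres are indexed by integers, periodically.\<close>
locale wreath =
  fixes n :: nat and V :: "'v set" and E :: "'v set set" and x :: "int \<Rightarrow> bool \<Rightarrow> 'v"
  assumes n3: "n \<ge> 3"
    and x_eq_iff: "x i s = x j t \<longleftrightarrow> int n dvd i - j \<and> s = t"
    and V_eq: "V = {x i s |i s. True}"
    and E_eq: "E = {{x i s, x (i + 1) t} |i s t. True}"

text \<open>The walk is indexed by all integers while its edges live modulo n. If t flips after n
  steps, it winds twice round the fibres before closing.\<close>

definition pth :: "(int \<Rightarrow> bool \<Rightarrow> 'v) \<Rightarrow> (int \<Rightarrow> bool) \<Rightarrow> 'v set set" where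
  "pth x t = range (\<lambda>i. {x i (t i), x (i + 1) (t (i + 1))})"

definition quad :: "(int \<Rightarrow> bool \<Rightarrow> 'v) \<Rightarrow> int \<Rightarrow> 'v set set" where
  "quad x i = {{x i s, x (i + 1) t} |s t. True}"

lemma face_img_pth: "face_img \<sigma> (pth x t) = pth (\<lambda>i s. \<sigma> (x i s)) t"
  by (auto simp: face_img_def pth_def image_image)

lemma face_img_quad: "face_img \<sigma> (quad x i) = quad (\<lambda>i s. \<sigma> (x i s)) i"
  unfolding face_img_def quad_def by (auto simp: image_iff) (metis image_empty image_insert)

lemma xor_cancel: "((p \<noteq> q) \<noteq> q) = (p :: bool)"
  by blast

lemma dvd_cancel_small:
  assumes "int n dvd a" "\<bar>a\<bar> < int n"
  shows "a = 0"
  using assms zdvd_not_zless[of "\<bar>a\<bar>" "int n"] by (cases "a = 0") auto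

lemma range_periodic:
  fixes f :: "int \<Rightarrow> 'a"
  assumes "N > 0" and f: "\<And>i j. f i = f j \<longleftrightarrow> int N dvd i - j"
  shows "finite (range f)" "card (range f) = N"
proof -
  have "f i \<in> f ` {0..<int N}" for i
  proof -
    have "f i = f (i mod int N)" unfolding f by (simp add: minus_mod_eq_mult_div)
    moreover have "i mod int N \<in> {0..<int N}" using assms(1) by simp
    ultimately show ?thesis by blast
  qed
  then have r: "range f = f ` {0..<int N}" by blast
  have "inj_on f {0..<int N}"
  proof (rule inj_onI)
    fix i j assume ij: "i \<in> {0..<int N}" "j \<in> {0..<int N}" "f i = f j"
    then have "int N dvd i - j" by (simp add: f)
    moreover have "\<bar>i - j\<bar> < int N" using ij by auto
    ultimately show "i = j" using dvd_cancel_small[of N "i - j"] by simp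
  qed
  then show "card (range f) = N" unfolding r by (simp add: card_image)
  show "finite (range f)" unfolding r by simp
qed

lemma card_coords:
  fixes z :: "int \<Rightarrow> bool \<Rightarrow> 'a"
  assumes "N > 0" and z: "\<And>i s j t. z i s = z j t \<longleftrightarrow> int N dvd i - j \<and> s = t"
  shows "finite {z i s |i s. True}" "card {z i s |i s. True} = 2 * N"
proof -
  have c: "card (range (\<lambda>i. z i s)) = N" "finite (range (\<lambda>i. z i s))" for s
    using range_periodic[of N "\<lambda>i. z i s"] assms by simp_all
  have eq: "{z i s |i s. True} = range (\<lambda>i. z i True) \<union> range (\<lambda>i. z i False)"
    by (auto simp: image_iff) (metis (full_types))
  have "range (\<lambda>i. z i True) \<inter> range (\<lambda>i. z i False) = {}" by (auto simp: z)
  then show "finite {z i s |i s. True}" "card {z i s |i s. True} = 2 * N"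
    unfolding eq using c by (simp_all add: card_Un_disjoint)
qed

section \<open>Edges and changes of coordinates\<close>

context wreath
begin

lemma x_cong: "int n dvd i - j \<Longrightarrow> x i s = x j s"
  by (simp add: x_eq_iff)

lemma small_not_dvd: "\<not> int n dvd 1" "\<not> int n dvd 2" "\<not> int n dvd - 1" "\<not> int n dvd - 2"
  using n3 by (auto dest: zdvd_imp_le)

text \<open>An edge could be read in both directions only if n divided 2, so it determines its lower
  fibre.\<close>

lemma edge_eq_iff:
  "{x i p, x (i + 1) q} = {x j p', x (j + 1) q'} \<longleftrightarrow> int n dvd i - j \<and> p = p' \<and> q = q'"
proof -
  have "\<not> (int n dvd i - (j + 1) \<and> int n dvd (i + 1) - j)"
  proof
    assume "int n dvd i - (j + 1) \<and> int n dvd (i + 1) - j"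
    then have "int n dvd ((i + 1) - j) - (i - (j + 1))" by (metis dvd_diff)
    then show False using small_not_dvd by simp
  qed
  then show ?thesis by (auto simp: doubleton_eq_iff x_eq_iff)
qed

lemma edge_iff: "{x i s, x j t} \<in> E \<longleftrightarrow> int n dvd j - i - 1 \<or> int n dvd i - j - 1"
proof
  assume "{x i s, x j t} \<in> E"
  then obtain k p q where "{x i s, x j t} = {x k p, x (k + 1) q}" unfolding E_eq by blast
  then consider "int n dvd i - k" "int n dvd j - (k + 1)" | "int n dvd j - k" "int n dvd i - (k + 1)"
    by (auto simp: doubleton_eq_iff x_eq_iff)
  then show "int n dvd j - i - 1 \<or> int n dvd i - j - 1"
  proof cases
    case 1
    then have "int n dvd (j - (k + 1)) - (i - k)" by (rule dvd_diff[rotated])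
    then show ?thesis by (simp add: algebra_simps)
  next
    case 2
    then have "int n dvd (i - (k + 1)) - (j - k)" by (rule dvd_diff[rotated])
    then show ?thesis by (simp add: algebra_simps)
  qed
next
  assume "int n dvd j - i - 1 \<or> int n dvd i - j - 1"
  then consider "int n dvd j - (i + 1)" | "int n dvd i - (j + 1)" by (auto simp: algebra_simps)
  then show "{x i s, x j t} \<in> E"
  proof cases
    case 1
    then have "x j t = x (i + 1) t" by (rule x_cong)
    then show ?thesis unfolding E_eq by auto
  next
    case 2
    then have "x i s = x (j + 1) s" by (rule x_cong)
    then show ?thesis unfolding E_eq by (auto simp: insert_commute)
  qed
qed

lemma edge_Suc: "{x i s, x (i + 1) t} \<in> E"
  unfolding E_eq by blast

lemma edgeE:
  assumes "e \<in> E"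
  obtains i s t where "e = {x i s, x (i + 1) t}"
  using assms unfolding E_eq by blast

lemma x_in_V: "x i s \<in> V"
  unfolding V_eq by blast

lemma x_step_neq: "x i s \<noteq> x (i + 1) t" "x (i + 1) t \<noteq> x i s"
  using small_not_dvd by (auto simp: x_eq_iff)

lemma arcE:
  assumes "{u, v} \<in> E"
  obtains i p q where "u = x i p" "v = x (i + 1) q" | i p q where "u = x i p" "v = x (i - 1) q"
proof -
  obtain i p q where "{u, v} = {x i p, x (i + 1) q}" using assms by (rule edgeE)
  then consider "u = x i p" "v = x (i + 1) q" | "u = x (i + 1) q" "v = x (i + 1 - 1) p"
    by (auto simp: doubleton_eq_iff)
  then show thesis using that by cases
qed

lemma finite_V: "finite V" and card_V: "card V = 2 * n"
  using card_coords[of n x] n3 x_eq_iff unfolding V_eq by simp_all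

lemma simple: "simple_graph V E"
  unfolding simple_graph_def
proof (intro conjI subsetI finite_V)
  fix e assume "e \<in> E"
  then obtain i s t where "e = {x i s, x (i + 1) t}" by (rule edgeE)
  then show "e \<in> {e. \<exists>u w. u \<in> V \<and> w \<in> V \<and> u \<noteq> w \<and> e = {u, w}}"
    using x_in_V x_step_neq by blast
qed

lemma E_ne: "E \<noteq> {}"
  using edge_Suc by blast

lemma E_Pow: "E \<subseteq> Pow V"
  by (rule simple_graph_Pow[OF simple])

lemma connected: "graph_connected V E"
proof -
  let ?R = "{(u, w). {u, w} \<in> E}"
  have s: "sym ?R" by (auto simp: sym_def insert_commute)
  have a: "(x 0 False, x (int k) t) \<in> ?R\<^sup>*" for k t
  proof (induction k arbitrary: t)
    case 0
    have "(x 0 False, x 1 False) \<in> ?R" "(x 1 False, x 0 t) \<in> ?R"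
      using edge_Suc[of 0 False False] edge_Suc[of 0 t False] by (auto simp: insert_commute)
    then have "(x 0 False, x 0 t) \<in> ?R\<^sup>*" by (rule rtrancl_into_rtrancl[OF r_into_rtrancl])
    then show ?case by simp
  next
    case (Suc k)
    have "(x (int k) False, x (int (Suc k)) t) \<in> ?R"
      using edge_Suc[of "int k" False t] by (simp add: add.commute)
    with Suc show ?case by (rule rtrancl_into_rtrancl)
  qed
  have b: "(x 0 False, v) \<in> ?R\<^sup>*" if v: "v \<in> V" for v
  proof -
    obtain i t where i: "v = x i t" using v unfolding V_eq by blast
    have "v = x (int (nat (i mod int n))) t" unfolding i
      using n3 by (intro x_cong) (simp add: minus_mod_eq_mult_div)
    then show ?thesis using a[of "nat (i mod int n)" t] by (simp only:)
  qed
  have "(u, w) \<in> ?R\<^sup>*" if "u \<in> V" "w \<in> V" for u w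
  proof -
    have "(u, x 0 False) \<in> ?R\<^sup>*" using symD[OF sym_rtrancl[OF s] b[OF that(1)]] .
    then show ?thesis using b[OF that(2)] by (rule rtrancl_trans)
  qed
  then show ?thesis unfolding graph_connected_def by blast
qed

text \<open>Rotations, reflections and independent swaps inside the fibres; only a periodic r is
  well defined on fibres. The symmetries of the existence proofs and the twists of the normal forms
  come from here.\<close>

lemma reindex:
  assumes r: "\<And>j. r (j + int n) = r j" and \<epsilon>: "\<epsilon> = 1 \<or> \<epsilon> = -1"
  shows "wreath n V E (\<lambda>j u. x (i + \<epsilon> * j) (u \<noteq> r j))"
proof
  have rm: "r (j + int k * int n) = r j" for j k
  proof (induction k)
    case (Suc k)
    have "j + int (Suc k) * int n = (j + int k * int n) + int n" by (simp add: algebra_simps)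
    then show ?case using Suc r[of "j + int k * int n"] by (simp only:)
  qed simp
  have rc: "r a = r b" if d: "int n dvd a - b" for a b
  proof -
    obtain m where m: "a = b + m * int n" using d by (auto simp: dvd_def algebra_simps)
    show ?thesis
    proof (cases "m \<ge> 0")
      case True
      then show ?thesis using rm[of b "nat m"] m by simp
    next
      case False
      then show ?thesis using rm[of a "nat (- m)"] m by simp
    qed
  qed
  show "3 \<le> n" by (rule n3)
  have d: "int n dvd (i + \<epsilon> * j) - (i + \<epsilon> * k) \<longleftrightarrow> int n dvd j - k" for j k
    using \<epsilon> dvd_minus_iff[of "int n" "j - k"] by auto
  show "(x (i + \<epsilon> * j) (s \<noteq> r j) = x (i + \<epsilon> * k) (t \<noteq> r k)) = (int n dvd j - k \<and> s = t)" for j s k t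
    unfolding x_eq_iff d using rc by blast
  show "V = {x (i + \<epsilon> * j) (s \<noteq> r j) |j s. True}"
  proof (intro equalityI subsetI)
    fix v assume "v \<in> V"
    then obtain k p where v: "v = x k p" unfolding V_eq by blast
    have "i + \<epsilon> * (\<epsilon> * (k - i)) = k" using \<epsilon> by auto
    then have "v = x (i + \<epsilon> * (\<epsilon> * (k - i))) ((p \<noteq> r (\<epsilon> * (k - i))) \<noteq> r (\<epsilon> * (k - i)))"
      unfolding xor_cancel using v by simp
    then show "v \<in> {x (i + \<epsilon> * j) (s \<noteq> r j) |j s. True}" by blast
  qed (auto simp: x_in_V)
  show "E = {{x (i + \<epsilon> * j) (s \<noteq> r j), x (i + \<epsilon> * (j + 1)) (t \<noteq> r (j + 1))} |j s t. True}"
  proof (intro equalityI subsetI)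
    fix e assume "e \<in> E"
    then obtain k p q where e: "e = {x k p, x (k + 1) q}" by (rule edgeE)
    show "e \<in> {{x (i + \<epsilon> * j) (s \<noteq> r j), x (i + \<epsilon> * (j + 1)) (t \<noteq> r (j + 1))} |j s t. True}"
      using \<epsilon>
    proof
      assume "\<epsilon> = 1"
      then have "e = {x (i + \<epsilon> * (k - i)) ((p \<noteq> r (k - i)) \<noteq> r (k - i)),
          x (i + \<epsilon> * (k - i + 1)) ((q \<noteq> r (k - i + 1)) \<noteq> r (k - i + 1))}"
        unfolding xor_cancel using e by simp
      then show ?thesis by blast
    next
      \<comment> \<open>Reflection exchanges the ends of an edge: the new lower index i - k - 1
        belongs to the old fibre k + 1.\<close>
      assume "\<epsilon> = -1"
      then have "e = {x (i + \<epsilon> * (i - k - 1)) ((q \<noteq> r (i - k - 1)) \<noteq> r (i - k - 1)),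
          x (i + \<epsilon> * (i - k - 1 + 1)) ((p \<noteq> r (i - k - 1 + 1)) \<noteq> r (i - k - 1 + 1))}"
        unfolding xor_cancel using e by (simp add: insert_commute add.commute)
      then show ?thesis by blast
    qed
  next
    fix e assume "e \<in> {{x (i + \<epsilon> * j) (s \<noteq> r j), x (i + \<epsilon> * (j + 1)) (t \<noteq> r (j + 1))} |j s t. True}"
    then obtain j s t where e: "e = {x (i + \<epsilon> * j) (s \<noteq> r j), x (i + \<epsilon> * (j + 1)) (t \<noteq> r (j + 1))}" by blast
    have "i + \<epsilon> * (j + 1) - (i + \<epsilon> * j) - 1 = 0 \<or> (i + \<epsilon> * j) - (i + \<epsilon> * (j + 1)) - 1 = 0"
      using \<epsilon> by auto
    then show "e \<in> E" unfolding e edge_iff by (metis dvd_0_right)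
  qed
qed

text \<open>Adjacency is expressed by the indices alone, so passing from one labelling to another is
  an automorphism. Together with \<open>coords_of_aut\<close> this lets maps be compared by
  relabelling.\<close>

lemma iso_of_coords:
  assumes "wreath n V E y"
  obtains \<sigma> where "graph_aut V E \<sigma>" "\<And>i s. \<sigma> (x i s) = y i s"
proof
  interpret y: wreath n V E y by (rule assms)
  \<comment> \<open>The index of a vertex is known only modulo n, so a choice is made; periodicity
    of both labellings makes the value independent of it.\<close>
  define \<sigma> where "\<sigma> v = (SOME w. \<exists>i s. v = x i s \<and> w = y i s)" for v
  show s: "\<sigma> (x i s) = y i s" for i s
  proof -
    have "y j t = y i s" if "x i s = x j t" for j t
      using that by (simp add: x_eq_iff y.x_eq_iff dvd_diff_commute)
    then show ?thesis unfolding \<sigma>_def by (intro some_equality) blast+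
  qed
  show "graph_aut V E \<sigma>"
    unfolding graph_aut_def
  proof (intro conjI ballI)
    have "inj_on \<sigma> V"
    proof (rule inj_onI)
      fix u w assume "u \<in> V" "w \<in> V" "\<sigma> u = \<sigma> w"
      then show "u = w" unfolding V_eq by (auto simp: s x_eq_iff y.x_eq_iff)
    qed
    moreover have "\<sigma> ` V = V"
    proof
      show "\<sigma> ` V \<subseteq> V" using y.x_in_V s by (subst V_eq) auto
      show "V \<subseteq> \<sigma> ` V" using x_in_V s[symmetric] by (subst y.V_eq) auto
    qed
    ultimately show "bij_betw \<sigma> V V" by (simp add: bij_betw_def)
    fix u w assume "u \<in> V" "w \<in> V"
    then obtain i p j q where "u = x i p" "w = x j q" unfolding V_eq by blast
    then show "({u, w} \<in> E) = ({\<sigma> u, \<sigma> w} \<in> E)" by (simp add: s edge_iff y.edge_iff)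
  qed
qed

lemma coords_of_aut:
  assumes "graph_aut V E \<sigma>"
  shows "wreath n V E (\<lambda>i s. \<sigma> (x i s))"
proof
  have b: "bij_betw \<sigma> V V" using assms by (simp add: graph_aut_def)
  have inj: "inj_on \<sigma> V" and surj: "\<sigma> ` V = V" using b by (simp_all add: bij_betw_def)
  show "3 \<le> n" by (rule n3)
  show "(\<sigma> (x i s) = \<sigma> (x j t)) = (int n dvd i - j \<and> s = t)" for i s j t
    using inj_on_eq_iff[OF inj x_in_V x_in_V] by (simp add: x_eq_iff)
  show "V = {\<sigma> (x i s) |i s. True}"
    by (subst surj[symmetric], subst V_eq) auto
  show "E = {{\<sigma> (x i s), \<sigma> (x (i + 1) t)} |i s t. True}"
  proof (intro equalityI subsetI)
    fix e assume "e \<in> E"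
    then obtain u w where e: "e = {u, w}" "u \<in> V" "w \<in> V" using simple by (metis simple_graph_edgeE)
    have "u \<in> \<sigma> ` V" "w \<in> \<sigma> ` V" using e(2,3) by (simp_all add: surj)
    then obtain u' w' where u': "u' \<in> V" "w' \<in> V" "u = \<sigma> u'" "w = \<sigma> w'" by blast
    then have "{u', w'} \<in> E" using \<open>e \<in> E\<close> e(1) assms by (simp add: graph_aut_def)
    then obtain i s t where "{u', w'} = {x i s, x (i + 1) t}" by (rule edgeE)
    then have "e = {\<sigma> (x i s), \<sigma> (x (i + 1) t)}" using u' e(1) by (auto simp: doubleton_eq_iff)
    then show "e \<in> {{\<sigma> (x i s), \<sigma> (x (i + 1) t)} |i s t. True}" by blast
  next
    fix e assume "e \<in> {{\<sigma> (x i s), \<sigma> (x (i + 1) t)} |i s t. True}"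
    then obtain i s t where e: "e = {\<sigma> (x i s), \<sigma> (x (i + 1) t)}" by blast
    have "{x i s, x (i + 1) t} \<in> E" by (rule edge_Suc)
    then show "e \<in> E" using assms x_in_V by (simp add: graph_aut_def e)
  qed
qed

end

text \<open>With y_j in fibre j + 1, the four edges with index k have lower fibre k, k + 1, k and k
  - 1 (in the order \<open>e1\<close> to \<open>e4\<close>), and each type realises one of the four
  combinations of vertex numbers.\<close>

lemma wreath_rose_window:
  assumes "n \<ge> 3"
  shows "wreath n (rw_vertices n) (rw_edges n 2 1) (\<lambda>i s. (s, nat ((i - (if s then 1 else 0)) mod int n)))"
    (is "wreath n ?V ?E ?x")
proof
  have n0: "int n > 0" using assms by simp
  have mm: "(a mod int n = b mod int n) = (int n dvd a - b)" for a b by (rule mod_eq_dvd_iff)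
  have nn: "nat (a mod int n) = nat (b mod int n) \<longleftrightarrow> int n dvd a - b" for a b
    using n0 by (simp add: mm[symmetric] eq_nat_nat_iff)
  show "3 \<le> n" by fact
  show "(?x i s = ?x j t) = (int n dvd i - j \<and> s = t)" for i s j t
    by (auto simp: nn)
  have lt: "nat (a mod int n) < n" for a using n0 by (simp add: nat_less_iff)
  show "?V = {?x i s |i s. True}"
  proof (intro equalityI subsetI)
    fix v assume "v \<in> ?V"
    then obtain s k where v: "v = (s, k)" "k < n" unfolding rw_vertices_def by auto
    have "v = ?x (int k + (if s then 1 else 0)) s" using v by simp
    then show "v \<in> {?x i s |i s. True}" by blast
  qed (auto simp: rw_vertices_def lt)
  have cg: "?x i s = (s, k)" if "k < n" "int n dvd i - (if s then 1 else 0) - int k" for i s k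
    using nn[of "i - (if s then 1 else 0)" "int k"] that by auto
  have m1: "(k + 1) mod n < n" "(k + n - 2) mod n < n" for k using assms by auto
  have im: "int (Suc k mod n) = (int k + 1) mod int n" for k by (simp add: zmod_int add.commute)
  have im2: "int ((k + n - 2) mod n) = (int k - 2) mod int n" for k
  proof -
    have "int (k + n - 2) = int k - 2 + int n" using assms by simp
    then show ?thesis unfolding zmod_int by (simp only: mod_add_self2)
  qed
  have dm: "int n dvd a - b mod int n \<longleftrightarrow> int n dvd a - b" for a b
    by (metis mm mod_mod_trivial)
  have e1: "{(False, k), (False, (k + 1) mod n)} = {?x (int k) False, ?x (int k + 1) False}" if "k < n" for k
    using cg[of "(k + 1) mod n" "int k + 1" False] cg[of k "int k" False] m1 that by (simp add: im dm)
  have e2: "{(True, k), (True, (k + 1) mod n)} = {?x (int k + 1) True, ?x (int k + 1 + 1) True}" if "k < n" for k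
    using cg[of "(k + 1) mod n" "int k + 2" True] cg[of k "int k + 1" True] m1 that by (simp add: im dm)
  have e3: "{(False, k), (True, k)} = {?x (int k) False, ?x (int k + 1) True}" if "k < n" for k
    using cg[of k "int k + 1" True] cg[of k "int k" False] that by simp
  have e4: "{(False, k), (True, (k + n - 2) mod n)} = {?x (int k - 1) True, ?x (int k - 1 + 1) False}" if "k < n" for k
    using cg[of "(k + n - 2) mod n" "int k - 1" True] cg[of k "int k" False] m1 that
    by (simp add: im2 dm insert_commute)
  show "?E = {{?x i s, ?x (i + 1) t} |i s t. True}" (is "_ = ?E'")
  proof (intro equalityI subsetI)
    fix e assume "e \<in> ?E"
    then obtain k where k: "k < n" and "e \<in> {{(False, k), (False, (k + 1) mod n)}, {(True, k), (True, (k + 1) mod n)},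
        {(False, k), (True, k)}, {(False, k), (True, (k + n - 2) mod n)}}"
      unfolding rw_edges_def by blast
    then show "e \<in> ?E'" unfolding e1[OF k] e2[OF k] e3[OF k] e4[OF k] by blast
  next
    fix e assume "e \<in> ?E'"
    then obtain i s t where e: "e = {?x i s, ?x (i + 1) t}" by blast
    have per: "?x i s = ?x j s" if "int n dvd i - j" for i j s using that by (auto simp: nn)
    have pick: "\<exists>k<n. int n dvd i - (int k + a)" for a
    proof (intro exI conjI)
      show "nat ((i - a) mod int n) < n" by (rule lt)
      have "int n dvd (i - a) - (i - a) mod int n" by (rule dvd_minus_mod)
      then show "int n dvd i - (int (nat ((i - a) mod int n)) + a)" using n0 by (simp add: algebra_simps)
    qed
    have mem: "e \<in> ?E" if "k < n" "e \<in> {{(False, k), (False, (k + 1) mod n)}, {(True, k), (True, (k + 1) mod n)},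
        {(False, k), (True, k)}, {(False, k), (True, (k + n - 2) mod n)}}" for k
      using that unfolding rw_edges_def by blast
    have red: "e = {?x (int k + a) s, ?x (int k + a + 1) t}" if "int n dvd i - (int k + a)" for k a
    proof -
      have "int n dvd (i + 1) - (int k + a + 1)" using that by simp
      then show ?thesis using per[OF that, of s] per[of "i + 1" "int k + a + 1" t] unfolding e by (simp only:)
    qed
    \<comment> \<open>The offset a in the four cases is 0, 1, 0, -1: the lower fibre i is k +
      a.\<close>
    consider "\<not> s \<and> \<not> t" | "s \<and> t" | "\<not> s \<and> t" | "s \<and> \<not> t" by blast
    then show "e \<in> ?E"
    proof cases
      case 1
      obtain k where k: "k < n" "int n dvd i - (int k + 0)" using pick by blast
      show ?thesis using mem[OF k(1)] e1[OF k(1)] red[OF k(2)] 1 by simp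
    next
      case 2
      obtain k where k: "k < n" "int n dvd i - (int k + 1)" using pick by blast
      show ?thesis using mem[OF k(1)] e2[OF k(1)] red[OF k(2)] 2 by simp
    next
      case 3
      obtain k where k: "k < n" "int n dvd i - (int k + 0)" using pick by blast
      show ?thesis using mem[OF k(1)] e3[OF k(1)] red[OF k(2)] 3 by simp
    next
      case 4
      obtain k where k: "k < n" "int n dvd i - (int k + - 1)" using pick by blast
      show ?thesis using mem[OF k(1)] e4[OF k(1)] red[OF k(2)] 4 by simp
    qed
  qed
qed

section \<open>Families of straight faces\<close>

text \<open>Addition modulo 2 is written as inequality of truth values. For c = False these are the
  sequences of period 2, for c = True the Fibonacci sequences modulo 2.\<close>
definition lin :: "bool \<Rightarrow> (int \<Rightarrow> bool) set" where
  "lin c = {d. \<forall>i. d (i + 2) = (d i \<noteq> (c \<and> d (i + 1)))}"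

definition fam :: "bool \<Rightarrow> (int \<Rightarrow> bool) \<Rightarrow> (int \<Rightarrow> bool) set" where
  "fam c g = {t. (\<lambda>i. t i \<noteq> g i) \<in> lin c}"

lemma linD: "d \<in> lin c \<Longrightarrow> d (i + 2) = (d i \<noteq> (c \<and> d (i + 1)))"
  by (simp add: lin_def)

lemma lin_xor:
  assumes "d \<in> lin c" "d' \<in> lin c"
  shows "(\<lambda>i. d i \<noteq> d' i) \<in> lin c"
  unfolding lin_def mem_Collect_eq
proof
  fix i show "(d (i + 2) \<noteq> d' (i + 2)) = ((d i \<noteq> d' i) \<noteq> (c \<and> d (i + 1) \<noteq> d' (i + 1)))"
    unfolding linD[OF assms(1)] linD[OF assms(2)] by blast
qed

text \<open>Modulo 2 the recursion says that d(i), c d(i+1) and d(i+2) sum to 0, which is symmetric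
  under reversal.\<close>

lemma lin_reindex:
  assumes d: "d \<in> lin c" and \<epsilon>: "\<epsilon> = 1 \<or> \<epsilon> = -1"
  shows "(\<lambda>i. d (a + \<epsilon> * i)) \<in> lin c"
  unfolding lin_def mem_Collect_eq
proof
  fix i
  show "d (a + \<epsilon> * (i + 2)) = (d (a + \<epsilon> * i) \<noteq> (c \<and> d (a + \<epsilon> * (i + 1))))"
    using \<epsilon>
  proof
    assume "\<epsilon> = 1"
    then show ?thesis using linD[OF d, of "a + i"] by (simp add: add.assoc)
  next
    assume e: "\<epsilon> = -1"
    have "a - (i + 2) + 2 = a - i" "a - (i + 2) + 1 = a - (i + 1)" by simp_all
    then have "d (a - i) = (d (a - (i + 2)) \<noteq> (c \<and> d (a - (i + 1))))"
      using linD[OF d, of "a - (i + 2)"] by (simp only:)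
    moreover have m: "a + \<epsilon> * (i + 2) = a - (i + 2)" "a + \<epsilon> * i = a - i" "a + \<epsilon> * (i + 1) = a - (i + 1)"
      using e by simp_all
    ultimately show ?thesis unfolding m by blast
  qed
qed

lemma lin_zero:
  assumes d: "d \<in> lin c" and z: "\<not> d i" "\<not> d (i + 1)"
  shows "\<not> d k"
proof -
  have "\<not> d k \<and> \<not> d (k + 1)"
  proof (induction k rule: int_induct[of _ i])
    case base
    show ?case using z by simp
  next
    case (step1 k)
    then show ?case using linD[OF d, of k] by (simp add: add.assoc)
  next
    case (step2 k)
    then show ?case using linD[OF d, of "k - 1"] by (simp add: add.commute)
  qed
  then show ?thesis by blast
qed

lemma lin_eqI:
  assumes "d \<in> lin c" "d' \<in> lin c" "d i = d' i" "d (i + 1) = d' (i + 1)"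
  shows "d = d'"
  using lin_zero[OF lin_xor[OF assms(1,2)], of i] assms(3,4) by auto

lemma lin_ex: "\<exists>d\<in>lin c. d i = p \<and> d (i + 1) = q"
proof (cases c)
  case False
  let ?d = "\<lambda>k. if even (k - i) then p else q"
  have "?d \<in> lin c" using False by (simp add: lin_def)
  then show ?thesis by (intro bexI[of _ ?d]) simp_all
next
  case True
  \<comment> \<open>A Fibonacci sequence modulo 2 repeats p, q, p + q.\<close>
  let ?d = "\<lambda>k. if (k - i) mod 3 = 0 then p else if (k - i) mod 3 = 1 then q else p \<noteq> q"
  have "?d \<in> lin c"
    unfolding lin_def mem_Collect_eq
  proof
    fix k
    have m: "(k + 1 - i) mod 3 = ((k - i) mod 3 + 1) mod 3" "(k + 2 - i) mod 3 = ((k - i) mod 3 + 2) mod 3"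
      by presburger+
    have "(k - i) mod 3 = 0 \<or> (k - i) mod 3 = 1 \<or> (k - i) mod 3 = 2" by presburger
    then show "?d (k + 2) = (?d k \<noteq> (c \<and> ?d (k + 1)))"
      unfolding m by (elim disjE) (simp_all add: True, blast+)
  qed
  then show ?thesis by (intro bexI[of _ ?d]) simp_all
qed

lemma lin_True_3: "d \<in> lin True \<Longrightarrow> d (i + 3) = d i"
  using linD[of d True i] linD[of d True "i + 1"] by (simp add: add.assoc) blast

lemma lin_periodic:
  assumes d: "d \<in> lin c" and n: "if c then 3 dvd n else even n"
  shows "d (i + int n) = d i"
proof (cases c)
  case True
  obtain k where k: "n = 3 * k" using n True by (auto simp: dvd_def)
  have "d (i + int (3 * m)) = d i" for m
  proof (induction m)
    case (Suc m)
    have "i + int (3 * Suc m) = i + int (3 * m) + 3" by simp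
    then show ?case using Suc lin_True_3[of d "i + int (3 * m)"] d True by (simp only:)
  qed simp
  then show ?thesis using k by simp
next
  case False
  obtain k where k: "n = 2 * k" using n False by (auto simp: dvd_def)
  have "d (i + int (2 * m)) = d i" for m
  proof (induction m)
    case (Suc m)
    have "i + int (2 * Suc m) = i + int (2 * m) + 2" by simp
    then show ?case using Suc linD[OF d, of "i + int (2 * m)"] False by (simp only: simp_thms)
  qed simp
  then show ?thesis using k by simp
qed

text \<open>Two test sequences suffice: the parity of the index, and 0, 1, 1 repeated, whose zeros
  are exactly the multiples of 3.\<close>

lemma lin_periodic_conv:
  assumes "\<And>d. d \<in> lin c \<Longrightarrow> d (int n) = d 0"
  shows "if c then 3 dvd n else even n"
proof (cases c)
  case False
  have "(\<lambda>k. odd k) \<in> lin False" by (simp add: lin_def)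
  then show ?thesis using assms[of "\<lambda>k. odd k"] False by simp
next
  case True
  obtain d where d: "d \<in> lin c" "\<not> d 0" "d 1" using lin_ex[of c 0 False True] by auto
  have d2: "d 2" using linD[OF d(1), of 0] d True by simp
  have dm: "d (k + int (3 * m)) = d k" for k m
    using lin_periodic[OF d(1), of "3 * m"] True by simp
  have nn: "int n = int (n mod 3) + int (3 * (n div 3))" by (simp add: zmod_int zdiv_int)
  have dn: "d (int (n mod 3)) = d 0" using assms[OF d(1)] dm[of "int (n mod 3)" "n div 3"] unfolding nn[symmetric] by simp
  consider "n mod 3 = 0" | "n mod 3 = 1" | "n mod 3 = 2" by linarith
  then have "n mod 3 = 0"
    by cases (use dn d d2 in simp_all)
  then show ?thesis using True by auto
qed

lemma fam_ex: "\<exists>t\<in>fam c g. t i = p \<and> t (i + 1) = q"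
proof -
  obtain d where d: "d \<in> lin c" "d i = (p \<noteq> g i)" "d (i + 1) = (q \<noteq> g (i + 1))" using lin_ex[of c i] by blast
  have "(\<lambda>k. (d k \<noteq> g k) \<noteq> g k) = d" by auto
  then have "(\<lambda>k. d k \<noteq> g k) \<in> fam c g" using d(1) by (simp add: fam_def)
  then show ?thesis by (rule rev_bexI) (use d in blast)
qed

lemma fam_eqI:
  assumes "t \<in> fam c g" "t' \<in> fam c g" "t i = t' i" "t (i + 1) = t' (i + 1)"
  shows "t = t'"
proof -
  have "(\<lambda>k. t k \<noteq> g k) = (\<lambda>k. t' k \<noteq> g k)"
    using assms by (intro lin_eqI[of _ c _ i]) (simp_all add: fam_def)
  then have "(t k \<noteq> g k) = (t' k \<noteq> g k)" for k by (rule fun_cong)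
  then show ?thesis by blast
qed

lemma g_in_fam: "g \<in> fam c g"
  by (simp add: fam_def lin_def)

text \<open>For \<open>\<kappa>\<close> false the walk closes after one turn; for
  \<open>\<kappa>\<close> true it is then at the other vertex of the fibre and closes after
  two.\<close>

definition quasi :: "nat \<Rightarrow> bool \<Rightarrow> (int \<Rightarrow> bool) \<Rightarrow> bool" where
  "quasi n \<kappa> t \<longleftrightarrow> (\<forall>i. t (i + int n) = (t i \<noteq> \<kappa>))"

lemma quasi_mult:
  assumes "quasi n \<kappa> t"
  shows "t (i + m * int n) = (t i \<noteq> (\<kappa> \<and> odd m))"
proof (induction m rule: int_induct[of _ 0])
  case base
  show ?case by simp
next
  case (step1 m)
  have "t (i + (m + 1) * int n) = t (i + m * int n + int n)" by (simp add: algebra_simps)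
  also have "\<dots> = (t (i + m * int n) \<noteq> \<kappa>)" using assms unfolding quasi_def by blast
  finally show ?case using step1 by auto
next
  case (step2 m)
  have "t (i + m * int n) = t (i + (m - 1) * int n + int n)" by (simp add: algebra_simps)
  also have "\<dots> = (t (i + (m - 1) * int n) \<noteq> \<kappa>)" using assms unfolding quasi_def by blast
  finally show ?case using step2 by auto
qed

text \<open>A walk that returns to a vertex repeats itself from there in both directions. This is
  why \<open>pth\<close> gives a cycle and not just a closed walk.\<close>

lemma quasi_transfer:
  assumes "quasi n \<kappa> t" "int n dvd j - k" "t j = t k"
  shows "t (j + a) = t (k + a)"
proof -
  obtain m where m: "j = k + m * int n" using assms(2) by (auto simp: dvd_def algebra_simps)
  have ja: "j + a = (k + a) + m * int n" using m by simp
  have "t k = (t k \<noteq> (\<kappa> \<and> odd m))"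
    using quasi_mult[OF assms(1), of k m] assms(3) unfolding m by simp
  then show ?thesis unfolding ja quasi_mult[OF assms(1), of "k + a" m] by blast
qed

text \<open>The left side says that steps j and k meet the same vertex, so the right side gives the
  length of the cycle.\<close>

lemma quasi_dvd_iff:
  assumes "quasi n \<kappa> t" "n > 0"
  shows "int n dvd j - k \<and> t j = t k \<longleftrightarrow> int (if \<kappa> then 2 * n else n) dvd j - k"
proof
  assume a: "int n dvd j - k \<and> t j = t k"
  then obtain m where m: "j = k + m * int n" by (auto simp: dvd_def algebra_simps)
  have "\<not> (\<kappa> \<and> odd m)" using quasi_mult[OF assms(1), of k m] m a by auto
  then show "int (if \<kappa> then 2 * n else n) dvd j - k" using m by (auto elim!: evenE)
next
  assume a: "int (if \<kappa> then 2 * n else n) dvd j - k"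
  then obtain l where l: "j - k = int (if \<kappa> then 2 * n else n) * l" by (auto simp: dvd_def)
  obtain m where m: "j = k + m * int n" "\<kappa> \<longrightarrow> even m"
  proof
    show "j = k + (if \<kappa> then 2 * l else l) * int n" using l by (simp add: algebra_simps split: if_splits)
  qed simp
  have "t j = t k" unfolding m(1) quasi_mult[OF assms(1)] using m(2) by blast
  with m(1) show "int n dvd j - k \<and> t j = t k" by simp
qed

text \<open>Divisibility makes \<open>lin c\<close> n-periodic, so all members inherit
  \<open>\<kappa>\<close> from g. If c and \<open>\<kappa>\<close> were both true, the complement of
  a member would trace the same path without being a member, and the member through a complementary
  edge would put that edge on a second path.\<close>

definition good_fam :: "nat \<Rightarrow> bool \<Rightarrow> bool \<Rightarrow> (int \<Rightarrow> bool) \<Rightarrow> bool" where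
  "good_fam n c \<kappa> g \<longleftrightarrow> (if c then 3 dvd n \<and> \<not> \<kappa> else even n) \<and> quasi n \<kappa> g"

lemma quasi_fam:
  assumes "good_fam n c \<kappa> g" "t \<in> fam c g"
  shows "quasi n \<kappa> t"
  unfolding quasi_def
proof
  fix i
  have "(t (i + int n) \<noteq> g (i + int n)) = (t i \<noteq> g i)"
    using lin_periodic[of "\<lambda>i. t i \<noteq> g i" c n i] assms by (auto simp: fam_def good_fam_def split: if_splits)
  moreover have "g (i + int n) = (g i \<noteq> \<kappa>)" using assms by (simp add: good_fam_def quasi_def)
  ultimately show "t (i + int n) = (t i \<noteq> \<kappa>)" by blast
qed

section \<open>Paths and 4-cycles as faces\<close>

context wreath
begin

lemma mem_pth: "{x i p, x (i + 1) q} \<in> pth x t \<longleftrightarrow> (\<exists>k. int n dvd i - k \<and> t k = p \<and> t (k + 1) = q)"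
  unfolding pth_def by (auto simp: image_iff edge_eq_iff)

lemma pth_sub: "pth x t \<subseteq> E"
  unfolding pth_def using edge_Suc by blast

text \<open>Shifting the index by n fixes the vertices and turns t into its complement.\<close>

lemma pth_not:
  assumes "quasi n True t"
  shows "pth x (\<lambda>i. \<not> t i) = pth x t"
proof -
  have s: "{x i (\<not> t i), x (i + 1) (\<not> t (i + 1))} = {x (i + int n) (t (i + int n)), x (i + int n + 1) (t (i + int n + 1))}" for i
  proof -
    have "t (i + int n) = (\<not> t i)" "t (i + int n + 1) = (\<not> t (i + 1))"
      using assms unfolding quasi_def by (simp, metis add.assoc add.commute)
    moreover have "x i u = x (i + int n) u" "x (i + 1) u = x (i + int n + 1) u" for u
      by (simp_all add: x_eq_iff)
    ultimately show ?thesis by (simp only:)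
  qed
  have u: "range (\<lambda>i. f (i + int n)) = range f" for f :: "int \<Rightarrow> 'v set"
    using surj_plus_right[of "int n"] by (metis image_image)
  show ?thesis unfolding pth_def s by (rule u)
qed

text \<open>Two consecutive values determine a member of the family. The edge shows them at some
  index congruent to i; moving to i itself either preserves both values or, after an odd number of
  flips, complements both, and complementing t preserves the path.\<close>

lemma fam_unique_face:
  assumes g: "good_fam n c \<kappa> g" and e: "e \<in> E"
  shows "\<exists>!f. f \<in> pth x ` fam c g \<and> e \<in> f"
proof -
  obtain i p q where e': "e = {x i p, x (i + 1) q}" using e by (rule edgeE)
  obtain t where t: "t \<in> fam c g" "t i = p" "t (i + 1) = q" using fam_ex[of c g i p q] by blast
  have et: "e \<in> pth x t" unfolding e' mem_pth using t by (intro exI[of _ i]) simp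
  have same: "pth x t' = pth x t" if t': "t' \<in> fam c g" "e \<in> pth x t'" for t'
  proof -
    obtain k where k: "int n dvd i - k" "t' k = p" "t' (k + 1) = q"
      using t'(2) unfolding e' mem_pth by blast
    have qt: "quasi n \<kappa> t'" using quasi_fam g t'(1) by blast
    obtain m where m: "i = k + m * int n" using k(1) by (auto simp: dvd_def algebra_simps)
    then have m1: "i + 1 = k + 1 + m * int n" by simp
    have ti: "t' i = (p \<noteq> (\<kappa> \<and> odd m))" "t' (i + 1) = (q \<noteq> (\<kappa> \<and> odd m))"
      using quasi_mult[OF qt, of k m] quasi_mult[OF qt, of "k + 1" m] k unfolding m m1
      by (simp_all add: algebra_simps)
    show ?thesis
    proof (cases "\<kappa> \<and> odd m")
      case False
      then have "t' = t" using ti t t'(1) by (intro fam_eqI[of t' c g t i]) auto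
      then show ?thesis by simp
    next
      case True
      \<comment> \<open>Complementing adds the constant sequence 1, which belongs to
        \<open>lin False\<close> but not to \<open>lin True\<close>.\<close>
      then have c: "c = False" using g by (auto simp: good_fam_def split: if_splits)
      have "(\<lambda>i. t' i \<noteq> g i) \<in> lin c" using t'(1) by (simp add: fam_def)
      then have "(\<lambda>i. (\<not> t' i) \<noteq> g i) \<in> lin c" unfolding c lin_def by auto
      then have "(\<lambda>i. \<not> t' i) \<in> fam c g" by (simp add: fam_def)
      then have "(\<lambda>i. \<not> t' i) = t" using ti t True by (intro fam_eqI[of _ c g t i]) auto
      then show ?thesis using pth_not[of t'] qt True by simp
    qed
  qed
  show ?thesis
  proof (rule ex1I[of _ "pth x t"])
    show "pth x t \<in> pth x ` fam c g \<and> e \<in> pth x t" using t(1) et by blast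
    fix f assume "f \<in> pth x ` fam c g \<and> e \<in> f"
    then obtain t' where "t' \<in> fam c g" "f = pth x t'" "e \<in> pth x t'" by blast
    then show "f = pth x t" using same by simp
  qed
qed

lemma pth_edge_eq_iff:
  assumes "quasi n \<kappa> t"
  shows "{x i (t i), x (i + 1) (t (i + 1))} = {x j (t j), x (j + 1) (t (j + 1))}
    \<longleftrightarrow> int (if \<kappa> then 2 * n else n) dvd i - j"
  unfolding edge_eq_iff using quasi_dvd_iff[OF assms, of i j] quasi_transfer[OF assms, of i j 1] n3 by auto

lemma card_pth:
  assumes "quasi n \<kappa> t"
  shows "card (pth x t) = (if \<kappa> then 2 * n else n)" "finite (pth x t)"
  unfolding pth_def
  using range_periodic[of "if \<kappa> then 2 * n else n" "\<lambda>i. {x i (t i), x (i + 1) (t (i + 1))}"]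
    pth_edge_eq_iff[OF assms] n3 by (auto split: if_splits)

text \<open>At the vertex of step k only the edges k - 1 and k occur, because every other visit to
  it repeats the same two steps.\<close>

lemma pth_cycle:
  assumes q: "quasi n \<kappa> t"
  shows "is_cycle_face E (pth x t)"
  unfolding is_cycle_face_def
proof (intro conjI ballI)
  let ?e = "\<lambda>i. {x i (t i), x (i + 1) (t (i + 1))}"
  let ?C = "pth x t"
  show "?C \<subseteq> E" by (rule pth_sub)
  show "?C \<noteq> {}" by (simp add: pth_def)
  show "finite ?C" using card_pth(2)[OF q] .
  have mem: "?e i \<in> ?C" for i by (simp add: pth_def)
  fix v assume "v \<in> \<Union> ?C"
  then obtain i where "v \<in> ?e i" unfolding pth_def by blast
  then obtain k where v: "v = x k (t k)" by blast
  have "{e \<in> ?C. v \<in> e} = {?e (k - 1), ?e k}"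
  proof (intro equalityI subsetI)
    fix e assume "e \<in> {e \<in> ?C. v \<in> e}"
    then obtain j where j: "e = ?e j" "x k (t k) \<in> ?e j" unfolding pth_def v by blast
    then consider "int n dvd k - j" "t k = t j" | "int n dvd (k - 1) - j" "t k = t (j + 1)"
      by (auto simp: x_eq_iff algebra_simps)
    then show "e \<in> {?e (k - 1), ?e k}"
    proof cases
      case 1
      then have "?e k = ?e j" using quasi_transfer[OF q 1, of 1] by (simp add: edge_eq_iff)
      then show ?thesis using j by blast
    next
      case 2
      then have "int n dvd k - (j + 1)" by (simp add: algebra_simps)
      then have "t (k - 1) = t j" using quasi_transfer[OF q _ 2(2), of "-1"] by simp
      then have "?e (k - 1) = ?e j" using 2 edge_eq_iff[of "k - 1" "t (k - 1)" "t k" j "t j" "t (j + 1)"] by simp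
      then show ?thesis using j by blast
    qed
  next
    fix e assume "e \<in> {?e (k - 1), ?e k}"
    then show "e \<in> {e \<in> ?C. v \<in> e}" using mem[of k] mem[of "k - 1"] v by auto
  qed
  moreover have "?e (k - 1) \<noteq> ?e k"
    using edge_eq_iff[of "k - 1" "t (k - 1)" "t k" k "t k" "t (k + 1)"] small_not_dvd by simp
  ultimately show "card {e \<in> ?C. v \<in> e} = 2" by simp
next
  let ?e = "\<lambda>i. {x i (t i), x (i + 1) (t (i + 1))}"
  let ?R = "{(a, b). a \<in> pth x t \<and> b \<in> pth x t \<and> a \<inter> b \<noteq> {}}"
  have sy: "sym ?R" by (auto simp: sym_def)
  have fw: "(?e i, ?e (i + int k)) \<in> ?R\<^sup>*" for i k
  proof (induction k)
    case (Suc k)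
    have eq: "i + int (Suc k) = i + int k + 1" by simp
    have "(?e (i + int k), ?e (i + int k + 1)) \<in> ?R" by (auto simp: pth_def)
    then show ?case unfolding eq using Suc by (rule rtrancl_into_rtrancl[rotated])
  qed simp
  fix e1 e2 assume "e1 \<in> pth x t" "e2 \<in> pth x t"
  then obtain i j where ij: "e1 = ?e i" "e2 = ?e j" unfolding pth_def by blast
  show "(e1, e2) \<in> ?R\<^sup>*"
  proof (cases "i \<le> j")
    case True
    then show ?thesis using fw[of i "nat (j - i)"] ij by simp
  next
    case False
    then have "(e2, e1) \<in> ?R\<^sup>*" using fw[of j "nat (i - j)"] ij by simp
    then show ?thesis by (rule symD[OF sym_rtrancl[OF sy]])
  qed
qed

lemma quad_eq: "quad x i = {{x i False, x (i + 1) False}, {x i False, x (i + 1) True},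
    {x i True, x (i + 1) False}, {x i True, x (i + 1) True}}"
  by (rule set_eqI) (simp add: quad_def ex_bool_eq, blast)

lemma card_quad: "card (quad x i) = 4"
  unfolding quad_eq by (simp add: card_insert_if edge_eq_iff)

lemma mem_quad: "{x i p, x (i + 1) q} \<in> quad x j \<longleftrightarrow> int n dvd i - j"
  unfolding quad_def by (auto simp: edge_eq_iff)

lemma quad_cong: "int n dvd i - j \<Longrightarrow> quad x i = quad x j"
  unfolding quad_def using x_cong[of i j] x_cong[of "i + 1" "j + 1"] by simp

lemma quad_unique_face:
  assumes e: "e \<in> E"
  shows "\<exists>!f. f \<in> range (quad x) \<and> e \<in> f"
proof -
  obtain i p q where e': "e = {x i p, x (i + 1) q}" using e by (rule edgeE)
  show ?thesis
  proof (rule ex1I[of _ "quad x i"])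
    show "quad x i \<in> range (quad x) \<and> e \<in> quad x i" unfolding e' mem_quad by simp
    fix f assume "f \<in> range (quad x) \<and> e \<in> f"
    then obtain j where "f = quad x j" "int n dvd i - j" unfolding e' using mem_quad by blast
    then show "f = quad x i" using quad_cong by simp
  qed
qed

lemma quad_cycle: "is_cycle_face E (quad x i)"
  unfolding is_cycle_face_def
proof (intro conjI ballI)
  show "quad x i \<subseteq> E" unfolding quad_def using edge_Suc by blast
  show "quad x i \<noteq> {}" "finite (quad x i)" by (simp_all add: quad_eq)
  fix v assume "v \<in> \<Union> (quad x i)"
  then consider s where "v = x i s" | s where "v = x (i + 1) s" unfolding quad_def by blast
  then show "card {e \<in> quad x i. v \<in> e} = 2"
  proof cases
    case 1
    have "{e \<in> quad x i. v \<in> e} = {{x i s, x (i + 1) False}, {x i s, x (i + 1) True}}"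
      unfolding quad_eq 1 using small_not_dvd by (cases s) (auto simp: x_eq_iff)
    then show ?thesis by (simp add: edge_eq_iff)
  next
    case 2
    have "{e \<in> quad x i. v \<in> e} = {{x i False, x (i + 1) s}, {x i True, x (i + 1) s}}"
      unfolding quad_eq 2 using small_not_dvd by (cases s) (auto simp: x_eq_iff)
    then show ?thesis by (simp add: edge_eq_iff)
  qed
next
  let ?R = "{(a, b). a \<in> quad x i \<and> b \<in> quad x i \<and> a \<inter> b \<noteq> {}}"
  fix e1 e2 assume "e1 \<in> quad x i" "e2 \<in> quad x i"
  then obtain s t s' t' where e: "e1 = {x i s, x (i + 1) t}" "e2 = {x i s', x (i + 1) t'}"
    unfolding quad_def by blast
  have "(e1, {x i s, x (i + 1) t'}) \<in> ?R" "({x i s, x (i + 1) t'}, e2) \<in> ?R"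
    unfolding e by (auto simp: mem_quad)
  then show "(e1, e2) \<in> ?R\<^sup>*" by (rule rtrancl_into_rtrancl[OF r_into_rtrancl])
qed

end

section \<open>Existence of the maps\<close>

text \<open>The two faces at an edge are the one in A and the one in B.\<close>

lemma polytopal_mapI:
  assumes "simple_graph V E" "graph_connected V E"
    and cyc: "\<And>f. f \<in> A \<union> B \<Longrightarrow> is_cycle_face E f"
    and uA: "\<And>e. e \<in> E \<Longrightarrow> \<exists>!f. f \<in> A \<and> e \<in> f" and uB: "\<And>e. e \<in> E \<Longrightarrow> \<exists>!f. f \<in> B \<and> e \<in> f"
    and dis: "A \<inter> B = {}"
    and loc: "\<And>v e1 e2. v \<in> V \<Longrightarrow> e1 \<in> E \<Longrightarrow> v \<in> e1 \<Longrightarrow> e2 \<in> E \<Longrightarrow> v \<in> e2 \<Longrightarrow>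
      (e1, e2) \<in> {(a, b). v \<in> a \<and> v \<in> b \<and> (\<exists>f\<in>A \<union> B. a \<in> f \<and> b \<in> f)}\<^sup>*"
  shows "is_polytopal_map V E (A \<union> B)"
proof -
  have "card {f \<in> A \<union> B. e \<in> f} = 2" if e: "e \<in> E" for e
  proof -
    obtain f where f: "f \<in> A" "e \<in> f" "\<And>f'. f' \<in> A \<Longrightarrow> e \<in> f' \<Longrightarrow> f' = f" using uA[OF e] by (elim ex1E) auto
    obtain g where g: "g \<in> B" "e \<in> g" "\<And>f'. f' \<in> B \<Longrightarrow> e \<in> f' \<Longrightarrow> f' = g" using uB[OF e] by (elim ex1E) auto
    have "{f \<in> A \<union> B. e \<in> f} = {f, g}"
    proof (intro equalityI subsetI)
      fix h assume "h \<in> {f \<in> A \<union> B. e \<in> f}"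
      then show "h \<in> {f, g}" using f(3) g(3) by auto
    next
      fix h assume "h \<in> {f, g}"
      then show "h \<in> {f \<in> A \<union> B. e \<in> f}" using f(1,2) g(1,2) by blast
    qed
    moreover have "f \<noteq> g" using f(1) g(1) dis by blast
    ultimately show ?thesis by simp
  qed
  then show ?thesis unfolding is_polytopal_map_def using assms(1,2) cyc loc by simp
qed

context wreath
begin

lemma star_cases:
  assumes "e \<in> E" "x i s \<in> e"
  obtains t where "e = {x i s, x (i + 1) t}" | t where "e = {x (i - 1) t, x i s}"
proof -
  obtain j p q where e: "e = {x j p, x (j + 1) q}" using assms(1) by (rule edgeE)
  then consider "x i s = x j p" | "x i s = x (j + 1) q" using assms(2) by blast
  then show thesis
  proof cases
    case 1
    then have "int n dvd (i + 1) - (j + 1)" by (simp add: x_eq_iff)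
    then have "x (j + 1) q = x (i + 1) q" using x_cong by metis
    then show thesis using that(1) e 1 by simp
  next
    case 2
    then have "int n dvd (i - 1) - j" by (simp add: x_eq_iff algebra_simps)
    then have "x j p = x (i - 1) p" using x_cong by metis
    then show thesis using that(2) e 2 by simp
  qed
qed

lemma local_connectedI:
  assumes F: "F = {(a, b). v \<in> a \<and> v \<in> b \<and> (\<exists>f\<in>FF. a \<in> f \<and> b \<in> f)}"
    and l: "\<And>e. e \<in> E \<Longrightarrow> v \<in> e \<Longrightarrow> (e0, e) \<in> F\<^sup>*"
    and "e1 \<in> E" "v \<in> e1" "e2 \<in> E" "v \<in> e2"
  shows "(e1, e2) \<in> F\<^sup>*"
proof -
  have "sym F" unfolding F by (auto simp: sym_def)
  from symD[OF sym_rtrancl[OF this] l[OF assms(3,4)]] have "(e1, e0) \<in> F\<^sup>*" .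
  then show ?thesis using l[OF assms(5,6)] by (rule rtrancl_trans)
qed

text \<open>\<open>natA\<close> and \<open>natB\<close> say that the faces are defined from
  coordinates alone, so a change between two systems with the same faces is an automorphism of the
  map. \<open>symm\<close> supplies such a system starting at any given arc, hence arc-transitivity;
  the different lengths a and b keep automorphisms from mixing the kinds.\<close>

lemma class201_coords:
  fixes fa fb :: "(int \<Rightarrow> bool \<Rightarrow> 'v) \<Rightarrow> 'v set set set"
  assumes natA: "\<And>\<sigma> y. face_img \<sigma> ` fa y = fa (\<lambda>i s. \<sigma> (y i s))"
    and natB: "\<And>\<sigma> y. face_img \<sigma> ` fb y = fb (\<lambda>i s. \<sigma> (y i s))"
    and cA: "\<And>f. f \<in> fa x \<Longrightarrow> card f = a" and cB: "\<And>f. f \<in> fb x \<Longrightarrow> card f = b" and ab: "a \<noteq> b"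
    and cyc: "\<And>f. f \<in> fa x \<union> fb x \<Longrightarrow> is_cycle_face E f"
    and uA: "\<And>e. e \<in> E \<Longrightarrow> \<exists>!f. f \<in> fa x \<and> e \<in> f" and uB: "\<And>e. e \<in> E \<Longrightarrow> \<exists>!f. f \<in> fb x \<and> e \<in> f"
    and loc: "\<And>v e1 e2. v \<in> V \<Longrightarrow> e1 \<in> E \<Longrightarrow> v \<in> e1 \<Longrightarrow> e2 \<in> E \<Longrightarrow> v \<in> e2 \<Longrightarrow>
      (e1, e2) \<in> {(c, d). v \<in> c \<and> v \<in> d \<and> (\<exists>f\<in>fa x \<union> fb x. c \<in> f \<and> d \<in> f)}\<^sup>*"
    and symm: "\<And>i p q \<epsilon>. \<epsilon> = 1 \<or> \<epsilon> = - 1 \<Longrightarrow> \<exists>y. wreath n V E y \<and> y 0 False = x i p \<and> y 1 False = x (i + \<epsilon>) q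
      \<and> fa y = fa x \<and> fb y = fb x"
  shows "fa x \<union> fb x \<in> class201_maps V E"
proof -
  let ?F = "fa x \<union> fb x"
  have dis: "fa x \<inter> fb x = {}" using cA cB ab by (metis disjoint_iff)
  have pm: "is_polytopal_map V E ?F"
    by (rule polytopal_mapI[OF simple connected cyc uA uB dis loc])
  have fV: "f \<subseteq> Pow V" if "f \<in> ?F" for f using polytopal_faces(3)[OF pm] that by blast
  have pres: "face_img \<sigma> ` fa x = fa x \<and> face_img \<sigma> ` fb x = fb x" if s: "map_aut V E ?F \<sigma>" for \<sigma>
  proof -
    have inj: "inj_on \<sigma> V" and im: "face_img \<sigma> ` ?F = ?F"
      using s graph_aut_inj by (auto simp: map_aut_def)
    have cd: "card (face_img \<sigma> f) = card f" if "f \<in> ?F" for f by (rule card_face_img[OF fV[OF that] inj])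
    have sA: "face_img \<sigma> ` fa x \<subseteq> fa x"
    proof (rule image_subsetI)
      fix f assume f: "f \<in> fa x"
      then have "face_img \<sigma> f \<in> ?F" using im by blast
      moreover have "card (face_img \<sigma> f) = a" using cd f cA by simp
      ultimately show "face_img \<sigma> f \<in> fa x" using cB ab by blast
    qed
    have sB: "face_img \<sigma> ` fb x \<subseteq> fb x"
    proof (rule image_subsetI)
      fix f assume f: "f \<in> fb x"
      then have "face_img \<sigma> f \<in> ?F" using im by blast
      moreover have "card (face_img \<sigma> f) = b" using cd f cB by simp
      ultimately show "face_img \<sigma> f \<in> fb x" using cA ab by blast
    qed
    have u: "X = fa x \<and> Y = fb x" if "X \<subseteq> fa x" "Y \<subseteq> fb x" "X \<union> Y = fa x \<union> fb x" for X Y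
      using that dis by blast
    show ?thesis using u[OF sA sB] im by (simp add: image_Un)
  qed
  have ay: "\<exists>y. wreath n V E y \<and> y 0 False = u \<and> y 1 False = v \<and> fa y = fa x \<and> fb y = fb x"
    if "{u, v} \<in> E" for u v
    using that
  proof (cases rule: arcE)
    case (1 i p q)
    then show ?thesis using symm[of 1 i p q] by simp
  next
    case (2 i p q)
    then show ?thesis using symm[of "-1" i p q] by simp
  qed
  have arc: "\<exists>\<sigma>. map_aut V E ?F \<sigma> \<and> \<sigma> u = u' \<and> \<sigma> v = v'" if uv: "{u, v} \<in> E" "{u', v'} \<in> E" for u v u' v'
  proof -
    \<comment> \<open>In suitable coordinates each arc is the base arc from
      \<open>(0, False)\<close> to \<open>(1, False)\<close>; the automorphism translates one system
      into the other.\<close>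
    obtain y where y: "wreath n V E y" "y 0 False = u" "y 1 False = v" "fa y = fa x" "fb y = fb x"
      using ay[OF uv(1)] by blast
    obtain z where z: "wreath n V E z" "z 0 False = u'" "z 1 False = v'" "fa z = fa x" "fb z = fb x"
      using ay[OF uv(2)] by blast
    obtain \<sigma> where s: "graph_aut V E \<sigma>" "\<And>i s. \<sigma> (y i s) = z i s"
      using wreath.iso_of_coords[OF y(1) z(1)] by blast
    have "face_img \<sigma> ` (fa y \<union> fb y) = fa z \<union> fb z" by (simp add: image_Un natA natB s(2))
    then have "map_aut V E ?F \<sigma>" using s(1) y z by (simp add: map_aut_def)
    then show ?thesis using s(2)[of 0 False] s(2)[of 1 False] y z by auto
  qed
  have "split_map V E ?F (fa x) (fb x)"
    unfolding split_map_def
    by (intro conjI ballI allI impI refl dis) (use uA uB pres arc in simp_all)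
  then have "class_2_01 V E ?F" by (rule split_imp_class_2_01[OF pm _ E_ne])
  then show ?thesis using pm by (simp add: class201_maps_def)
qed

lemma quad_reindex:
  assumes "\<epsilon> = 1 \<or> \<epsilon> = - 1"
  shows "range (quad (\<lambda>j u. x (i + \<epsilon> * j) (u \<noteq> r j))) = range (quad x)"
proof -
  let ?y = "\<lambda>j u. x (i + \<epsilon> * j) (u \<noteq> r j)"
  have bx: "(\<exists>s. P (s \<noteq> q)) \<longleftrightarrow> (\<exists>s. P s)" for P and q :: bool
    by (cases q) (simp_all add: ex_bool_eq disj_commute)
  have y: "quad ?y j = {{x (i + \<epsilon> * j) s, x (i + \<epsilon> * (j + 1)) t} |s t. True}" for j
  proof (rule set_eqI)
    fix e
    have "e \<in> quad ?y j \<longleftrightarrow> (\<exists>s t. e = {x (i + \<epsilon> * j) (s \<noteq> r j), x (i + \<epsilon> * (j + 1)) (t \<noteq> r (j + 1))})"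
      by (simp add: quad_def)
    also have "\<dots> \<longleftrightarrow> (\<exists>s t. e = {x (i + \<epsilon> * j) s, x (i + \<epsilon> * (j + 1)) t})"
      using bx[of "\<lambda>s. \<exists>t. e = {x (i + \<epsilon> * j) s, x (i + \<epsilon> * (j + 1)) (t \<noteq> r (j + 1))}" "r j"]
        bx[of "\<lambda>t. e = {x (i + \<epsilon> * j) _, x (i + \<epsilon> * (j + 1)) t}" "r (j + 1)"] by simp
    finally show "e \<in> quad ?y j \<longleftrightarrow> e \<in> {{x (i + \<epsilon> * j) s, x (i + \<epsilon> * (j + 1)) t} |s t. True}" by simp
  qed
  show ?thesis using assms
  proof
    assume e: "\<epsilon> = 1"
    have "quad ?y j = quad x (i + j)" for j by (subst y) (simp add: e quad_def add.assoc)
    then have "range (quad ?y) = range (\<lambda>j. quad x (i + j))" by simp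
    also have "\<dots> = range (quad x)" using surj_plus[of i] by (metis image_image)
    finally show ?thesis .
  next
    assume e: "\<epsilon> = - 1"
    \<comment> \<open>Under reflection the fibres j and j + 1 become i - j and i - j - 1; the lower
      one gives the index.\<close>
    have yj: "quad ?y j = quad x (i - 1 - j)" for j
      by (subst y, unfold e quad_def, rule set_eqI) (auto simp: insert_commute algebra_simps)
    show ?thesis
    proof (intro equalityI subsetI)
      fix f assume "f \<in> range (quad ?y)"
      then show "f \<in> range (quad x)" using yj by auto
    next
      fix f assume "f \<in> range (quad x)"
      then obtain k where "f = quad x k" by blast
      then have "f = quad ?y (i - 1 - k)" using yj by simp
      then show "f \<in> range (quad ?y)" by blast
    qed
  qed
qed

lemma pth_reindex:
  assumes "\<epsilon> = 1 \<or> \<epsilon> = - 1"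
  shows "pth (\<lambda>j u. x (i + \<epsilon> * j) (u \<noteq> r j)) t = pth x (\<lambda>k. t (\<epsilon> * (k - i)) \<noteq> r (\<epsilon> * (k - i)))"
    (is "pth ?y t = pth x ?t'")
proof -
  have ee: "\<epsilon> * (i + \<epsilon> * j - i) = j" for j using assms by auto
  have v: "?y j (t j) = x (i + \<epsilon> * j) (?t' (i + \<epsilon> * j))" for j unfolding ee ..
  let ?f = "\<lambda>k. {x k (?t' k), x (k + 1) (?t' (k + 1))}"
  have m: "{?y j (t j), ?y (j + 1) (t (j + 1))} = ?f (if \<epsilon> = 1 then i + j else i - j - 1)" for j
  proof (cases "\<epsilon> = 1")
    case True
    then have "i + \<epsilon> * (j + 1) = i + j + 1" "i + \<epsilon> * j = i + j" by simp_all
    then show ?thesis unfolding v using True by (simp only: simp_thms if_True)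
  next
    case False
    then have "i + \<epsilon> * (j + 1) = i - j - 1" "i + \<epsilon> * j = i - j - 1 + 1" using assms by auto
    then show ?thesis unfolding v using False by (simp only: simp_thms if_False insert_commute)
  qed
  show ?thesis
  proof (intro equalityI subsetI)
    fix e assume "e \<in> pth ?y t"
    then obtain j where "e = {?y j (t j), ?y (j + 1) (t (j + 1))}" unfolding pth_def by blast
    then have "e = ?f (if \<epsilon> = 1 then i + j else i - j - 1)" using m by simp
    then show "e \<in> pth x ?t'" unfolding pth_def by blast
  next
    fix e assume "e \<in> pth x ?t'"
    then obtain k where k: "e = ?f k" unfolding pth_def by blast
    have "(if \<epsilon> = 1 then i + (if \<epsilon> = 1 then k - i else i - k - 1) else i - (if \<epsilon> = 1 then k - i else i - k - 1) - 1) = k"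
      by simp
    then have "e = {?y j (t j), ?y (j + 1) (t (j + 1))}" if "j = (if \<epsilon> = 1 then k - i else i - k - 1)" for j
      unfolding m that k by (simp only:)
    then show "e \<in> pth ?y t" unfolding pth_def by blast
  qed
qed

text \<open>In the new coordinates a member t becomes, at fibre i + \<epsilon> j, the value t(j) +
  r(j). The hypothesis on r says that this changes t + g only by an element of \<open>lin c\<close>,
  so the coset is mapped to itself.\<close>

lemma fam_reindex:
  assumes \<epsilon>: "\<epsilon> = 1 \<or> \<epsilon> = - 1" and r: "(\<lambda>j. r j \<noteq> (g j \<noteq> g (i + \<epsilon> * j))) \<in> lin c"
  shows "pth (\<lambda>j u. x (i + \<epsilon> * j) (u \<noteq> r j)) ` fam c g = pth x ` fam c g"
    (is "pth ?y ` _ = _")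
proof -
  have ee: "\<epsilon> * (i + \<epsilon> * j - i) = j" "i + \<epsilon> * (\<epsilon> * (j - i)) = j" for j using \<epsilon> by auto
  have bk: "(\<lambda>k. d (\<epsilon> * (k - i))) \<in> lin c" if d: "d \<in> lin c" for d
  proof -
    have "(\<lambda>k. d (\<epsilon> * (k - i))) = (\<lambda>k. d (- \<epsilon> * i + \<epsilon> * k))" by (simp add: algebra_simps)
    then show ?thesis using lin_reindex[OF d \<epsilon>, of "- \<epsilon> * i"] by simp
  qed
  show ?thesis
  proof (intro equalityI subsetI)
    fix f assume "f \<in> pth ?y ` fam c g"
    then obtain t where t: "t \<in> fam c g" "f = pth ?y t" by blast
    let ?t' = "\<lambda>k. t (\<epsilon> * (k - i)) \<noteq> r (\<epsilon> * (k - i))"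
    have "(\<lambda>j. (t j \<noteq> g j) \<noteq> (r j \<noteq> (g j \<noteq> g (i + \<epsilon> * j)))) \<in> lin c"
      by (rule lin_xor[OF t(1)[unfolded fam_def mem_Collect_eq] r])
    from bk[OF this] have "(\<lambda>k. ?t' k \<noteq> g k) \<in> lin c"
      unfolding ee by (rule back_subst[of "\<lambda>d. d \<in> lin c"]) auto
    then have "?t' \<in> fam c g" by (simp only: fam_def mem_Collect_eq)
    then show "f \<in> pth x ` fam c g" using t(2) pth_reindex[OF \<epsilon>] by blast
  next
    fix f assume "f \<in> pth x ` fam c g"
    then obtain t where t: "t \<in> fam c g" "f = pth x t" by blast
    let ?t' = "\<lambda>j. t (i + \<epsilon> * j) \<noteq> r j"
    have "(\<lambda>k. t k \<noteq> g k) \<in> lin c" using t(1) by (simp add: fam_def)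
    from lin_xor[OF lin_reindex[OF this \<epsilon>, of i] r]
    have "(\<lambda>j. ?t' j \<noteq> g j) \<in> lin c"
      by (rule back_subst[of "\<lambda>d. d \<in> lin c"]) auto
    then have "?t' \<in> fam c g" by (simp only: fam_def mem_Collect_eq)
    moreover have "pth ?y ?t' = pth x t"
      unfolding pth_reindex[OF \<epsilon>] ee by (rule arg_cong[of _ _ "pth x"]) auto
    ultimately show "f \<in> pth ?y ` fam c g" using t(2) by blast
  qed
qed

lemma fam_corner:
  "\<exists>q. \<exists>f\<in>pth x ` fam c g. {x (i - 1) p, x i s} \<in> f \<and> {x i s, x (i + 1) q} \<in> f"
proof -
  obtain t where t: "t \<in> fam c g" "t (i - 1) = p" "t i = s" using fam_ex[of c g "i - 1" p s] by auto
  have "{x i (t i), x (i + 1) (t (i + 1))} \<in> pth x t" unfolding pth_def by blast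
  moreover have "{x (i - 1) (t (i - 1)), x (i - 1 + 1) (t (i - 1 + 1))} \<in> pth x t" unfolding pth_def by blast
  ultimately show ?thesis using t by auto
qed

text \<open>The condition on 4 separates the two kinds by length. Every relabelling by
  \<open>reindex\<close> keeps the 4-cycles, so only the path family restricts the symmetries, and
  the elements of \<open>lin c\<close> leave enough of them to reach all arcs.\<close>

lemma quad_fam_class201:
  assumes g: "good_fam n c \<kappa> g" and n4: "(if \<kappa> then 2 * n else n) \<noteq> 4"
  shows "range (quad x) \<union> pth x ` fam c g \<in> class201_maps V E"
proof (rule class201_coords[where fa = "\<lambda>y. range (quad y)" and fb = "\<lambda>y. pth y ` fam c g"])
  fix \<sigma> :: "'v \<Rightarrow> 'v" and y :: "int \<Rightarrow> bool \<Rightarrow> 'v"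
  show "face_img \<sigma> ` range (quad y) = range (quad (\<lambda>i s. \<sigma> (y i s)))"
    by (simp add: image_image face_img_quad)
  show "face_img \<sigma> ` pth y ` fam c g = pth (\<lambda>i s. \<sigma> (y i s)) ` fam c g"
    by (simp add: image_image face_img_pth)
next
  show "4 \<noteq> (if \<kappa> then 2 * n else n)" using n4 by simp
  fix f
  show "f \<in> range (quad x) \<Longrightarrow> card f = 4" using card_quad by auto
  show "f \<in> pth x ` fam c g \<Longrightarrow> card f = (if \<kappa> then 2 * n else n)" using card_pth(1)[OF quasi_fam[OF g]] by auto
  assume "f \<in> range (quad x) \<union> pth x ` fam c g"
  then show "is_cycle_face E f" using quad_cycle pth_cycle[OF quasi_fam[OF g]] by auto
next
  fix e assume e: "e \<in> E"
  show "\<exists>!f. f \<in> range (quad x) \<and> e \<in> f" by (rule quad_unique_face[OF e])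
  show "\<exists>!f. f \<in> pth x ` fam c g \<and> e \<in> f" by (rule fam_unique_face[OF g e])
next
  let ?F = "range (quad x) \<union> pth x ` fam c g"
  fix v e1 e2 assume v: "v \<in> V" and e: "e1 \<in> E" "v \<in> e1" "e2 \<in> E" "v \<in> e2"
  let ?R = "{(a, b). v \<in> a \<and> v \<in> b \<and> (\<exists>f\<in>?F. a \<in> f \<and> b \<in> f)}"
  obtain i s where vi: "v = x i s" using v unfolding V_eq by blast
  let ?L = "\<lambda>t. {x (i - 1) t, x i s}" and ?R' = "\<lambda>t. {x i s, x (i + 1) t}"
  \<comment> \<open>Around v the two edges to fibre i - 1 share a 4-cycle, as do the two to fibre i
    + 1; one corner of a path joins the halves.\<close>
  obtain q f where q: "f \<in> pth x ` fam c g" "?L False \<in> f" "?R' q \<in> f" using fam_corner[of c g i False s] by blast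
  have L: "?L t \<in> quad x (i - 1)" for t using mem_quad[of "i - 1" t s "i - 1"] by simp
  have R: "?R' t \<in> quad x i" for t using mem_quad[of i s t i] by simp
  have lq: "(?L False, ?R' q) \<in> ?R" using q vi by auto
  have qr: "(?R' q, ?R' t) \<in> ?R" for t using R[of q] R[of t] vi by auto
  show "(e1, e2) \<in> ?R\<^sup>*"
  proof (rule local_connectedI[OF refl _ e, of "?L False"])
    fix e assume "e \<in> E" "v \<in> e"
    then have "e \<in> E" "x i s \<in> e" using vi by auto
    then show "(?L False, e) \<in> ?R\<^sup>*"
    proof (cases rule: star_cases)
      case (1 t)
      then show ?thesis using rtrancl_into_rtrancl[OF r_into_rtrancl[OF lq] qr[of t]] by (simp only:)
    next
      case (2 t)
      have "(?L False, ?L t) \<in> ?R" using L[of False] L[of t] vi by auto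
      then show ?thesis unfolding 2 by (rule r_into_rtrancl)
    qed
  qed
next
  fix i :: int and p q :: bool and \<epsilon> :: int assume \<epsilon>: "\<epsilon> = 1 \<or> \<epsilon> = - 1"
  \<comment> \<open>These two values are solved from r 0 = p and r 1 = q.\<close>
  obtain \<delta> where d: "\<delta> \<in> lin c" "\<delta> 0 = (p \<noteq> (g 0 \<noteq> g i))" "\<delta> (0 + 1) = (q \<noteq> (g 1 \<noteq> g (i + \<epsilon>)))"
    using lin_ex[of c 0 "p \<noteq> (g 0 \<noteq> g i)" "q \<noteq> (g 1 \<noteq> g (i + \<epsilon>))"] by blast
  define r where "r j = (\<delta> j \<noteq> (g j \<noteq> g (i + \<epsilon> * j)))" for j
  \<comment> \<open>The flips of the two occurrences of g cancel; going backwards n steps flips just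
    as going forwards.\<close>
  have rp: "r (j + int n) = r j" for j
  proof -
    have "\<delta> (j + int n) = \<delta> j" using lin_periodic[OF d(1), of n j] g by (auto simp: good_fam_def split: if_splits)
    moreover have qg: "quasi n \<kappa> g" using g by (simp add: good_fam_def)
    have "g (j + int n) = (g j \<noteq> \<kappa>)" using qg by (simp add: quasi_def)
    moreover have "g (i + \<epsilon> * (j + int n)) = (g (i + \<epsilon> * j) \<noteq> \<kappa>)"
      using quasi_mult[OF qg, of "i + \<epsilon> * j" \<epsilon>] \<epsilon> by (auto simp: algebra_simps)
    ultimately show ?thesis unfolding r_def by blast
  qed
  have rl: "(\<lambda>j. r j \<noteq> (g j \<noteq> g (i + \<epsilon> * j))) \<in> lin c"
    using d(1) unfolding r_def xor_cancel .
  let ?y = "\<lambda>j u. x (i + \<epsilon> * j) (u \<noteq> r j)"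
  have "wreath n V E ?y" by (rule reindex[of r \<epsilon> i, OF rp \<epsilon>])
  moreover have "r 0 = p" "r 1 = q" using d by (auto simp: r_def)
  ultimately show "\<exists>y. wreath n V E y \<and> y 0 False = x i p \<and> y 1 False = x (i + \<epsilon>) q
      \<and> range (quad y) = range (quad x) \<and> pth y ` fam c g = pth x ` fam c g"
    using quad_reindex[OF \<epsilon>, of i r] fam_reindex[OF \<epsilon> rl] by (intro exI[of _ ?y]) simp
qed

text \<open>The sequence 0, 0, 1, 1 of period 4, a particular solution of t(i+2) = t(i) + 1. Adding
  it to a 2-periodic family reverses every exit.\<close>

definition (in -) q4 :: "int \<Rightarrow> bool" where "q4 i = odd (i div 2)"

lemma (in -) q4_2: "q4 (i + 2) = (\<not> q4 i)" "q4 (i - 2) = (\<not> q4 i)"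
proof -
  have "(i + 2) div 2 = i div 2 + 1" "(i - 2) div 2 = i div 2 - 1" by presburger+
  then show "q4 (i + 2) = (\<not> q4 i)" "q4 (i - 2) = (\<not> q4 i)" by (simp_all add: q4_def)
qed

lemma (in -) quasi_q4:
  assumes "even n"
  shows "quasi n (n mod 4 = 2) q4"
proof -
  obtain k where k: "n = 2 * k" using assms by (auto elim!: evenE)
  have "(i + int n) div 2 = i div 2 + int k" for i unfolding k by simp
  moreover have "n mod 4 = 2 \<longleftrightarrow> odd k" unfolding k by presburger
  ultimately show ?thesis by (auto simp: quasi_def q4_def)
qed

text \<open>A shifted or reflected \<open>q4\<close> solves the same inhomogeneous recursion, so the
  difference solves the homogeneous one.\<close>

lemma (in -) q4_xor_lin:
  assumes "\<epsilon> = 1 \<or> \<epsilon> = - 1"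
  shows "(\<lambda>j. q4 j \<noteq> q4 (i + \<epsilon> * j)) \<in> lin False"
  unfolding lin_def mem_Collect_eq
proof
  fix k
  have "i + \<epsilon> * (k + 2) = (i + \<epsilon> * k) + 2 \<or> i + \<epsilon> * (k + 2) = (i + \<epsilon> * k) - 2"
    using assms by auto
  then have "q4 (i + \<epsilon> * (k + 2)) = (\<not> q4 (i + \<epsilon> * k))" by (elim disjE) (simp_all only: q4_2)
  then show "(q4 (k + 2) \<noteq> q4 (i + \<epsilon> * (k + 2))) = ((q4 k \<noteq> q4 (i + \<epsilon> * k)) \<noteq>
      (False \<and> (q4 (k + 1) \<noteq> q4 (i + \<epsilon> * (k + 1)))))"
    using q4_2(1)[of k] by blast
qed

text \<open>These are the families with b = 0 and b = 1. For n = 2 modulo 4 the sequence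
  \<open>q4\<close> flips after n steps, giving lengths n and 2n. Both families are stable under
  shifts, reflections and addition of \<open>lin False\<close>, so one relabelling serves
  both.\<close>

lemma fam_fam_class201:
  assumes n: "n mod 4 = 2"
  shows "pth x ` fam False (\<lambda>_. False) \<union> pth x ` fam False q4 \<in> class201_maps V E"
proof (rule class201_coords[where fa = "\<lambda>y. pth y ` fam False (\<lambda>_. False)" and fb = "\<lambda>y. pth y ` fam False q4"])
  have en: "even n" using n by presburger
  have gA: "good_fam n False False (\<lambda>_. False)" using en by (simp add: good_fam_def quasi_def)
  have gB: "good_fam n False True q4" using en n quasi_q4[OF en] by (simp add: good_fam_def)
  {
    fix \<sigma> :: "'v \<Rightarrow> 'v" and y :: "int \<Rightarrow> bool \<Rightarrow> 'v"
    show "face_img \<sigma> ` pth y ` fam False (\<lambda>_. False) = pth (\<lambda>i s. \<sigma> (y i s)) ` fam False (\<lambda>_. False)"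
      "face_img \<sigma> ` pth y ` fam False q4 = pth (\<lambda>i s. \<sigma> (y i s)) ` fam False q4"
      by (simp_all add: image_image face_img_pth)
  next
    show "n \<noteq> 2 * n" using n3 by simp
    fix f
    show "f \<in> pth x ` fam False (\<lambda>_. False) \<Longrightarrow> card f = n" using card_pth(1)[OF quasi_fam[OF gA]] by auto
    show "f \<in> pth x ` fam False q4 \<Longrightarrow> card f = 2 * n" using card_pth(1)[OF quasi_fam[OF gB]] by auto
    assume "f \<in> pth x ` fam False (\<lambda>_. False) \<union> pth x ` fam False q4"
    then show "is_cycle_face E f" using pth_cycle[OF quasi_fam[OF gA]] pth_cycle[OF quasi_fam[OF gB]] by auto
  next
    fix e assume e: "e \<in> E"
    show "\<exists>!f. f \<in> pth x ` fam False (\<lambda>_. False) \<and> e \<in> f" by (rule fam_unique_face[OF gA e])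
    show "\<exists>!f. f \<in> pth x ` fam False q4 \<and> e \<in> f" by (rule fam_unique_face[OF gB e])
  next
    let ?F = "pth x ` fam False (\<lambda>_. False) \<union> pth x ` fam False q4"
    fix v e1 e2 assume v: "v \<in> V" and e: "e1 \<in> E" "v \<in> e1" "e2 \<in> E" "v \<in> e2"
    let ?R = "{(a, b). v \<in> a \<and> v \<in> b \<and> (\<exists>f\<in>?F. a \<in> f \<and> b \<in> f)}"
    obtain i s where vi: "v = x i s" using v unfolding V_eq by blast
    let ?L = "\<lambda>t. {x (i - 1) t, x i s}" and ?R' = "\<lambda>t. {x i s, x (i + 1) t}"
    have lr: "(?L p, ?R' q) \<in> ?R" for p q
    proof -
      \<comment> \<open>Going from p to q across a fibre needs b = 0 if p = q and b = 1 otherwise,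
        so any two edges on opposite sides of the vertex form a corner.\<close>
      define g where "g = (if p = q then (\<lambda>_. False) else q4)"
      obtain t where t: "t \<in> fam False g" "t (i - 1) = p" "t (i - 1 + 1) = s" using fam_ex[of False g "i - 1" p s] by blast
      have i2: "i - 1 + 2 = i + 1" by simp
      have "(\<lambda>i. t i \<noteq> g i) \<in> lin False" using t(1) by (simp add: fam_def)
      from linD[OF this, of "i - 1"]
      have "(t (i + 1) \<noteq> g (i + 1)) = (t (i - 1) \<noteq> g (i - 1))" unfolding i2 by blast
      moreover have "g (i + 1) = (g (i - 1) \<noteq> (p \<noteq> q))"
        using q4_2(1)[of "i - 1"] unfolding i2 g_def by (cases "p = q") (simp_all only: if_True if_False simp_thms)
      ultimately have tq: "t (i + 1) = q" using t(2) by blast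
      have "{x (i - 1) (t (i - 1)), x (i - 1 + 1) (t (i - 1 + 1))} \<in> pth x t"
        "{x i (t i), x (i + 1) (t (i + 1))} \<in> pth x t" unfolding pth_def by blast+
      then have "?L p \<in> pth x t" "?R' q \<in> pth x t" using t tq by simp_all
      moreover have "pth x t \<in> ?F" using t(1) unfolding g_def by (auto split: if_splits)
      ultimately show ?thesis unfolding vi by blast
    qed
    have "sym ?R" by (auto simp: sym_def)
    then have rl: "(?R' q, ?L p) \<in> ?R" for p q using lr by (rule symD)
    show "(e1, e2) \<in> ?R\<^sup>*"
    proof (rule local_connectedI[OF refl _ e, of "?L False"])
      fix e assume "e \<in> E" "v \<in> e"
      then have "e \<in> E" "x i s \<in> e" using vi by auto
      then show "(?L False, e) \<in> ?R\<^sup>*"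
      proof (cases rule: star_cases)
        case (1 t)
        then show ?thesis using lr[of False t] by (simp only: r_into_rtrancl)
      next
        case (2 t)
        show ?thesis unfolding 2 by (rule rtrancl_into_rtrancl[OF r_into_rtrancl[OF lr] rl[of False t]])
      qed
    qed
  next
    fix i :: int and p q :: bool and \<epsilon> :: int assume \<epsilon>: "\<epsilon> = 1 \<or> \<epsilon> = - 1"
    obtain \<delta> where d: "\<delta> \<in> lin False" "\<delta> 0 = p" "\<delta> (0 + 1) = q"
      using lin_ex[of False 0 p q] by blast
    have rp: "\<delta> (j + int n) = \<delta> j" for j using lin_periodic[OF d(1), of n j] en by simp
    have r1: "(\<lambda>j. \<delta> j \<noteq> (False \<noteq> False)) \<in> lin False" using d(1) by simp
    have r2: "(\<lambda>j. \<delta> j \<noteq> (q4 j \<noteq> q4 (i + \<epsilon> * j))) \<in> lin False"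
      by (rule lin_xor[OF d(1) q4_xor_lin[OF \<epsilon>]])
    let ?y = "\<lambda>j u. x (i + \<epsilon> * j) (u \<noteq> \<delta> j)"
    have "wreath n V E ?y" by (rule reindex[of \<delta> \<epsilon> i, OF rp \<epsilon>])
    moreover have "\<delta> 0 = p" "\<delta> 1 = q" using d by auto
    ultimately show "\<exists>y. wreath n V E y \<and> y 0 False = x i p \<and> y 1 False = x (i + \<epsilon>) q
        \<and> pth y ` fam False (\<lambda>_. False) = pth x ` fam False (\<lambda>_. False) \<and> pth y ` fam False q4 = pth x ` fam False q4"
      using fam_reindex[OF \<epsilon> r1, of i] fam_reindex[OF \<epsilon> r2] by (intro exI[of _ ?y]) simp
  }
qed

end

section \<open>Corners of a split map\<close>

text \<open>C already has both edges of D at each of its vertices, so it is closed under adjacency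
  in D, and D is connected.\<close>

lemma cycle_face_subset_eq:
  assumes C: "is_cycle_face E C" and D: "is_cycle_face E D" and sub: "C \<subseteq> D"
  shows "C = D"
proof
  obtain e0 where e0: "e0 \<in> C" using C by (auto simp: is_cycle_face_def)
  show "D \<subseteq> C"
  proof
    fix e assume "e \<in> D"
    then have "(e0, e) \<in> {(x, y). x \<in> D \<and> y \<in> D \<and> x \<inter> y \<noteq> {}}\<^sup>*"
      using D e0 sub unfolding is_cycle_face_def by blast
    then show "e \<in> C"
    proof (induction rule: rtrancl_induct)
      case base
      show ?case by (rule e0)
    next
      case (step a b)
      then obtain v where v: "v \<in> a" "v \<in> b" "b \<in> D" by auto
      have c: "card {e \<in> C. v \<in> e} = 2" "card {e \<in> D. v \<in> e} = 2" "finite D"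
        using C D sub v step.IH unfolding is_cycle_face_def by blast+
      have "{e \<in> C. v \<in> e} = {e \<in> D. v \<in> e}"
        by (rule card_subset_eq) (use c sub in auto)
      then show ?case using v by blast
    qed
  qed
qed (rule sub)

definition corner :: "'v set set set \<Rightarrow> 'v \<Rightarrow> 'v \<Rightarrow> 'v \<Rightarrow> bool" where
  "corner X u v w \<longleftrightarrow> (\<exists>f\<in>X. {u, v} \<in> f \<and> {v, w} \<in> f \<and> u \<noteq> w)"

lemma corner_sym: "corner X u v w \<Longrightarrow> corner X w v u"
  unfolding corner_def by (auto simp: insert_commute)

locale split_wreath = wreath +
  fixes F A B :: "'v set set set"
  assumes pm: "is_polytopal_map V E F" and sp: "split_map V E F A B"
begin

lemma F_eq: "F = A \<union> B" and AB_disj: "A \<inter> B = {}"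
  using sp unfolding split_map_def by (rule conjunct1, elim conjE)

lemma pick:
  assumes X: "X = A \<or> X = B"
  shows sub_F: "X \<subseteq> F"
    and unique_face: "\<And>e. e \<in> E \<Longrightarrow> \<exists>!f. f \<in> X \<and> e \<in> f"
    and aut_X: "\<And>\<sigma>. map_aut V E F \<sigma> \<Longrightarrow> face_img \<sigma> ` X = X"
proof -
  note S = sp[unfolded split_map_def]
  note S3 = S[THEN conjunct2, THEN conjunct2]
  show "X \<subseteq> F" using X F_eq by blast
  show "\<exists>!f. f \<in> X \<and> e \<in> f" if "e \<in> E" for e
    using X S3[THEN conjunct1, rule_format, OF that] S3[THEN conjunct2, THEN conjunct1, rule_format, OF that]
    by (elim disjE) simp_all
  show "face_img \<sigma> ` X = X" if "map_aut V E F \<sigma>" for \<sigma>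
    using X S3[THEN conjunct2, THEN conjunct2, THEN conjunct1, rule_format, OF that] by (elim disjE) simp_all
qed

lemma arc_trans: "{u, v} \<in> E \<Longrightarrow> {u', v'} \<in> E \<Longrightarrow> \<exists>\<sigma>. map_aut V E F \<sigma> \<and> \<sigma> u = u' \<and> \<sigma> v = v'"
  by (rule sp[unfolded split_map_def, THEN conjunct2, THEN conjunct2, THEN conjunct2, THEN conjunct2,
        THEN conjunct2, rule_format])

lemma face_cycle: "f \<in> F \<Longrightarrow> is_cycle_face E f"
  using pm unfolding is_polytopal_map_def by simp

lemma faceE: "f \<in> F \<Longrightarrow> f \<subseteq> E"
  using face_cycle by (simp add: is_cycle_face_def)

lemma face_obtain:
  assumes X: "X = A \<or> X = B" and e: "e \<in> E"
  obtains f where "f \<in> X" "e \<in> f"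
  using ex1_implies_ex[OF unique_face[OF X e]] by auto

lemma face_uniq:
  assumes X: "X = A \<or> X = B" and "e \<in> E" "f \<in> X" "e \<in> f" "f' \<in> X" "e \<in> f'"
  shows "f = f'"
  using unique_face[OF X assms(2)] assms(3-) by (elim ex1E) auto

lemma edge_ends: "{u, v} \<in> E \<Longrightarrow> u \<in> V \<and> v \<in> V \<and> u \<noteq> v"
  by (auto elim!: arcE simp: x_in_V x_step_neq x_step_neq[of "_ - 1", simplified])

lemma corner_edges:
  assumes "X = A \<or> X = B" "corner X u v w"
  shows "{u, v} \<in> E" "{v, w} \<in> E" "u \<noteq> w"
  using assms faceE sub_F[OF assms(1)] unfolding corner_def by blast+

lemma corner_exists:
  assumes X: "X = A \<or> X = B" and e: "{u, v} \<in> E"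
  obtains w where "corner X u v w"
proof -
  obtain f where f: "f \<in> X" "{u, v} \<in> f" using face_obtain[OF X e] .
  have fF: "f \<in> F" using sub_F[OF X] f(1) by blast
  have c2: "card {d \<in> f. v \<in> d} = 2" using face_cycle[OF fF] f(2) unfolding is_cycle_face_def by blast
  obtain d1 d2 where d: "{d \<in> f. v \<in> d} = {d1, d2}" "d1 \<noteq> d2" using c2 by (auto simp: card_2_iff)
  have "{u, v} \<in> {d1, d2}" using f(2) unfolding d(1)[symmetric] by simp
  then obtain d' where "d' \<in> {d1, d2}" "d' \<noteq> {u, v}" using d(2) by blast
  then have d': "d' \<in> f" "v \<in> d'" "d' \<noteq> {u, v}" unfolding d(1)[symmetric] by simp_all
  then have "d' \<in> E" using faceE[OF fF] by blast
  then obtain a b where "d' = {a, b}" using simple_graph_edgeE[OF simple] by metis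
  then obtain w where w: "d' = {v, w}" using d'(2) by auto
  have "u \<noteq> w" using w d'(3) by (auto simp: insert_commute)
  then have "corner X u v w" unfolding corner_def using f w d'(1) by blast
  then show thesis by (rule that)
qed

lemma no_three_edges:
  assumes f: "f \<in> F" "{v, a} \<in> f" "{v, b} \<in> f" "{v, c} \<in> f" and ne: "a \<noteq> b" "a \<noteq> c" "b \<noteq> c"
  shows False
proof -
  have c2: "card {d \<in> f. v \<in> d} = 2" and fin: "finite f"
    using face_cycle[OF f(1)] f(2) unfolding is_cycle_face_def by blast+
  have "{{v, a}, {v, b}, {v, c}} \<subseteq> {d \<in> f. v \<in> d}" using f by auto
  moreover have "card {{v, a}, {v, b}, {v, c}} = 3"
    using ne by (auto simp: doubleton_eq_iff card_insert_if)
  ultimately have "3 \<le> card {d \<in> f. v \<in> d}" using fin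
    by (metis (no_types, lifting) card_mono finite_subset mem_Collect_eq subsetI)
  then show False using c2 by simp
qed

lemma corner_unique:
  assumes X: "X = A \<or> X = B" and w: "corner X u v w" "corner X u v w'"
  shows "w = w'"
proof (rule ccontr)
  assume ne: "w \<noteq> w'"
  obtain f where f: "f \<in> X" "{u, v} \<in> f" "{v, w} \<in> f" "u \<noteq> w" using w(1) unfolding corner_def by blast
  obtain f' where f': "f' \<in> X" "{u, v} \<in> f'" "{v, w'} \<in> f'" "u \<noteq> w'" using w(2) unfolding corner_def by blast
  have "f' = f" by (rule face_uniq[OF X corner_edges(1)[OF X w(1)] f'(1,2) f(1,2)])
  moreover have "f \<in> F" using sub_F[OF X] f(1) by blast
  ultimately show False
    using no_three_edges[of f v u w w'] f f' ne by (simp add: insert_commute)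
qed

lemma corner_aut:
  assumes X: "X = A \<or> X = B" and s: "map_aut V E F \<sigma>" and c: "corner X u v w"
  shows "corner X (\<sigma> u) (\<sigma> v) (\<sigma> w)"
proof -
  obtain f where f: "f \<in> X" "{u, v} \<in> f" "{v, w} \<in> f" "u \<noteq> w" using c unfolding corner_def by blast
  have "face_img \<sigma> f \<in> X" using aut_X[OF X s] f(1) by blast
  moreover have "{\<sigma> u, \<sigma> v} = \<sigma> ` {u, v}" "{\<sigma> v, \<sigma> w} = \<sigma> ` {v, w}" by auto
  then have "{\<sigma> u, \<sigma> v} \<in> face_img \<sigma> f" "{\<sigma> v, \<sigma> w} \<in> face_img \<sigma> f"
    using f(2,3) unfolding face_img_def by (metis imageI)+
  moreover have "inj_on \<sigma> V" using s graph_aut_inj by (auto simp: map_aut_def)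
  then have "\<sigma> u \<noteq> \<sigma> w"
    using f(4) edge_ends[OF corner_edges(1)[OF X c]] edge_ends[OF corner_edges(2)[OF X c]]
    by (auto dest: inj_onD)
  ultimately show ?thesis unfolding corner_def by blast
qed

lemma three_neighbours:
  assumes "v \<in> V"
  obtains a b c where "{v, a} \<in> E" "{v, b} \<in> E" "{v, c} \<in> E" "a \<noteq> b" "a \<noteq> c" "b \<noteq> c"
proof -
  obtain i s where v: "v = x i s" using assms unfolding V_eq by blast
  have "{v, x (i + 1) False} \<in> E" "{v, x (i + 1) True} \<in> E" "{v, x (i - 1) True} \<in> E"
    unfolding v edge_iff by simp_all
  moreover have "x (i + 1) p \<noteq> x (i - 1) q" for p q using small_not_dvd by (simp add: x_eq_iff)
  moreover have "x (i + 1) False \<noteq> x (i + 1) True" by (simp add: x_eq_iff)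
  ultimately show thesis using that by blast
qed

text \<open>If the A-face and the B-face turned the same way at v, the two edges uv and vw would be
  closed under sharing a face at v. The faces around v are connected, and v has at least three
  neighbours.\<close>

lemma corner_A_B_distinct:
  assumes a: "corner A u v w" and b: "corner B u v w'"
  shows "w \<noteq> w'"
proof
  assume "w = w'"
  then have [simp]: "w' = w" by simp
  have uv: "{u, v} \<in> E" "u \<in> V" "v \<in> V" using corner_edges[of A] a edge_ends by blast+
  let ?R = "{(x, y). v \<in> x \<and> v \<in> y \<and> (\<exists>f\<in>F. x \<in> f \<and> y \<in> f)}"
  have closed: "d' \<in> {{u, v}, {v, w}}" if d: "d \<in> {{u, v}, {v, w}}" "(d, d') \<in> ?R" for d d'
  proof (rule ccontr)
    assume no: "d' \<notin> {{u, v}, {v, w}}"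
    obtain f where f: "f \<in> F" "d \<in> f" "d' \<in> f" "v \<in> d'" using d(2) by blast
    have "d' \<in> E" using faceE f by blast
    then obtain z where z: "d' = {v, z}" using simple_graph_edgeE[OF simple] f(4) by (metis insertE insert_commute singletonD)
    obtain X where X: "X = A \<or> X = B" "f \<in> X" using f(1) F_eq by blast
    have cX: "corner X u v w" using X(1) a b by auto
    have zz: "z \<noteq> u" "z \<noteq> w" using no z by (auto simp: insert_commute)
    show False
    proof (cases "d = {u, v}")
      case True
      then have "corner X u v z" unfolding corner_def using X(2) f zz z by blast
      then show False using corner_unique[OF X(1) cX] zz by blast
    next
      case False
      then have "d = {w, v}" using d(1) by (auto simp: insert_commute)
      then have "corner X w v z" unfolding corner_def using X(2) f zz z by blast
      then show False using corner_unique[OF X(1) corner_sym[OF cX]] zz by blast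
    qed
  qed
  have all: "d \<in> {{u, v}, {v, w}}" if d: "d \<in> E" "v \<in> d" for d
  proof -
    have "({u, v}, d) \<in> ?R\<^sup>*" using pm uv d unfolding is_polytopal_map_def by blast
    then show ?thesis
    proof (induction rule: rtrancl_induct)
      case base
      show ?case by simp
    next
      case (step y z)
      show ?case by (rule closed[OF step.IH step.hyps(2)])
    qed
  qed
  obtain p q r where "{v, p} \<in> E" "{v, q} \<in> E" "{v, r} \<in> E" "p \<noteq> q" "p \<noteq> r" "q \<noteq> r"
    by (rule three_neighbours[OF uv(3)])
  then show False using all[of "{v, p}"] all[of "{v, q}"] all[of "{v, r}"] by (auto simp: doubleton_eq_iff)
qed

text \<open>An automorphism moving an edge of f to an edge of f' must move f to f', as it preserves
  the kind.\<close>

lemma card_faces_eq: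
  assumes X: "X = A \<or> X = B" and f: "f \<in> X" "f' \<in> X"
  shows "card f = card f'"
proof -
  have F': "f \<in> F" "f' \<in> F" using sub_F[OF X] f by blast+
  have "f \<noteq> {}" "f' \<noteq> {}" using face_cycle[OF F'(1)] face_cycle[OF F'(2)] by (simp_all add: is_cycle_face_def)
  then obtain d d' where d: "d \<in> f" "d' \<in> f'" by blast
  then have dE: "d \<in> E" "d' \<in> E" using faceE[OF F'(1)] faceE[OF F'(2)] by blast+
  obtain u v where e1: "d = {u, v}" using simple_graph_edgeE[OF simple dE(1)] by metis
  obtain u' v' where e2: "d' = {u', v'}" using simple_graph_edgeE[OF simple dE(2)] by metis
  note e = e1 e2
  obtain \<sigma> where s: "map_aut V E F \<sigma>" "\<sigma> u = u'" "\<sigma> v = v'" using arc_trans dE e by blast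
  have "face_img \<sigma> f \<in> X" using aut_X[OF X s(1)] f(1) by blast
  moreover have "d' \<in> face_img \<sigma> f" using d(1) e s by (auto simp: face_img_def intro!: image_eqI[of _ _ d])
  ultimately have "face_img \<sigma> f = f'" by (rule face_uniq[OF X dE(2) _ _ f(2) d(2)])
  moreover have "f \<subseteq> Pow V" using faceE[OF F'(1)] E_Pow by blast
  moreover have "inj_on \<sigma> V" using s graph_aut_inj by (auto simp: map_aut_def)
  ultimately show ?thesis using card_face_img by metis
qed

text \<open>An automorphism interchanging the two kinds of faces would merge the two flag orbits.\<close>
lemma no_swap:
  assumes "wreath n V E y" "\<And>\<sigma>. (\<And>i s. \<sigma> (x i s) = y i s) \<Longrightarrow> face_img \<sigma> ` A = B"
    "\<And>\<sigma>. (\<And>i s. \<sigma> (x i s) = y i s) \<Longrightarrow> face_img \<sigma> ` B = A"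
  shows False
proof -
  obtain \<sigma> where s: "graph_aut V E \<sigma>" "\<And>i s. \<sigma> (x i s) = y i s" using iso_of_coords[OF assms(1)] by blast
  have AB: "face_img \<sigma> ` A = B" "face_img \<sigma> ` B = A" using assms(2,3) s(2) by blast+
  then have "map_aut V E F \<sigma>" using s(1) by (simp add: map_aut_def F_eq image_Un Un_commute)
  then have "face_img \<sigma> ` A = A" using aut_X by blast
  then have "A = {}" using AB AB_disj by simp
  then show False using face_obtain[of A] E_ne by blast
qed

end

section \<open>Straight families\<close>

text \<open>H i is a right inverse of G i, used to run the recursion backwards.\<close>
lemma int_recursion:
  fixes G H :: "int \<Rightarrow> 'a \<Rightarrow> 'a"
  assumes GH: "\<And>i a. G i (H i a) = a"
  obtains T where "T 0 = a0" "\<And>i. T (i + 1) = G i (T i)"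
proof -
  define u where "u = rec_nat a0 (\<lambda>k. G (int k))"
  define w where "w = rec_nat a0 (\<lambda>k. H (- int k - 1))"
  have u: "u 0 = a0" "u (Suc k) = G (int k) (u k)" for k by (simp_all add: u_def)
  have w: "w 0 = a0" "w (Suc k) = H (- int k - 1) (w k)" for k by (simp_all add: w_def)
  define T where "T i = (if i \<ge> 0 then u (nat i) else w (nat (- i)))" for i
  have "T (i + 1) = G i (T i)" for i
  proof (cases "i \<ge> 0")
    case True
    then obtain k where k: "i = int k" using nonneg_int_cases by blast
    have "nat (i + 1) = Suc k" using k by simp
    then show ?thesis unfolding T_def using u(2)[of k] k by simp
  next
    case False
    then have "i = - int (nat (- i - 1)) - 1" by simp
    then obtain k where k: "i = - int k - 1" by blast
    have "nat (- i) = Suc k" using k by simp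
    then have "T i = H i (w k)" unfolding T_def using w(2)[of k] k by simp
    moreover have "i + 1 = - int k" using k by simp
    then have "T (i + 1) = w k" unfolding T_def using u(1) w(1) by (cases "k = 0") simp_all
    ultimately show ?thesis using GH by simp
  qed
  moreover have "T 0 = a0" by (simp add: T_def u)
  ultimately show thesis using that by blast
qed

lemma fam_eq_fam:
  assumes "(\<lambda>i. g i \<noteq> g' i) \<in> lin c"
  shows "fam c g = fam c g'"
proof -
  have "(\<lambda>i. t i \<noteq> g i) \<in> lin c \<longleftrightarrow> (\<lambda>i. t i \<noteq> g' i) \<in> lin c" for t
  proof
    assume "(\<lambda>i. t i \<noteq> g i) \<in> lin c"
    from lin_xor[OF this assms] show "(\<lambda>i. t i \<noteq> g' i) \<in> lin c"
      by (rule back_subst[of "\<lambda>d. d \<in> lin c"]) auto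
  next
    assume "(\<lambda>i. t i \<noteq> g' i) \<in> lin c"
    from lin_xor[OF this assms] show "(\<lambda>i. t i \<noteq> g i) \<in> lin c"
      by (rule back_subst[of "\<lambda>d. d \<in> lin c"]) auto
  qed
  then show ?thesis by (simp add: fam_def)
qed

lemma pth_twist: "pth (\<lambda>i s. x i (s \<noteq> r i)) t = pth x (\<lambda>i. t i \<noteq> r i)"
  by (simp add: pth_def)

text \<open>The relabelling adds r once in the vertices and once in g, and the two cancel. Thus g
  can be altered by any n-periodic sequence.\<close>

lemma fam_twist: "pth (\<lambda>i s. x i (s \<noteq> r i)) ` fam c (\<lambda>i. g i \<noteq> r i) = pth x ` fam c g"
proof -
  have m: "t \<in> fam c g \<longleftrightarrow> (\<lambda>i. t i \<noteq> r i) \<in> fam c (\<lambda>i. g i \<noteq> r i)" for t g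
  proof -
    have "(\<lambda>i. (t i \<noteq> r i) \<noteq> (g i \<noteq> r i)) = (\<lambda>i. t i \<noteq> g i)" by auto
    then show ?thesis by (simp only: fam_def mem_Collect_eq)
  qed
  show ?thesis
  proof (intro equalityI subsetI)
    fix f assume "f \<in> pth (\<lambda>i s. x i (s \<noteq> r i)) ` fam c (\<lambda>i. g i \<noteq> r i)"
    then obtain t where t: "t \<in> fam c (\<lambda>i. g i \<noteq> r i)" "f = pth x (\<lambda>i. t i \<noteq> r i)"
      by (elim imageE) (simp only: pth_twist)
    have "(\<lambda>i. t i \<noteq> r i) \<in> fam c (\<lambda>i. (g i \<noteq> r i) \<noteq> r i)" by (rule m[THEN iffD1, OF t(1)])
    then show "f \<in> pth x ` fam c g" unfolding xor_cancel using t(2) by blast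
  next
    fix f assume "f \<in> pth x ` fam c g"
    then obtain t where t: "t \<in> fam c g" "f = pth x t" by blast
    have "pth (\<lambda>i s. x i (s \<noteq> r i)) (\<lambda>i. t i \<noteq> r i) = f" unfolding pth_twist xor_cancel t(2) ..
    then show "f \<in> pth (\<lambda>i s. x i (s \<noteq> r i)) ` fam c (\<lambda>i. g i \<noteq> r i)"
      using m[THEN iffD1, OF t(1)] by (intro image_eqI) (rule sym)
  qed
qed

lemma (in wreath) twist:
  assumes "\<And>j. r (j + int n) = r j"
  shows "wreath n V E (\<lambda>i s. x i (s \<noteq> r i))"
  using reindex[of r 1 0, OF assms] by simp

lemma (in wreath) quad_twist: "range (quad (\<lambda>i s. x i (s \<noteq> r i))) = range (quad x)"
  using quad_reindex[of 1 0 r] by simp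

definition twin :: "(int \<Rightarrow> bool \<Rightarrow> 'v) \<Rightarrow> 'v \<Rightarrow> 'v \<Rightarrow> bool" where
  "twin x u w \<longleftrightarrow> (\<exists>j t. u = x j t \<and> w = x j (\<not> t))"

text \<open>The fibres are blocks of the automorphism group of the map. For n other than 4 this is
  automatic; for n = 4 it depends on the coordinates.\<close>

locale twin_wreath = split_wreath +
  assumes tw: "\<And>\<sigma> i s. map_aut V E F \<sigma> \<Longrightarrow> twin x (\<sigma> (x i s)) (\<sigma> (x i (\<not> s)))"
begin

lemma twin_wreath_sym: "twin_wreath n V E x F B A"
  by unfold_locales (use pm sp split_map_sym tw in blast)+

lemma twin_iff: "twin x (x i s) w \<longleftrightarrow> w = x i (\<not> s)"
proof
  assume "twin x (x i s) w"
  then obtain j t where j: "x i s = x j t" "w = x j (\<not> t)" unfolding twin_def by blast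
  then have "int n dvd j - i" "s = t" by (auto simp: x_eq_iff dvd_diff_commute)
  then show "w = x i (\<not> s)" using x_cong j by simp
qed (auto simp: twin_def)

text \<open>By arc-transitivity any corner of kind X is an image of the given one, and blocks go to
  blocks.\<close>

lemma vertical_all:
  assumes X: "X = A \<or> X = B" and c: "corner X u v w" "twin x u w" and c': "corner X u' v' w'"
  shows "twin x u' w'"
proof -
  obtain \<sigma> where s: "map_aut V E F \<sigma>" "\<sigma> u = u'" "\<sigma> v = v'"
    using arc_trans[OF corner_edges(1)[OF X c(1)] corner_edges(1)[OF X c']] by blast
  have "corner X u' v' (\<sigma> w)" using corner_aut[OF X s(1) c(1)] s by simp
  then have "w' = \<sigma> w" using corner_unique[OF X c'] by blast
  moreover obtain i t where "u = x i t" "w = x i (\<not> t)" using c(2) unfolding twin_def by blast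
  ultimately show ?thesis using tw[OF s(1), of i t] s by simp
qed

lemma corner_in_face:
  assumes X: "X = A \<or> X = B" and f: "f \<in> X" "{u, v} \<in> f" and c: "corner X u v w"
  shows "{v, w} \<in> f"
proof -
  obtain f' where f': "f' \<in> X" "{u, v} \<in> f'" "{v, w} \<in> f'" using c unfolding corner_def by blast
  have "f' = f" by (rule face_uniq[OF X corner_edges(1)[OF X c] f'(1,2) f])
  then show ?thesis using f' by simp
qed

text \<open>Turning back repeatedly from one edge produces all four edges between its two fibres,
  and a cycle containing a 4-cycle equals it.\<close>

lemma vertical_quads:
  assumes X: "X = A \<or> X = B" and vert: "\<And>u v w. corner X u v w \<Longrightarrow> twin x u w"
  shows "X = range (quad x)"
proof -
  have st: "{v, x i (\<not> s)} \<in> f" if f: "f \<in> X" "{x i s, v} \<in> f" for f i s v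
  proof -
    have "{x i s, v} \<in> E" using faceE sub_F[OF X] f by blast
    then obtain w where w: "corner X (x i s) v w" by (rule corner_exists[OF X])
    then have "w = x i (\<not> s)" using vert twin_iff by blast
    then show ?thesis using corner_in_face[OF X f w] by simp
  qed
  have q: "f = quad x i" if f: "f \<in> X" "{x i p, x (i + 1) q} \<in> f" for f i p q
  proof -
    have a: "{x i (\<not> p), x (i + 1) q} \<in> f" using st[OF f] by (simp add: insert_commute)
    have b: "{x i p', x (i + 1) (\<not> q)} \<in> f" if "{x i p', x (i + 1) q} \<in> f" for p'
      using st[OF f(1), of "i + 1" q "x i p'"] that by (simp add: insert_commute)
    have "{x i p', x (i + 1) q'} \<in> f" for p' q'
      using f(2) a b[OF f(2)] b[OF a] by (cases p; cases p'; cases q; cases q') simp_all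
    then have "quad x i \<subseteq> f" unfolding quad_def by blast
    moreover have "is_cycle_face E f" using face_cycle sub_F[OF X] f(1) by blast
    ultimately show ?thesis using cycle_face_subset_eq[OF quad_cycle] by blast
  qed
  show ?thesis
  proof (intro equalityI subsetI)
    fix f assume f: "f \<in> X"
    then have fF: "f \<in> F" using sub_F[OF X] by blast
    then have "f \<noteq> {}" using face_cycle[OF fF] by (simp add: is_cycle_face_def)
    then obtain e where e: "e \<in> f" by blast
    then have "e \<in> E" using faceE[OF fF] by blast
    then obtain i p q where "e = {x i p, x (i + 1) q}" by (rule edgeE)
    then show "f \<in> range (quad x)" using q f e by blast
  next
    fix f assume "f \<in> range (quad x)"
    then obtain i where i: "f = quad x i" by blast
    obtain f' where "f' \<in> X" "{x i False, x (i + 1) False} \<in> f'" using face_obtain[OF X edge_Suc] by blast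
    then show "f \<in> X" using q i by blast
  qed
qed

lemma nbr_cases:
  assumes "{x i s, w} \<in> E"
  obtains t where "w = x (i + 1) t" | t where "w = x (i - 1) t"
proof -
  have "w \<in> V" using edge_ends[OF assms] by blast
  then obtain j t where w: "w = x j t" unfolding V_eq by blast
  have "int n dvd j - i - 1 \<or> int n dvd i - j - 1" using assms unfolding w edge_iff .
  then consider "int n dvd j - (i + 1)" | "int n dvd (i - 1) - j" by (auto simp: algebra_simps)
  then show thesis
    by cases (use that w x_cong in metis)+
qed

text \<open>The exits at the corners define a recursion of order two. Its solutions trace walks
  inside faces, hence the faces themselves; that each face is a cycle yields the behaviour after n
  steps.\<close>

lemma straight_family:
  assumes X: "X = A \<or> X = B" and str: "\<And>u v w. corner X u v w \<Longrightarrow> \<not> twin x u w"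
  obtains c \<kappa> g where "good_fam n c \<kappa> g" "X = pth x ` fam c g"
proof -
  \<comment> \<open>The only other vertex of fibre i - 1 is the twin of the entry, and turning to it
    is excluded.\<close>
  have up: "\<exists>q. corner X (x (i - 1) p) (x i s) (x (i + 1) q)" for i p s
  proof -
    have "{x (i - 1) p, x i s} \<in> E" unfolding edge_iff by simp
    then obtain w where w: "corner X (x (i - 1) p) (x i s) w" by (rule corner_exists[OF X])
    have "{x i s, w} \<in> E" "x (i - 1) p \<noteq> w" using corner_edges[OF X w] by blast+
    then show ?thesis
    proof (cases rule: nbr_cases)
      case (1 t)
      then show ?thesis using w by blast
    next
      case (2 t)
      then have "t = (\<not> p)" using \<open>x (i - 1) p \<noteq> w\<close> by (cases t; cases p) auto
      then show ?thesis using str[OF w] 2 twin_iff by blast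
    qed
  qed
  define b where "b i s = (SOME q. corner X (x (i - 1) False) (x i s) (x (i + 1) q))" for i s
  have b0: "corner X (x (i - 1) False) (x i s) (x (i + 1) (b i s))" for i s
    unfolding b_def by (rule someI_ex) (rule up)
  \<comment> \<open>Corners can be read backwards, so different entries have different
    exits.\<close>
  have b1: "corner X (x (i - 1) True) (x i s) (x (i + 1) (\<not> b i s))" for i s
  proof -
    obtain q where q: "corner X (x (i - 1) True) (x i s) (x (i + 1) q)" using up by blast
    have "q \<noteq> b i s"
    proof
      assume "q = b i s"
      then have "x (i - 1) True = x (i - 1) False"
        using corner_unique[OF X corner_sym[OF q]] corner_sym[OF b0[of i s]] by blast
      then show False by (simp add: x_eq_iff)
    qed
    then have "q = (\<not> b i s)" by blast
    then show ?thesis using q by simp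
  qed
  have cb: "corner X (x (i - 1) p) (x i s) w \<longleftrightarrow> w = x (i + 1) (p \<noteq> b i s)" for i p s w
  proof -
    have "corner X (x (i - 1) p) (x i s) (x (i + 1) (p \<noteq> b i s))"
      using b0[of i s] b1[of i s] by (cases p) simp_all
    then show ?thesis using corner_unique[OF X] by blast
  qed
  have bper: "b (i + int n) s = b i s" for i s
    unfolding b_def using x_cong[of "i + int n - 1" "i - 1"] x_cong[of "i + int n" i] x_cong[of "i + int n + 1" "i + 1"]
    by simp
  \<comment> \<open>\<open>P i\<close> says, without naming exits, that both vertices of fibre i
    have the same corners. Automorphisms respect corners and twins, so this property passes from one
    fibre to all; in coordinates it means that b i does not depend on s.\<close>
  define P where "P i \<longleftrightarrow> (\<forall>s u w. corner X u (x i s) w \<longrightarrow> corner X u (x i (\<not> s)) w)" for i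
  have Pb: "P i \<longleftrightarrow> b i True = b i False" for i
  proof
    assume "P i"
    then have "corner X (x (i - 1) False) (x i False) (x (i + 1) (b i True))"
      using b0[of i True] unfolding P_def by force
    then show "b i True = b i False" unfolding cb by (simp add: x_eq_iff)
  next
    assume e: "b i True = b i False"
    then have e': "b i s = b i (\<not> s)" for s by (cases s) auto
    have fw: "corner X (x (i - 1) p) (x i (\<not> s)) w" if "corner X (x (i - 1) p) (x i s) w" for p s w
      using that e'[of s] unfolding cb by simp
    show "P i" unfolding P_def
    proof (intro allI impI)
      fix s u w assume c: "corner X u (x i s) w"
      have "{x i s, u} \<in> E" using corner_edges(1)[OF X c] by (simp add: insert_commute)
      then show "corner X u (x i (\<not> s)) w"
      proof (cases rule: nbr_cases)
        case (2 t)
        then show ?thesis using fw c by simp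
      next
        case (1 t)
        have h: "corner X (x (i - 1) (t \<noteq> b i s)) (x i s) u" unfolding cb xor_cancel 1 ..
        have "w = x (i - 1) (t \<noteq> b i s)" by (rule corner_unique[OF X c corner_sym[OF h]])
        then show ?thesis using corner_sym[OF fw[OF h]] by (simp only:)
      qed
    qed
  qed
  have Pij: "P j" if "P i" for i j
    unfolding P_def
  proof (intro allI impI)
    fix s u w assume c: "corner X u (x j s) w"
    obtain \<tau> where t: "map_aut V E F \<tau>" "\<tau> (x j s) = x i s"
      using arc_trans[OF edge_Suc[of j s False] edge_Suc[of i s False]] by blast
    obtain \<tau>' where t': "map_aut V E F \<tau>'" "\<And>v. v \<in> V \<Longrightarrow> \<tau>' (\<tau> v) = v"
        "\<And>v. v \<in> V \<Longrightarrow> \<tau> (\<tau>' v) = v"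
      using map_aut_inverse[OF t(1) polytopal_faces(3)[OF pm]] by blast
    have tn: "\<tau> (x j (\<not> s)) = x i (\<not> s)" using tw[OF t(1), of j s] unfolding t(2) twin_iff .
    have "corner X (\<tau> u) (x i s) (\<tau> w)" using corner_aut[OF X t(1) c] t(2) by simp
    then have "corner X (\<tau> u) (\<tau> (x j (\<not> s))) (\<tau> w)" using that unfolding P_def tn by blast
    then have "corner X (\<tau>' (\<tau> u)) (\<tau>' (\<tau> (x j (\<not> s)))) (\<tau>' (\<tau> w))" by (rule corner_aut[OF X t'(1)])
    moreover have "u \<in> V" "w \<in> V" using edge_ends corner_edges[OF X c] by blast+
    ultimately show "corner X u (x j (\<not> s)) w" using t'(2) x_in_V by simp
  qed
  define c where "c = (b 0 True \<noteq> b 0 False)"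
  have bc: "b i s = (b i False \<noteq> (c \<and> s))" for i s
    using Pij[of 0 i] Pij[of i 0] Pb[of i] Pb[of 0] by (cases s) (auto simp: c_def)
  \<comment> \<open>The state is the pair of values at i and i + 1; the initial pair is left
    open.\<close>
  obtain T where T: "\<And>i. T (i + 1) = (snd (T i), fst (T i) \<noteq> b (i + 1) (snd (T i)))"
    by (rule int_recursion[of "\<lambda>i a. (snd a, fst a \<noteq> b (i + 1) (snd a))"
        "\<lambda>i a. (snd a \<noteq> b (i + 1) (fst a), fst a)"]) auto
  define g where "g i = fst (T i)" for i
  have g: "g (i + 1) = (g (i - 1) \<noteq> b i (g i))" for i
  proof -
    have "snd (T (i - 1)) = g i" using T[of "i - 1"] by (simp add: g_def)
    moreover have "snd (T i) = g (i + 1)" using T[of i] by (simp add: g_def)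
    moreover have "snd (T i) = (fst (T (i - 1)) \<noteq> b i (snd (T (i - 1))))" using T[of "i - 1"] by simp
    ultimately show ?thesis by (simp add: g_def)
  qed
  have fr: "t (i + 1) = (t (i - 1) \<noteq> b i (t i))" if t: "t \<in> fam c g" for t i
  proof -
    have e: "i - 1 + 2 = i + 1" "i - 1 + 1 = i" by simp_all
    have "(\<lambda>i. t i \<noteq> g i) \<in> lin c" using t by (simp add: fam_def)
    from linD[OF this, of "i - 1", unfolded e]
    have "(t (i + 1) \<noteq> g (i + 1)) = ((t (i - 1) \<noteq> g (i - 1)) \<noteq> (c \<and> (t i \<noteq> g i)))" .
    moreover have "g (i + 1) = (g (i - 1) \<noteq> (b i False \<noteq> (c \<and> g i)))" using g[of i] bc[of i "g i"] by simp
    moreover have "b i (t i) = (b i False \<noteq> (c \<and> t i))" by (rule bc)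
    ultimately show ?thesis by (cases c) auto
  qed
  let ?e = "\<lambda>t i. {x i (t i), x (i + 1) (t (i + 1))}"
  have tc: "corner X (x (i - 1) (t (i - 1))) (x i (t i)) (x (i + 1) (t (i + 1)))" if "t \<in> fam c g" for t i
    unfolding cb using fr[OF that, of i] by simp
  have sub: "pth x t \<subseteq> f" if t: "t \<in> fam c g" and f: "f \<in> X" "?e t i \<in> f" for t f i
  proof -
    have "?e t k \<in> f" for k
    proof (induction k rule: int_induct[of _ i])
      case base
      show ?case by (rule f(2))
    next
      case (step1 k)
      have "corner X (x k (t k)) (x (k + 1) (t (k + 1))) (x (k + 1 + 1) (t (k + 1 + 1)))"
        using tc[OF t, of "k + 1"] by simp
      then show ?case using corner_in_face[OF X f(1)] step1 by blast
    next
      case (step2 k)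
      have "corner X (x (k + 1) (t (k + 1))) (x k (t k)) (x (k - 1) (t (k - 1)))"
        by (rule corner_sym[OF tc[OF t]])
      moreover have "{x (k + 1) (t (k + 1)), x k (t k)} \<in> f" using step2 by (simp add: insert_commute)
      ultimately have "{x k (t k), x (k - 1) (t (k - 1))} \<in> f" using corner_in_face[OF X f(1)] by blast
      then show ?case by (simp add: insert_commute)
    qed
    then show ?thesis unfolding pth_def by blast
  qed
  have qu: "\<exists>\<kappa>. quasi n \<kappa> t" if t: "t \<in> fam c g" and f: "f \<in> F" "pth x t \<subseteq> f" for t f
  proof -
    have ef: "?e t k \<in> f" for k using f(2) unfolding pth_def by blast
    have ef': "{x (k + 1) (t (k + 1)), x k (t k)} \<in> f" for k using ef[of k] by (simp add: insert_commute)
    have ne: "x (k + 1) p \<noteq> x (k - 1) q" for k p q using small_not_dvd by (simp add: x_eq_iff)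
    have xn: "x (k + int n) = x k" for k using x_cong[of "k + int n" k] by (auto simp: fun_eq_iff)
    \<comment> \<open>If the walk returned after n steps to just one of two consecutive vertices,
      three edges of the face would meet at that vertex.\<close>
    have eqv: "t (k + int n) = t k \<longleftrightarrow> t (k + 1 + int n) = t (k + 1)" for k
    proof (rule ccontr)
      assume "\<not> ?thesis"
      then consider "t (k + int n) = t k" "t (k + 1 + int n) \<noteq> t (k + 1)"
        | "t (k + int n) \<noteq> t k" "t (k + 1 + int n) = t (k + 1)" by blast
      then show False
      proof cases
        case 1
        have "?e t (k + int n) = {x k (t k), x (k + 1) (t (k + 1 + int n))}"
          using xn[of k] xn[of "k + 1"] 1(1) by (simp add: algebra_simps)
        then have "{x k (t k), x (k + 1) (t (k + 1 + int n))} \<in> f" using ef[of "k + int n"] by simp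
        moreover have "{x k (t k), x (k + 1) (t (k + 1))} \<in> f" by (rule ef)
        moreover have "{x k (t k), x (k - 1) (t (k - 1))} \<in> f" using ef'[of "k - 1"] by simp
        moreover have "x (k + 1) (t (k + 1 + int n)) \<noteq> x (k + 1) (t (k + 1))" using 1(2) by (simp add: x_eq_iff)
        ultimately show False using no_three_edges[OF f(1)] ne by blast
      next
        case 2
        have "?e t (k + int n) = {x (k + 1) (t (k + 1)), x k (t (k + int n))}"
          using xn[of k] xn[of "k + 1"] 2(2) by (simp add: algebra_simps insert_commute)
        then have "{x (k + 1) (t (k + 1)), x k (t (k + int n))} \<in> f" using ef[of "k + int n"] by simp
        moreover have "{x (k + 1) (t (k + 1)), x k (t k)} \<in> f" by (rule ef')
        moreover have "{x (k + 1) (t (k + 1)), x (k + 1 + 1) (t (k + 1 + 1))} \<in> f" by (rule ef)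
        moreover have "x k (t (k + int n)) \<noteq> x k (t k)" using 2(1) by (simp add: x_eq_iff)
        moreover have "x (k + 1 + 1) p \<noteq> x k q" for p q using ne[of "k + 1" p q] by simp
        ultimately show False using no_three_edges[OF f(1)] by metis
      qed
    qed
    have "(t (k + int n) = t k) = (t (int n) = t 0)" for k
    proof (induction k rule: int_induct[of _ 0])
      case base
      show ?case by simp
    next
      case (step1 k)
      then show ?case using eqv[of k] by blast
    next
      case (step2 k)
      then show ?case using eqv[of "k - 1"] by simp
    qed
    then have "t (k + int n) = (t k \<noteq> (t (int n) \<noteq> t 0))" for k by blast
    then show ?thesis unfolding quasi_def by (intro exI[of _ "t (int n) \<noteq> t 0"] allI)
  qed
  have pX: "pth x t = f" if t: "t \<in> fam c g" and f: "f \<in> X" "?e t i \<in> f" for t f i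
  proof -
    have fF: "f \<in> F" using sub_F[OF X] f(1) by blast
    obtain \<kappa> where "quasi n \<kappa> t" using qu[OF t fF sub[OF t f]] by blast
    then show ?thesis using cycle_face_subset_eq[OF pth_cycle face_cycle[OF fF] sub[OF t f]] by blast
  qed
  have pm': "pth x t \<in> X" if t: "t \<in> fam c g" for t
  proof -
    obtain f where f: "f \<in> X" "?e t 0 \<in> f" by (rule face_obtain[OF X edge_Suc])
    then show ?thesis using pX[OF t f] by simp
  qed
  have q': "\<exists>\<kappa>. quasi n \<kappa> t" if "t \<in> fam c g" for t
    using qu[OF that _ subset_refl] pm'[OF that] sub_F[OF X] by blast
  obtain \<kappa> where \<kappa>: "quasi n \<kappa> g" using q'[OF g_in_fam] by blast
  have qall: "quasi n \<kappa> t" if t: "t \<in> fam c g" for t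
  proof -
    obtain \<kappa>' where k: "quasi n \<kappa>' t" using q'[OF t] by blast
    \<comment> \<open>Faces of one kind have equal length, and the length reveals
      \<open>\<kappa>\<close>.\<close>
    have "card (pth x t) = card (pth x g)" by (rule card_faces_eq[OF X pm'[OF t] pm'[OF g_in_fam]])
    then have "\<kappa>' = \<kappa>" unfolding card_pth(1)[OF k] card_pth(1)[OF \<kappa>] using n3 by (auto split: if_splits)
    then show ?thesis using k by simp
  qed
  have XX: "X = pth x ` fam c g"
  proof (intro equalityI subsetI)
    fix f assume f: "f \<in> X"
    then have fF: "f \<in> F" using sub_F[OF X] by blast
    then have "f \<noteq> {}" using face_cycle[OF fF] by (simp add: is_cycle_face_def)
    then obtain e where e: "e \<in> f" by blast
    then have "e \<in> E" using faceE[OF fF] by blast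
    then obtain i p q where ee: "e = {x i p, x (i + 1) q}" by (rule edgeE)
    obtain t where t: "t \<in> fam c g" "t i = p" "t (i + 1) = q" using fam_ex[of c g i p q] by blast
    have "pth x t = f" using pX[OF t(1) f, of i] e ee t(2,3) by simp
    then show "f \<in> pth x ` fam c g" using t(1) by blast
  next
    fix f assume "f \<in> pth x ` fam c g"
    then show "f \<in> X" using pm' by blast
  qed
  \<comment> \<open>Every d in \<open>lin c\<close> is a difference of two members of the family,
    whose flips cancel, so d has the same value at 0 and n.\<close>
  have per: "if c then 3 dvd n else even n"
  proof (rule lin_periodic_conv)
    fix d assume d: "d \<in> lin c"
    have "(\<lambda>i. (d i \<noteq> g i) \<noteq> g i) \<in> lin c" unfolding xor_cancel by (rule d)
    then have "(\<lambda>i. d i \<noteq> g i) \<in> fam c g" by (simp only: fam_def mem_Collect_eq)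
    from qall[OF this] have "(d (0 + int n) \<noteq> g (0 + int n)) = ((d 0 \<noteq> g 0) \<noteq> \<kappa>)" unfolding quasi_def by blast
    moreover have "g (0 + int n) = (g 0 \<noteq> \<kappa>)" using \<kappa> unfolding quasi_def by blast
    ultimately have "d (0 + int n) = d 0" by blast
    then show "d (int n) = d 0" by simp
  qed
  \<comment> \<open>Between 0 and n the two neighbours flip, and so does b because its argument
    flips and c is true. Three flips violate the recursion.\<close>
  have "\<not> (c \<and> \<kappa>)"
  proof
    assume ck: "c \<and> \<kappa>"
    have gn: "g (i + int n) = (\<not> g i)" for i using \<kappa> ck unfolding quasi_def by simp
    have e: "0 + int n - 1 = - 1 + int n" "0 + int n + 1 = 1 + int n" by simp_all
    have "g (1 + int n) = (g (- 1 + int n) \<noteq> b 0 (g (0 + int n)))"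
      using g[of "0 + int n"] bper[of 0] by (simp only: e)
    then have "(\<not> g 1) = ((\<not> g (- 1)) \<noteq> b 0 (\<not> g 0))" unfolding gn .
    moreover have "g 1 = (g (- 1) \<noteq> b 0 (g 0))" using g[of 0] by simp
    moreover have "b 0 (\<not> g 0) = (\<not> b 0 (g 0))" using bc[of 0 "g 0"] bc[of 0 "\<not> g 0"] ck by simp
    ultimately show False by blast
  qed
  then have "good_fam n c \<kappa> g" using per \<kappa> by (simp add: good_fam_def split: if_splits)
  then show thesis using XX by (rule that)
qed

end

section \<open>Normal forms\<close>

text \<open>The parity of the number of completed turns: a standard sequence that flips after n
  steps, serving as g when \<open>\<kappa>\<close> is true.\<close>

definition jump :: "nat \<Rightarrow> int \<Rightarrow> bool" where "jump n i = odd (i div int n)"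

definition map_quad :: "nat \<Rightarrow> bool \<Rightarrow> bool \<Rightarrow> (int \<Rightarrow> bool \<Rightarrow> 'v) \<Rightarrow> 'v set set set" where
  "map_quad n c \<kappa> y = range (quad y) \<union> pth y ` fam c (\<lambda>i. \<kappa> \<and> jump n i)"

definition map_straight :: "(int \<Rightarrow> bool \<Rightarrow> 'v) \<Rightarrow> 'v set set set" where
  "map_straight y = pth y ` fam False (\<lambda>_. False) \<union> pth y ` fam False q4"

lemma quasi_jump: "n > 0 \<Longrightarrow> quasi n \<kappa> (\<lambda>i. \<kappa> \<and> jump n i)"
  by (auto simp: quasi_def jump_def div_add_self2)

lemma quasi_xor_periodic:
  assumes "quasi n \<kappa> g" "quasi n \<kappa> h"
  shows "(g (j + int n) \<noteq> h (j + int n)) = (g j \<noteq> h j)"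
  using assms unfolding quasi_def by blast

context twin_wreath
begin

text \<open>Two sequences with the same \<open>\<kappa>\<close> differ by an n-periodic one, which
  is an admissible relabelling and keeps the 4-cycles.\<close>

lemma normal_form_quad:
  assumes A: "A = range (quad x)" and B: "B = pth x ` fam c g" and g: "good_fam n c \<kappa> g"
  obtains y where "wreath n V E y" "A = range (quad y)" "B = pth y ` fam c (\<lambda>i. \<kappa> \<and> jump n i)"
proof -
  define h where "h i \<longleftrightarrow> \<kappa> \<and> jump n i" for i
  define r where "r i = (g i \<noteq> h i)" for i
  have qh: "quasi n \<kappa> h" unfolding h_def using quasi_jump n3 by simp
  have rp: "r (j + int n) = r j" for j
    unfolding r_def by (rule quasi_xor_periodic[OF _ qh]) (use g in \<open>simp add: good_fam_def\<close>)
  let ?y = "\<lambda>i s. x i (s \<noteq> r i)"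
  have "(\<lambda>i. g i \<noteq> r i) = h" unfolding r_def by auto
  then have "pth ?y ` fam c h = B" using fam_twist[of x r c g] B by simp
  then show thesis using that[OF twist[of r, OF rp]] quad_twist[of r] A unfolding h_def by simp
qed

text \<open>Adding r twice changes nothing, so the relabelling by r interchanges the families of g
  and g + r.\<close>

lemma no_twist:
  assumes r: "\<And>j. r (j + int n) = r j" and A: "A = pth x ` fam c g" and B: "B = pth x ` fam c (\<lambda>i. g i \<noteq> r i)"
  shows False
proof (rule no_swap[OF twist[of r, OF r]])
  let ?y = "\<lambda>i s. x i (s \<noteq> r i)"
  have 1: "pth ?y ` fam c g = B"
    using fam_twist[of x r c "\<lambda>i. g i \<noteq> r i"] unfolding B xor_cancel .
  have 2: "pth ?y ` fam c (\<lambda>i. g i \<noteq> r i) = A"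
    using fam_twist[of x r c g] unfolding A .
  fix \<sigma> assume s: "\<And>i s. \<sigma> (x i s) = ?y i s"
  show "face_img \<sigma> ` A = B" unfolding 1[symmetric] A image_image face_img_pth s ..
  show "face_img \<sigma> ` B = A" unfolding 2[symmetric] B image_image face_img_pth s ..
qed

text \<open>Two straight families with opposite exits differ by one fixed inhomogeneous solution;
  whenever that solution is n-periodic, it provides a forbidden swap.\<close>

lemma normal_form_straight:
  assumes strA: "\<And>u v w. corner A u v w \<Longrightarrow> \<not> twin x u w" and strB: "\<And>u v w. corner B u v w \<Longrightarrow> \<not> twin x u w"
  obtains y where "wreath n V E y" "F = map_straight y" "n mod 4 = 2"
proof -
  obtain c \<kappa> g where g: "good_fam n c \<kappa> g" "A = pth x ` fam c g"
    using straight_family[of A] strA by blast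
  obtain c' \<kappa>' g' where g': "good_fam n c' \<kappa>' g'" "B = pth x ` fam c' g'"
    using straight_family[of B] strB by blast
  have corn: "corner X (x (i - 1) (t (i - 1))) (x i (t i)) (x (i + 1) (t (i + 1)))"
    if X: "X = pth x ` fam d h" "t \<in> fam d h" for X d h t i
  proof -
    have "{x (i - 1) (t (i - 1)), x (i - 1 + 1) (t (i - 1 + 1))} \<in> pth x t" "{x i (t i), x (i + 1) (t (i + 1))} \<in> pth x t"
      unfolding pth_def by blast+
    moreover have "x (i - 1) (t (i - 1)) \<noteq> x (i + 1) (t (i + 1))" using small_not_dvd by (simp add: x_eq_iff)
    ultimately show ?thesis unfolding corner_def using X by auto
  qed
  have rec: "t (i + 2) = ((t i \<noteq> (d \<and> t (i + 1))) \<noteq> (h (i + 2) \<noteq> (h i \<noteq> (d \<and> h (i + 1)))))"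
    if "t \<in> fam d h" for t d h i
  proof -
    have "(\<lambda>i. t i \<noteq> h i) \<in> lin d" using that by (simp add: fam_def)
    from linD[OF this, of i] show ?thesis by (cases d) auto
  qed
  \<comment> \<open>The inhomogeneous term of the recursion, shared by all members of the
    family.\<close>
  define \<beta> where "\<beta> i = (g (i + 2) \<noteq> (g i \<noteq> (c \<and> g (i + 1))))" for i
  define \<beta>' where "\<beta>' i = (g' (i + 2) \<noteq> (g' i \<noteq> (c' \<and> g' (i + 1))))" for i
  have diff: "((p \<noteq> (c \<and> s)) \<noteq> \<beta> i) \<noteq> ((p \<noteq> (c' \<and> s)) \<noteq> \<beta>' i)" for p s i
  proof -
    have e: "i + 1 - 1 = i" "i + 1 + 1 = i + 2" by simp_all
    obtain t where t: "t \<in> fam c g" "t i = p" "t (i + 1) = s" using fam_ex[of c g i p s] by blast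
    obtain t' where t': "t' \<in> fam c' g'" "t' i = p" "t' (i + 1) = s" using fam_ex[of c' g' i p s] by blast
    have "x (i + 2) (t (i + 2)) \<noteq> x (i + 2) (t' (i + 2))"
      using corner_A_B_distinct[OF corn[OF g(2) t(1), of "i + 1", unfolded e t(2,3)] corn[OF g'(2) t'(1), of "i + 1", unfolded e t'(2,3)]] .
    then have "t (i + 2) \<noteq> t' (i + 2)" by (simp only: x_eq_iff) simp
    moreover have 1: "t (i + 2) = ((p \<noteq> (c \<and> s)) \<noteq> \<beta> i)" using rec[OF t(1), of i] unfolding t(2,3) \<beta>_def .
    moreover have 2: "t' (i + 2) = ((p \<noteq> (c' \<and> s)) \<noteq> \<beta>' i)" using rec[OF t'(1), of i] unfolding t'(2,3) \<beta>'_def .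
    ultimately show ?thesis by (simp only: simp_thms)
  qed
  \<comment> \<open>The exits disagree for s = False and for s = True, so the coefficients of s
    agree.\<close>
  have cc: "c' = c" using diff[of False True 0] diff[of False False 0] by blast
  have bb: "\<beta>' i = (\<not> \<beta> i)" for i using diff[of False False i] by blast
  show thesis
  proof (cases c)
    case True
    \<comment> \<open>The constant 1 solves t(i+2) = t(i) + t(i+1) + 1 and is periodic for every n,
      so this case never occurs.\<close>
    have h: "(\<lambda>i. g' i \<noteq> (g i \<noteq> True)) \<in> lin True"
      unfolding lin_def mem_Collect_eq
    proof
      fix i show "(g' (i + 2) \<noteq> (g (i + 2) \<noteq> True)) = ((g' i \<noteq> (g i \<noteq> True)) \<noteq> (True \<and> (g' (i + 1) \<noteq> (g (i + 1) \<noteq> True))))"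
        using bb[of i] unfolding \<beta>_def \<beta>'_def cc using True by blast
    qed
    have B: "B = pth x ` fam c (\<lambda>i. g i \<noteq> True)" unfolding g'(2) cc using fam_eq_fam[OF h] True by simp
    show thesis using no_twist[of "\<lambda>_. True", OF _ g(2) B] by simp
  next
    case False
    have en: "even n" using g(1) False by (simp add: good_fam_def)
    \<comment> \<open>Now the difference must solve t(i+2) = t(i) + 1. The solution
      \<open>q4\<close> is n-periodic when 4 divides n, and then swaps A and B.\<close>
    have h: "(\<lambda>i. g' i \<noteq> (g i \<noteq> q4 i)) \<in> lin False"
      unfolding lin_def mem_Collect_eq
    proof
      fix i show "(g' (i + 2) \<noteq> (g (i + 2) \<noteq> q4 (i + 2))) = ((g' i \<noteq> (g i \<noteq> q4 i)) \<noteq> (False \<and> (g' (i + 1) \<noteq> (g (i + 1) \<noteq> q4 (i + 1)))))"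
        using bb[of i] q4_2(1)[of i] unfolding \<beta>_def \<beta>'_def cc using False by blast
    qed
    have B: "B = pth x ` fam c (\<lambda>i. g i \<noteq> q4 i)" unfolding g'(2) cc using fam_eq_fam[OF h] False by simp
    have qq: "quasi n (n mod 4 = 2) q4" by (rule quasi_q4[OF en])
    have qg: "quasi n \<kappa> g" using g(1) by (simp add: good_fam_def)
    have n42: "n mod 4 = 2"
    proof (rule ccontr)
      assume "n mod 4 \<noteq> 2"
      then have qp: "q4 (j + int n) = q4 j" for j using qq by (simp add: quasi_def)
      show False by (rule no_twist[of q4, OF qp g(2) B])
    qed
    then have qT: "quasi n True q4" using qq by simp
    show thesis
    \<comment> \<open>Exactly one of A and B has faces of length n; that family is moved to g = 0
      and the other to \<open>q4\<close>.\<close>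
    proof (cases \<kappa>)
      case True
      define r where "r i = (g i \<noteq> q4 i)" for i
      have rp: "r (j + int n) = r j" for j
        unfolding r_def by (rule quasi_xor_periodic[OF _ qT]) (use qg True in simp)
      let ?y = "\<lambda>i s. x i (s \<noteq> r i)"
      have f1: "(\<lambda>i. g i \<noteq> r i) = q4" and f2: "(\<lambda>i. (g i \<noteq> q4 i) \<noteq> r i) = (\<lambda>_. False)"
        unfolding r_def by auto
      have "pth ?y ` fam c q4 = A" using fam_twist[of x r c g] unfolding f1 g(2) .
      moreover have "pth ?y ` fam c (\<lambda>_. False) = B" using fam_twist[of x r c "\<lambda>i. g i \<noteq> q4 i"] unfolding f2 B .
      ultimately have "F = map_straight ?y" using False by (simp add: map_straight_def F_eq Un_commute)
      then show thesis using that[OF twist[of r, OF rp]] n42 by blast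
    next
      case kF: False
      have rp: "g (j + int n) = g j" for j using qg kF by (simp add: quasi_def)
      let ?y = "\<lambda>i s. x i (s \<noteq> g i)"
      have f1: "(\<lambda>i. g i \<noteq> g i) = (\<lambda>_. False)" and f2: "(\<lambda>i. (g i \<noteq> q4 i) \<noteq> g i) = q4" by auto
      have "pth ?y ` fam c (\<lambda>_. False) = A" using fam_twist[of x g c g] unfolding f1 g(2) .
      moreover have "pth ?y ` fam c q4 = B" using fam_twist[of x g c "\<lambda>i. g i \<noteq> q4 i"] unfolding f2 B .
      ultimately have "F = map_straight ?y" using False by (simp add: map_straight_def F_eq)
      then show thesis using that[OF twist[of g, OF rp]] n42 by blast
    qed
  qed
qed

text \<open>At a common arc both kinds would turn to the same twin, so their corners would
  coincide.\<close>

lemma not_both_vertical: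
  assumes "corner A u v w" "twin x u w" "corner B u' v' w'" "twin x u' w'"
  shows False
proof -
  have "{u, v} \<in> E" using corner_edges(1)[of A] assms(1) by blast
  then obtain w2 where w2: "corner B u v w2" using corner_exists[of B] by blast
  have "twin x u w2" using vertical_all[of B] assms(3,4) w2 by blast
  moreover obtain i s where "u = x i s" "w = x i (\<not> s)" using assms(2) unfolding twin_def by blast
  ultimately have "w2 = w" using twin_iff by simp
  then show False using corner_A_B_distinct[OF assms(1) w2] by simp
qed

end

section \<open>The complete bipartite case n = 4\<close>

lemma (in wreath) edge_parity:
  assumes "n = 4"
  shows "{x i s, x j t} \<in> E \<longleftrightarrow> odd (i - j)"
  unfolding edge_iff assms by simp presburger

text \<open>For n = 4 the graph is complete bipartite, so any labelling that respects the bipartition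
  is a coordinate system.\<close>
lemma (in wreath) wreath4I:
  assumes n4: "n = 4" and z: "\<And>i s j t. z i s = z j t \<longleftrightarrow> 4 dvd i - j \<and> s = t"
    and par: "\<And>i s. \<exists>j t. z i s = x j t \<and> even (i - j)"
  shows "wreath n V E z"
proof
  show "3 \<le> n" by (rule n3)
  show zn: "(z i s = z j t) = (int n dvd i - j \<and> s = t)" for i s j t using z n4 by simp
  have zV: "{z i s |i s. True} \<subseteq> V"
  proof
    fix v assume "v \<in> {z i s |i s. True}"
    then obtain i s where "v = z i s" by blast
    then show "v \<in> V" using par[of i s] x_in_V by auto
  qed
  have "card {z i s |i s. True} = 2 * n" by (rule card_coords(2)) (use n3 zn in simp_all)
  then show V: "V = {z i s |i s. True}" using card_subset_eq[OF finite_V zV] card_V by simp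
  have zE: "{z i s, z j t} \<in> E \<longleftrightarrow> odd (i - j)" for i s j t
  proof -
    obtain a p b q where ab: "z i s = x a p" "even (i - a)" "z j t = x b q" "even (j - b)" using par by metis
    show ?thesis unfolding ab(1,3) edge_parity[OF n4] using ab(2,4) by presburger
  qed
  show "E = {{z i s, z (i + 1) t} |i s t. True}"
  proof (intro equalityI subsetI)
    fix e assume e: "e \<in> E"
    then obtain u w where uw: "e = {u, w}" "u \<in> V" "w \<in> V" using simple_graph_edgeE[OF simple] by metis
    obtain i s j t where ij: "u = z i s" "w = z j t" using uw(2,3) unfolding V by blast
    have "odd (i - j)" using e unfolding uw(1) ij zE .
    then have "(4::int) dvd j - (i + 1) \<or> (4::int) dvd i - (j + 1)" by presburger
    then consider "(4::int) dvd j - (i + 1)" | "(4::int) dvd i - (j + 1)" by blast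
    then show "e \<in> {{z i s, z (i + 1) t} |i s t. True}"
    proof cases
      case 1
      then have "w = z (i + 1) t" unfolding ij z by simp
      then show ?thesis using uw ij by blast
    next
      case 2
      then have "u = z (j + 1) s" unfolding ij z by simp
      then have "e = {z j t, z (j + 1) s}" using uw ij by (simp add: insert_commute)
      then show ?thesis by blast
    qed
  next
    fix e assume "e \<in> {{z i s, z (i + 1) t} |i s t. True}"
    then show "e \<in> E" using zE by auto
  qed
qed

text \<open>For n = 4, exchanging fibre index and vertex number within each part of the bipartition turns
  the 4-cycles between consecutive fibres into the paths of the 2-periodic sequences and vice versa.\<close>
definition transp :: "(int \<Rightarrow> bool \<Rightarrow> 'v) \<Rightarrow> int \<Rightarrow> bool \<Rightarrow> 'v" where
  "transp x i s = x (i mod 2 + (if s then 2 else 0)) (odd (i div 2))"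

context wreath
begin

lemma transp_wreath:
  assumes n4: "n = 4"
  shows "wreath n V E (transp x)"
proof (rule wreath4I[OF n4])
  show "\<exists>j t. transp x i s = x j t \<and> even (i - j)" for i s
    unfolding transp_def by (intro exI conjI, rule refl) auto
  show "(transp x i s = transp x j t) = (4 dvd i - j \<and> s = t)" for i s j t
    unfolding transp_def x_eq_iff n4 by (cases s; cases t; simp; presburger)
qed

lemma transp_transp:
  assumes n4: "n = 4"
  shows "transp (transp x) = x"
proof (intro ext)
  fix i :: int and s
  have "(i mod 2 + (if s then 2 else 0)) mod 2 = i mod 2"
    "odd ((i mod 2 + (if s then 2 else 0)) div 2) = s" by auto
  moreover have "int n dvd i mod 2 + (if odd (i div 2) then 2 else 0) - i" unfolding n4 by simp presburger
  ultimately show "transp (transp x) i s = x i s" unfolding transp_def by (simp add: x_eq_iff)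
qed

lemma quad_transp:
  assumes n4: "n = 4"
  shows "range (quad (transp x)) = pth x ` fam False (\<lambda>_. False)"
proof -
  interpret z: wreath n V E "transp x" by (rule transp_wreath[OF n4])
  have gf: "good_fam n False False (\<lambda>_. False)" using n4 by (simp add: good_fam_def quasi_def)
  have sub: "quad (transp x) i \<in> pth x ` fam False (\<lambda>_. False)" for i
  proof -
    \<comment> \<open>Fibre i of \<open>transp x\<close> consists of the vertices numbered
      \<open>odd (i div 2)\<close> in the two fibres of the parity of i. The 2-periodic d selects
      this number on one parity and the corresponding one for i + 1 on the other.\<close>
    obtain d where d: "d \<in> fam False (\<lambda>_. False)" "d i = odd (i div 2)" "d (i + 1) = odd ((i + 1) div 2)"
      using fam_ex[of False "\<lambda>_. False" i "odd (i div 2)" "odd ((i + 1) div 2)"] by blast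
    have "d \<in> lin False" using d(1) by (simp add: fam_def)
    then have d2: "d (k + 2) = d k" for k using linD by blast
    have d2m: "d (k - 2) = d k" for k using d2[of "k - 2"] by simp
    have dm: "d (k + 2 * m) = d k" for k m
    proof (induction m rule: int_induct[of _ 0])
      case (step1 m)
      then show ?case using d2[of "k + 2 * m"] by (simp add: algebra_simps)
    next
      case (step2 m)
      then show ?case using d2m[of "k + 2 * m"] by (simp add: algebra_simps)
    qed simp
    have dpar: "d k = d l" if "even (k - l)" for k l
    proof -
      obtain m where "k - l = 2 * m" using \<open>even (k - l)\<close> by blast
      then have "k = l + 2 * m" by simp
      then show ?thesis using dm by simp
    qed
    have "{transp x i s, transp x (i + 1) t} \<in> pth x d" for s t
    proof -
      define a b where "a = i mod 2 + (if s then 2 else 0)" and "b = (i + 1) mod 2 + (if t then 2 else (0::int))"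
      have da: "d a = odd (i div 2)" "d b = odd ((i + 1) div 2)"
        using dpar[of a i] dpar[of b "i + 1"] d(2,3) by (auto simp: a_def b_def)
      have tr: "transp x i s = x a (d a)" "transp x (i + 1) t = x b (d b)"
        unfolding transp_def a_def[symmetric] b_def[symmetric] da by blast+
      have "odd (a - b)" unfolding a_def b_def by auto
      then have "(4::int) dvd b - (a + 1) \<or> (4::int) dvd a - (b + 1)" by presburger
      then consider "(4::int) dvd b - (a + 1)" | "(4::int) dvd a - (b + 1)" by blast
      then show ?thesis
      proof cases
        case 1
        then have eq: "x b (d b) = x (a + 1) (d (a + 1))" using dpar[of b "a + 1"] \<open>odd (a - b)\<close> n4 by (simp add: x_eq_iff)
        show ?thesis unfolding tr eq pth_def by (rule rangeI)
      next
        case 2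
        then have eq: "x a (d a) = x (b + 1) (d (b + 1))" using dpar[of a "b + 1"] \<open>odd (a - b)\<close> n4 by (simp add: x_eq_iff)
        have sw: "{x (b + 1) (d (b + 1)), x b (d b)} = {x b (d b), x (b + 1) (d (b + 1))}" by (rule insert_commute)
        show ?thesis unfolding tr eq sw pth_def by (rule rangeI)
      qed
    qed
    then have "quad (transp x) i \<subseteq> pth x d" unfolding quad_def by blast
    then have "quad (transp x) i = pth x d"
      using cycle_face_subset_eq[OF z.quad_cycle pth_cycle[OF quasi_fam[OF gf d(1)]]] by blast
    then show ?thesis using d(1) by blast
  qed
  show ?thesis
  proof (intro equalityI subsetI)
    fix f assume "f \<in> range (quad (transp x))"
    then show "f \<in> pth x ` fam False (\<lambda>_. False)" using sub by blast
  next
    fix f assume f: "f \<in> pth x ` fam False (\<lambda>_. False)"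
    then obtain t where "f = pth x t" by blast
    then obtain e where e: "e \<in> f" "e \<in> E" using pth_sub unfolding pth_def by blast
    obtain i where "e \<in> quad (transp x) i" using ex1_implies_ex[OF z.quad_unique_face[OF e(2)]] by auto
    then have "f = quad (transp x) i"
      using fam_unique_face[OF gf e(2)] sub[of i] f e(1) by (elim ex1E) auto
    then show "f \<in> range (quad (transp x))" by blast
  qed
qed

end

text \<open>Here all faces are 4-cycles, and the involution \<open>transp x\<close> exchanges the
  two kinds.\<close>

lemma (in split_wreath) not_regular4:
  assumes n4: "n = 4" and A: "A = range (quad x)" and B: "B = pth x ` fam False (\<lambda>_. False)"
  shows False
proof (rule no_swap[OF transp_wreath[OF n4]])
  interpret z: wreath n V E "transp x" by (rule transp_wreath[OF n4])
  fix \<sigma> assume s: "\<And>i s. \<sigma> (x i s) = transp x i s"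
  have "face_img \<sigma> ` A = range (quad (transp x))" unfolding A by (simp add: image_image face_img_quad s)
  then show "face_img \<sigma> ` A = B" unfolding quad_transp[OF n4] B .
  have "face_img \<sigma> ` B = pth (transp x) ` fam False (\<lambda>_. False)" unfolding B by (simp add: image_image face_img_pth s)
  also have "\<dots> = range (quad x)" using z.quad_transp[OF n4] unfolding transp_transp[OF n4] by simp
  finally show "face_img \<sigma> ` B = A" using A by simp
qed

context twin_wreath
begin

lemma normal_form_vertical:
  assumes v: "corner A u v w" "twin x u w"
  obtains y c \<kappa> where "wreath n V E y" "F = map_quad n c \<kappa> y" "if c then 3 dvd n \<and> \<not> \<kappa> else even n" "n \<noteq> 4 \<or> \<kappa>"
proof -
  have A: "A = range (quad x)" using vertical_quads[of A] vertical_all[OF _ v] by blast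
  have strB: "\<not> twin x u' w'" if "corner B u' v' w'" for u' v' w' using not_both_vertical[OF v that] by blast
  obtain c \<kappa> g where g: "good_fam n c \<kappa> g" "B = pth x ` fam c g" using straight_family[of B] strB by blast
  obtain y where y: "wreath n V E y" "A = range (quad y)" "B = pth y ` fam c (\<lambda>i. \<kappa> \<and> jump n i)"
    by (rule normal_form_quad[OF A g(2,1)])
  have "n \<noteq> 4 \<or> \<kappa>"
  proof (rule ccontr)
    assume h: "\<not> (n \<noteq> 4 \<or> \<kappa>)"
    then have "\<not> c" using g(1) by (auto simp: good_fam_def)
    interpret y: wreath n V E y by (rule y(1))
    interpret ys: split_wreath n V E y F A B by unfold_locales (rule pm, rule sp)
    show False using ys.not_regular4[OF _ y(2)] y(3) h \<open>\<not> c\<close> by simp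
  qed
  then show thesis using that[of y c \<kappa>] y g(1) F_eq by (simp add: map_quad_def good_fam_def split: if_splits)
qed

theorem normal_form:
  obtains y c \<kappa> where "wreath n V E y" "F = map_quad n c \<kappa> y" "if c then 3 dvd n \<and> \<not> \<kappa> else even n" "n \<noteq> 4 \<or> \<kappa>"
  | y where "wreath n V E y" "F = map_straight y" "n mod 4 = 2"
proof -
  interpret s: twin_wreath n V E x F B A by (rule twin_wreath_sym)
  consider u v w where "corner A u v w" "twin x u w" | u v w where "corner B u v w" "twin x u w"
    | "\<And>u v w. corner A u v w \<Longrightarrow> \<not> twin x u w" "\<And>u v w. corner B u v w \<Longrightarrow> \<not> twin x u w" by blast
  then show thesis
  proof cases
    case 1
    then show ?thesis using normal_form_vertical that(1) by blast
  next
    case 2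
    then show ?thesis using s.normal_form_vertical that(1) by blast
  next
    case 3
    then show ?thesis using normal_form_straight that(2) by blast
  qed
qed

end

section \<open>Invariant fibres\<close>

context wreath
begin

text \<open>Fibres are read off from the graph: vertices in different fibres i and j with the same
  neighbours would need j to be congruent to both i + 2 and i - 2, so n would divide 4.\<close>

lemma twin_char:
  assumes n4: "n \<noteq> 4" and u: "u \<in> V" "w \<in> V"
  shows "twin x u w \<longleftrightarrow> u \<noteq> w \<and> (\<forall>z. {u, z} \<in> E \<longrightarrow> {w, z} \<in> E)"
proof
  assume "twin x u w"
  then obtain i s where i: "u = x i s" "w = x i (\<not> s)" unfolding twin_def by blast
  show "u \<noteq> w \<and> (\<forall>z. {u, z} \<in> E \<longrightarrow> {w, z} \<in> E)"
  proof (intro conjI allI impI)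
    show "u \<noteq> w" unfolding i by (simp add: x_eq_iff)
    fix z assume e: "{u, z} \<in> E"
    then have "z \<in> V" using E_Pow by blast
    then obtain j t where "z = x j t" unfolding V_eq by blast
    then show "{w, z} \<in> E" using e unfolding i by (simp add: edge_iff)
  qed
next
  assume r: "u \<noteq> w \<and> (\<forall>z. {u, z} \<in> E \<longrightarrow> {w, z} \<in> E)"
  obtain i s j t where ij: "u = x i s" "w = x j t" using u unfolding V_eq by blast
  have "{u, x (i + 1) False} \<in> E" "{u, x (i - 1) False} \<in> E" unfolding ij edge_iff by simp_all
  then have "{w, x (i + 1) False} \<in> E" "{w, x (i - 1) False} \<in> E" using r by blast+
  then have a: "int n dvd i - j \<or> int n dvd j - (i + 2)" "int n dvd (i - 2) - j \<or> int n dvd j - i"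
    unfolding ij edge_iff by (auto simp: algebra_simps)
  have "int n dvd i - j"
  proof (rule ccontr)
    assume no: "\<not> int n dvd i - j"
    then have "\<not> int n dvd j - i" by (simp add: dvd_diff_commute)
    then have "int n dvd j - (i + 2)" "int n dvd (i - 2) - j" using a no by blast+
    then have "int n dvd (j - (i + 2)) + ((i - 2) - j)" by (rule dvd_add)
    then have "int n dvd - 4" by simp
    then have "int n dvd int 4" by simp
    then have "n dvd 4" unfolding int_dvd_int_iff .
    then have "n \<le> 4" by (rule dvd_imp_le) simp
    then have "n = 3" using n3 n4 by linarith
    then show False using \<open>n dvd 4\<close> by simp
  qed
  then have "x j t = x i t" by (simp add: x_eq_iff dvd_diff_commute)
  moreover have "t = (\<not> s)" using r calculation ij by (cases s; cases t) auto
  ultimately show "twin x u w" unfolding twin_def ij by blast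
qed

lemma twin_aut:
  assumes n4: "n \<noteq> 4" and s: "graph_aut V E \<sigma>"
  shows "twin x (\<sigma> (x i s)) (\<sigma> (x i (\<not> s)))"
proof -
  interpret y: wreath n V E "\<lambda>i s. \<sigma> (x i s)" by (rule coords_of_aut[OF s])
  have "twin (\<lambda>i s. \<sigma> (x i s)) (\<sigma> (x i s)) (\<sigma> (x i (\<not> s)))" unfolding twin_def by blast
  then show ?thesis using twin_char[OF n4 y.x_in_V y.x_in_V] y.twin_char[OF n4 y.x_in_V y.x_in_V] by blast
qed

section \<open>Invariant pairs of vertices for n = 4\<close>

lemma same_part4:
  assumes n4: "n = 4" and "{v, u} \<in> E" "{v', u} \<in> E" "{v, z} \<in> E"
  shows "{v', z} \<in> E"
proof -
  have "v \<in> V" "v' \<in> V" "u \<in> V" "z \<in> V" using assms E_Pow by blast+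
  then obtain i s j t k p l q where "v = x i s" "v' = x j t" "u = x k p" "z = x l q" unfolding V_eq by blast
  then show ?thesis using assms(2-4) edge_parity[OF n4] by auto
qed

lemma neighbours4:
  assumes n4: "n = 4" and v: "v \<in> V"
  shows "card {u. {v, u} \<in> E} = 4" "finite {u. {v, u} \<in> E}"
proof -
  obtain i s where vi: "v = x i s" using v unfolding V_eq by blast
  have eq: "{u. {v, u} \<in> E} = {x (i + 1) False, x (i + 1) True, x (i - 1) False, x (i - 1) True}"
  proof (intro equalityI subsetI)
    fix u assume "u \<in> {u. {v, u} \<in> E}"
    then have e: "{x i s, u} \<in> E" unfolding vi by simp
    then have "x i s \<in> {x i s, u}" by simp
    from e this show "u \<in> {x (i + 1) False, x (i + 1) True, x (i - 1) False, x (i - 1) True}"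
    proof (cases rule: star_cases)
      case (1 t)
      then show ?thesis by (cases t) (auto simp: doubleton_eq_iff)
    next
      case (2 t)
      then show ?thesis by (cases t) (auto simp: doubleton_eq_iff)
    qed
  next
    fix u assume "u \<in> {x (i + 1) False, x (i + 1) True, x (i - 1) False, x (i - 1) True}"
    then show "u \<in> {u. {v, u} \<in> E}" unfolding vi by (auto simp: edge_iff)
  qed
  show "finite {u. {v, u} \<in> E}" unfolding eq by simp
  have "\<not> (4::int) dvd 2" by presburger
  then show "card {u. {v, u} \<in> E} = 4" unfolding eq by (simp add: card_insert_if x_eq_iff n4)
qed

end

lemma five_distinct:
  assumes "finite S" "card S = 4" "{a, b, c, d, e} \<subseteq> S"
    "a \<noteq> b" "a \<noteq> c" "a \<noteq> d" "a \<noteq> e" "b \<noteq> c" "b \<noteq> d" "b \<noteq> e" "c \<noteq> d" "c \<noteq> e" "d \<noteq> e"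
  shows False
proof -
  have "card {a, b, c, d, e} = 5" using assms(4-) by simp
  then show False using card_mono[OF assms(1,3)] assms(2) by simp
qed

context split_wreath
begin

text \<open>Two vertices of the same part of K_{4,4} are equivalent when the A-faces pair up
  their (common) neighbours in the same way. There are only three pairings, so the
  equivalence classes, all of the same size by transitivity, have two or four elements.\<close>
definition eqv :: "'v \<Rightarrow> 'v \<Rightarrow> bool" where
  "eqv v v' \<longleftrightarrow> v \<in> V \<and> v' \<in> V \<and> (\<forall>u w. corner A u v w \<longrightarrow> corner A u v' w)"

lemma cA: "corner A u v w \<Longrightarrow> {u, v} \<in> E" "corner A u v w \<Longrightarrow> {v, u} \<in> E"
  "corner A u v w \<Longrightarrow> {v, w} \<in> E" "corner A u v w \<Longrightarrow> u \<noteq> w"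
  using corner_edges[of A] by (auto simp: insert_commute)

lemma cA_unique: "corner A u v w \<Longrightarrow> corner A u v w' \<Longrightarrow> w = w'"
  using corner_unique[of A] by blast

lemma cA_exists: "{v, u} \<in> E \<Longrightarrow> \<exists>w. corner A u v w"
  using corner_exists[of A u v] by (auto simp: insert_commute)

lemma eqv_refl: "v \<in> V \<Longrightarrow> eqv v v"
  by (simp add: eqv_def)

lemma eqv_trans: "eqv u v \<Longrightarrow> eqv v w \<Longrightarrow> eqv u w"
  by (simp add: eqv_def)

lemma three_nbrs: "v \<in> V \<Longrightarrow> \<exists>u. {v, u} \<in> E"
  using three_neighbours by blast

lemma eqv_edge:
  assumes n4: "n = 4" and e: "eqv v v'"
  shows "{v, u} \<in> E \<longleftrightarrow> {v', u} \<in> E"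
proof -
  obtain u0 where u0: "{v, u0} \<in> E" using three_nbrs e unfolding eqv_def by blast
  then obtain w where "corner A u0 v w" using cA_exists by blast
  then have "corner A u0 v' w" using e unfolding eqv_def by blast
  then have "{v', u0} \<in> E" by (rule cA(2))
  then show ?thesis using same_part4[OF n4] u0 by blast
qed

lemma eqv_sym:
  assumes n4: "n = 4" and e: "eqv v v'"
  shows "eqv v' v"
  unfolding eqv_def
proof (intro conjI allI impI)
  show "v' \<in> V" "v \<in> V" using e by (simp_all add: eqv_def)
  fix u w assume c: "corner A u v' w"
  then have "{v, u} \<in> E" using eqv_edge[OF n4 e] cA(2) by blast
  then obtain w' where w': "corner A u v w'" using cA_exists by blast
  then have "corner A u v' w'" using e unfolding eqv_def by blast
  then have "w' = w" using cA_unique c by blast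
  then show "corner A u v w" using w' by simp
qed

lemma eqv_aut:
  assumes s: "map_aut V E F \<sigma>" and e: "eqv v v'"
  shows "eqv (\<sigma> v) (\<sigma> v')"
proof -
  have v: "v \<in> V" "v' \<in> V" using e by (simp_all add: eqv_def)
  have bij: "\<sigma> ` V = V" using s by (simp add: map_aut_def graph_aut_def bij_betw_def)
  obtain \<tau> where t: "map_aut V E F \<tau>" "\<And>v. v \<in> V \<Longrightarrow> \<tau> (\<sigma> v) = v" "\<And>v. v \<in> V \<Longrightarrow> \<sigma> (\<tau> v) = v"
    using map_aut_inverse[OF s polytopal_faces(3)[OF pm]] by blast
  show ?thesis unfolding eqv_def
  proof (intro conjI allI impI)
    show "\<sigma> v \<in> V" "\<sigma> v' \<in> V" using v bij by blast+
    fix u w assume c: "corner A u (\<sigma> v) w"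
    have "u \<in> V" "w \<in> V" using cA(1,3)[OF c] E_Pow by blast+
    have "corner A (\<tau> u) v (\<tau> w)" using corner_aut[OF _ t(1) c] t(2) v by simp
    then have "corner A (\<tau> u) v' (\<tau> w)" using e unfolding eqv_def by blast
    from corner_aut[OF _ s this] show "corner A u (\<sigma> v') w" using t(3) \<open>u \<in> V\<close> \<open>w \<in> V\<close> by simp
  qed
qed

text \<open>A pairing of four neighbours is determined by one pair. If the pairings of v and v'
  shared one pair but differed elsewhere, a fifth neighbour would appear.\<close>

lemma eqvI:
  assumes n4: "n = 4" and c: "corner A u0 v w0" "corner A u0 v' w0"
  shows "eqv v v'"
  unfolding eqv_def
proof (intro conjI allI impI)
  show vV: "v \<in> V" "v' \<in> V" using cA(2)[OF c(1)] cA(2)[OF c(2)] E_Pow by blast+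
  fix u z assume h: "corner A u v z"
  have "{v', u} \<in> E" using same_part4[OF n4 cA(2)[OF c(1)] cA(2)[OF c(2)] cA(2)[OF h]] .
  then obtain z' where z': "corner A u v' z'" using cA_exists by blast
  show "corner A u v' z"
  proof (rule ccontr)
    assume "\<not> corner A u v' z"
    then have zz: "z' \<noteq> z" using z' by blast
    have sy: "corner A w0 v u0" "corner A w0 v' u0" "corner A z v u" "corner A z' v' u"
      by (rule corner_sym, fact)+
    have n1: "u \<noteq> u0" using cA_unique[OF c(1), of z] cA_unique[OF c(2), of z'] h z' zz by auto
    have n2: "u \<noteq> w0" using cA_unique[OF sy(1), of z] cA_unique[OF sy(2), of z'] h z' zz by auto
    have n3': "z \<noteq> u0" using cA_unique[OF c(1), of u] sy(3) n2 by auto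
    have n4': "z \<noteq> w0" using cA_unique[OF sy(1), of u] sy(3) n1 by auto
    have n5: "z' \<noteq> u0" using cA_unique[OF c(2), of u] sy(4) n2 by auto
    have n6: "z' \<noteq> w0" using cA_unique[OF sy(2), of u] sy(4) n1 by auto
    have n7: "u0 \<noteq> w0" "u \<noteq> z" "u \<noteq> z'" using cA(4)[OF c(1)] cA(4)[OF h] cA(4)[OF z'] by blast+
    have vv: "{v, y} \<in> E \<longleftrightarrow> {v', y} \<in> E" for y
      using same_part4[OF n4] cA(2)[OF c(1)] cA(2)[OF c(2)] by blast
    have "{u0, w0, u, z, z'} \<subseteq> {y. {v, y} \<in> E}"
      using cA(2,3)[OF c(1)] cA(2,3)[OF h] cA(3)[OF z'] vv by blast
    then show False
      by (rule five_distinct[OF neighbours4(2,1)[OF n4 vV(1)]]) (use n1 n2 n3' n4' n5 n6 n7 zz in auto)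
  qed
qed

text \<open>Each of the four vertices adjacent to u0 pairs u0 with one of three others, so two of
  them agree and are equivalent by \<open>eqvI\<close>. Transitivity moves one of them to v.\<close>

lemma eqv_exists:
  assumes n4: "n = 4" and v: "v \<in> V"
  shows "\<exists>v'. v' \<noteq> v \<and> eqv v v'"
proof -
  obtain u0 where u0: "{v, u0} \<in> E" using three_nbrs[OF v] by blast
  have uV: "u0 \<in> V" using u0 E_Pow by blast
  let ?P = "{y. {u0, y} \<in> E}"
  define f where "f y = (SOME w. corner A u0 y w)" for y
  have f: "corner A u0 y (f y)" if "y \<in> ?P" for y
  proof -
    have "{y, u0} \<in> E" using that by (simp add: insert_commute)
    from cA_exists[OF this] show ?thesis unfolding f_def by (rule someI_ex)
  qed
  have "f ` ?P \<subseteq> {y. {v, y} \<in> E} - {u0}"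
  proof (rule image_subsetI)
    fix y assume y: "y \<in> ?P"
    have yu: "{y, u0} \<in> E" using y by (simp add: insert_commute)
    have "{v, f y} \<in> E" using same_part4[OF n4 yu u0 cA(3)[OF f[OF y]]] .
    moreover have "f y \<noteq> u0" using cA(4)[OF f[OF y]] by blast
    ultimately show "f y \<in> {y. {v, y} \<in> E} - {u0}" by blast
  qed
  moreover have "card ({y. {v, y} \<in> E} - {u0}) = 3"
    using neighbours4[OF n4 v] u0 by (simp add: card_Diff_singleton)
  ultimately have "card (f ` ?P) \<le> 3"
    using card_mono[of "{y. {v, y} \<in> E} - {u0}" "f ` ?P"] neighbours4(2)[OF n4 v] by simp
  then have "\<not> inj_on f ?P" using neighbours4(1)[OF n4 uV] by (intro pigeonhole) simp
  then obtain a b where ab: "a \<in> ?P" "b \<in> ?P" "a \<noteq> b" "f a = f b" unfolding inj_on_def by blast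
  have e: "eqv a b" using eqvI[OF n4 f[OF ab(1)]] f[OF ab(2)] ab(4) by simp
  obtain \<sigma> where s: "map_aut V E F \<sigma>" "\<sigma> a = v"
    using arc_trans[of a u0 v u0] ab(1) u0 by (auto simp: insert_commute)
  have "\<sigma> b \<noteq> \<sigma> a"
  proof -
    have "inj_on \<sigma> V" using s(1) graph_aut_inj by (auto simp: map_aut_def)
    then show ?thesis using e ab(3) unfolding eqv_def by (auto dest: inj_onD)
  qed
  then show ?thesis using eqv_aut[OF s(1) e] s(2) by blast
qed

text \<open>If the classes have two elements, they are the pairs. Otherwise each class is a whole
  part, so all vertices of the opposite part induce the same pairing on it, and that pairing is
  used.\<close>

lemma mates4:
  assumes n4: "n = 4"
  obtains M where "\<And>v. v \<in> V \<Longrightarrow> \<exists>w. M v w" "\<And>v w w'. M v w \<Longrightarrow> M v w' \<Longrightarrow> w = w'"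
    "\<And>v w. M v w \<Longrightarrow> M w v" "\<And>v w. M v w \<Longrightarrow> v \<noteq> w \<and> (\<exists>u. {v, u} \<in> E \<and> {w, u} \<in> E)"
    "\<And>\<sigma> v w. map_aut V E F \<sigma> \<Longrightarrow> M v w \<Longrightarrow> M (\<sigma> v) (\<sigma> w)"
proof (cases "\<exists>v a b. eqv v a \<and> eqv v b \<and> a \<noteq> v \<and> b \<noteq> v \<and> a \<noteq> b")
  case False
  let ?M = "\<lambda>v w. eqv v w \<and> w \<noteq> v"
  show thesis
  proof (rule that[of ?M])
    show "\<exists>w. ?M v w" if "v \<in> V" for v using eqv_exists[OF n4 that] by blast
    show "w = w'" if "?M v w" "?M v w'" for v w w' using False that by blast
    show "?M w v" if "?M v w" for v w using that eqv_sym[OF n4] by blast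
    show "v \<noteq> w \<and> (\<exists>u. {v, u} \<in> E \<and> {w, u} \<in> E)" if h: "?M v w" for v w
    proof -
      have "v \<in> V" using h by (simp add: eqv_def)
      then obtain u where "{v, u} \<in> E" using three_nbrs by blast
      then show ?thesis using eqv_edge[OF n4] h by blast
    qed
    show "?M (\<sigma> v) (\<sigma> w)" if "map_aut V E F \<sigma>" "?M v w" for \<sigma> v w
    proof -
      have "inj_on \<sigma> V" using that(1) graph_aut_inj by (auto simp: map_aut_def)
      then have "\<sigma> w \<noteq> \<sigma> v" using that(2) unfolding eqv_def by (auto dest: inj_onD)
      then show ?thesis using eqv_aut[OF that(1)] that(2) by blast
    qed
  qed
next
  case True
  then obtain v0 a0 b0 where v0: "eqv v0 a0" "eqv v0 b0" "a0 \<noteq> v0" "b0 \<noteq> v0" "a0 \<noteq> b0" by blast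
  have v0V: "v0 \<in> V" using v0 by (simp add: eqv_def)
  have three: "\<exists>a b. eqv v a \<and> eqv v b \<and> a \<noteq> v \<and> b \<noteq> v \<and> a \<noteq> b" if v: "v \<in> V" for v
  proof -
    obtain u u' where "{v0, u} \<in> E" "{v, u'} \<in> E" using three_nbrs v v0V by blast
    then obtain \<sigma> where s: "map_aut V E F \<sigma>" "\<sigma> v0 = v" using arc_trans by blast
    have "inj_on \<sigma> V" using s(1) graph_aut_inj by (auto simp: map_aut_def)
    then have "\<sigma> a0 \<noteq> \<sigma> v0" "\<sigma> b0 \<noteq> \<sigma> v0" "\<sigma> a0 \<noteq> \<sigma> b0"
      using v0 unfolding eqv_def by (auto dest: inj_onD)
    then show ?thesis using eqv_aut[OF s(1) v0(1)] eqv_aut[OF s(1) v0(2)] s(2) by auto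
  qed
  \<comment> \<open>Classes have at least three elements here, so a second class in the same part
    would give at least five vertices adjacent to u.\<close>
  have all: "eqv v v'" if h: "{v, u} \<in> E" "{v', u} \<in> E" for v v' u
  proof (rule ccontr)
    assume no: "\<not> eqv v v'"
    have V: "v \<in> V" "v' \<in> V" "u \<in> V" using h E_Pow by blast+
    obtain a b where ab: "eqv v a" "eqv v b" "a \<noteq> v" "b \<noteq> v" "a \<noteq> b" using three[OF V(1)] by blast
    obtain c where c: "eqv v' c" "c \<noteq> v'" using eqv_exists[OF n4 V(2)] by blast
    have nb: "y \<noteq> z" if "eqv v y" "eqv v' z" for y z
      using no eqv_trans[OF that(1)] eqv_sym[OF n4 that(2)] by blast
    have adj: "{u, y} \<in> E" if "eqv v y \<or> eqv v' y" for y
      using that eqv_edge[OF n4, of v y u] eqv_edge[OF n4, of v' y u] h by (auto simp: insert_commute)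
    have r: "eqv v v" "eqv v' v'" using V eqv_refl by blast+
    have "{v, a, b, v', c} \<subseteq> {y. {u, y} \<in> E}" using adj ab c r by blast
    then show False
      by (rule five_distinct[OF neighbours4(2,1)[OF n4 V(3)]])
        (use ab(3-5) c(2) nb[OF r(1) r(2)] nb[OF r(1) c(1)] nb[OF ab(1) r(2)] nb[OF ab(1) c(1)]
          nb[OF ab(2) r(2)] nb[OF ab(2) c(1)] in auto)
  qed
  let ?M = "\<lambda>u w. \<exists>v. corner A u v w"
  show thesis
  proof (rule that[of ?M])
    show "\<exists>w. ?M v w" if v: "v \<in> V" for v
    proof -
      obtain u where "{v, u} \<in> E" using three_nbrs[OF v] by blast
      then show ?thesis using cA_exists[of u v] by (auto simp: insert_commute)
    qed
    show "w = w'" if h: "?M u w" "?M u w'" for u w w'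
    proof -
      obtain v v' where c: "corner A u v w" "corner A u v' w'" using h by blast
      then have "eqv v v'" using all[OF cA(2) cA(2)] by blast
      then show ?thesis using c cA_unique unfolding eqv_def by blast
    qed
    show "?M w v" if "?M v w" for v w using that by (auto intro: corner_sym)
    show "v \<noteq> w \<and> (\<exists>u. {v, u} \<in> E \<and> {w, u} \<in> E)" if h: "?M v w" for v w
    proof -
      obtain u where u: "corner A v u w" using h by blast
      then show ?thesis using cA(1,4)[OF u] cA(3)[OF u] by (auto simp: insert_commute)
    qed
    show "?M (\<sigma> v) (\<sigma> w)" if "map_aut V E F \<sigma>" "?M v w" for \<sigma> v w
      using corner_aut[OF _ that(1), of A] that(2) by auto
  qed
qed

text \<open>Each part consists of two pairs of mates. Using the pairs as fibres, alternately from
  either part, gives coordinates by \<open>wreath4I\<close>.\<close>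

lemma twin_coords4:
  assumes n4: "n = 4"
  obtains z where "twin_wreath n V E z F A B"
proof -
  obtain M where Mex: "\<And>v. v \<in> V \<Longrightarrow> \<exists>w. M v w" and Mun: "\<And>v w w'. M v w \<Longrightarrow> M v w' \<Longrightarrow> w = w'"
    and Msym: "\<And>v w. M v w \<Longrightarrow> M w v" and Mne: "\<And>v w. M v w \<Longrightarrow> v \<noteq> w \<and> (\<exists>u. {v, u} \<in> E \<and> {w, u} \<in> E)"
    and Maut: "\<And>\<sigma> v w. map_aut V E F \<sigma> \<Longrightarrow> M v w \<Longrightarrow> M (\<sigma> v) (\<sigma> w)"
    using mates4[OF n4] by blast
  \<comment> \<open>The part of the bipartition that contains fibre k; mates have a common neighbour
    and hence share a part.\<close>
  define pt where "pt k v \<longleftrightarrow> (\<exists>j t. v = x j t \<and> even (k - j))" for k :: int and v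
  have Mpt: "pt k w" if h: "pt k v" "M v w" for k v w
  proof -
    obtain u where u: "{v, u} \<in> E" "{w, u} \<in> E" using Mne h(2) by blast
    obtain i s where i: "v = x i s" "even (k - i)" using h(1) unfolding pt_def by blast
    have "w \<in> V" "u \<in> V" using u E_Pow by blast+
    then obtain j t l q where j: "w = x j t" "u = x l q" unfolding V_eq by blast
    have "odd (i - l)" "odd (j - l)" using u edge_parity[OF n4] unfolding i j by blast+
    then show ?thesis unfolding pt_def j using i(2) by auto
  qed
  have blocks: "\<exists>f :: bool \<Rightarrow> bool \<Rightarrow> 'v. (\<forall>k' s k'' s'. f k' s = f k'' s' \<longleftrightarrow> k' = k'' \<and> s = s') \<and> (\<forall>k' s. pt k (f k' s)) \<and> (\<forall>k'. M (f k' False) (f k' True))"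
    for k
  proof -
    let ?a = "x k False"
    have pa: "pt k (x k s)" "pt k (x (k + 2) s)" for s unfolding pt_def by (intro exI conjI, rule refl, simp)+
    obtain a' where a': "M ?a a'" using Mex x_in_V by blast
    have "\<exists>b \<in> {x k True, x (k + 2) False, x (k + 2) True}. b \<noteq> a' \<and> b \<noteq> ?a"
      using n4 by (auto simp: x_eq_iff) presburger?
    then obtain b where b: "pt k b" "b \<noteq> a'" "b \<noteq> ?a" using pa by auto
    have "b \<in> V" using b(1) x_in_V unfolding pt_def by auto
    then obtain b' where b': "M b b'" using Mex by blast
    have d: "?a \<noteq> a'" "b \<noteq> b'" using Mne a' b' by blast+
    have d2: "b' \<noteq> ?a" "b' \<noteq> a'" using Mun Msym a' b' b by metis+
    define f where "f k' s = (if k' then (if s then b' else b) else (if s then a' else ?a))" for k' s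
    have "pt k a'" "pt k b'" using Mpt pa a' b b' by blast+
    then have "\<forall>k' s. pt k (f k' s)" using pa b(1) by (simp add: f_def)
    moreover have "\<forall>k'. M (f k' False) (f k' True)" using a' b' by (simp add: f_def)
    moreover have "\<forall>k' s k'' s'. f k' s = f k'' s' \<longleftrightarrow> k' = k'' \<and> s = s'"
      using d d2 b by (auto simp: f_def)
    ultimately show ?thesis by (intro exI[of _ f] conjI)
  qed
  from blocks[of 0] obtain f0 :: "bool \<Rightarrow> bool \<Rightarrow> 'v" where "(\<forall>k' s k'' s'. f0 k' s = f0 k'' s' \<longleftrightarrow> k' = k'' \<and> s = s') \<and>
      (\<forall>k' s. pt 0 (f0 k' s)) \<and> (\<forall>k'. M (f0 k' False) (f0 k' True))" by (rule exE)
  note f0 = this[THEN conjunct1, rule_format] this[THEN conjunct2, THEN conjunct1, rule_format]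
    this[THEN conjunct2, THEN conjunct2, rule_format]
  from blocks[of 1] obtain f1 :: "bool \<Rightarrow> bool \<Rightarrow> 'v" where "(\<forall>k' s k'' s'. f1 k' s = f1 k'' s' \<longleftrightarrow> k' = k'' \<and> s = s') \<and>
      (\<forall>k' s. pt 1 (f1 k' s)) \<and> (\<forall>k'. M (f1 k' False) (f1 k' True))" by (rule exE)
  note f1 = this[THEN conjunct1, rule_format] this[THEN conjunct2, THEN conjunct1, rule_format]
    this[THEN conjunct2, THEN conjunct2, rule_format]
  \<comment> \<open>The parity of i selects the part, the parity of \<open>i div 2\<close> one of
    its two pairs.\<close>
  define z where "z i s = (if even i then f0 (odd (i div 2)) s else f1 (odd (i div 2)) s)" for i :: int and s
  have ptz: "pt i (z i s)" for i s
    using f0(2)[of "odd (i div 2)" s] f1(2)[of "odd (i div 2)" s] unfolding z_def pt_def by auto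
  have Mz: "M (z i s) (z i (\<not> s))" for i s
    using f0(3)[of "odd (i div 2)"] f1(3)[of "odd (i div 2)"] Msym unfolding z_def by (cases s) auto
  have w: "wreath n V E z"
  proof (rule wreath4I[OF n4])
    show "\<exists>j t. z i s = x j t \<and> even (i - j)" for i s using ptz unfolding pt_def by blast
    show "(z i s = z j t) = (4 dvd i - j \<and> s = t)" for i s j t
    proof (cases "even (i - j)")
      case True
      then have "(even i \<longleftrightarrow> even j)" by simp
      moreover have "(odd (i div 2) \<longleftrightarrow> odd (j div 2)) \<longleftrightarrow> 4 dvd i - j" using True by presburger
      ultimately show ?thesis unfolding z_def by (simp add: f0(1) f1(1))
    next
      case False
      have "z i s \<noteq> z j t"
      proof
        assume e: "z i s = z j t"
        obtain a p where a: "z i s = x a p" "even (i - a)" using ptz[of i s] unfolding pt_def by blast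
        obtain b q where b: "z j t = x b q" "even (j - b)" using ptz[of j t] unfolding pt_def by blast
        have "4 dvd a - b" using e a b n4 by (simp add: x_eq_iff)
        then show False using a(2) b(2) False by presburger
      qed
      moreover have "\<not> 4 dvd i - j" using False by presburger
      ultimately show ?thesis by blast
    qed
  qed
  interpret z: wreath n V E z by (rule w)
  have "twin z (\<sigma> (z i s)) (\<sigma> (z i (\<not> s)))" if s: "map_aut V E F \<sigma>" for \<sigma> i s
  proof -
    have m: "M (\<sigma> (z i s)) (\<sigma> (z i (\<not> s)))" by (rule Maut[OF s Mz])
    have "\<sigma> ` V = V" using s by (simp add: map_aut_def graph_aut_def bij_betw_def)
    then have "\<sigma> (z i s) \<in> V" using z.x_in_V by blast
    then obtain j t where j: "\<sigma> (z i s) = z j t" unfolding z.V_eq by blast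
    have "\<sigma> (z i (\<not> s)) = z j (\<not> t)" using Mun[OF m] Mz[of j t] j by simp
    then show ?thesis unfolding twin_def using j by blast
  qed
  then have "twin_wreath n V E z F A B"
    using w pm sp by (intro twin_wreath.intro split_wreath.intro split_wreath_axioms.intro twin_wreath_axioms.intro)
  then show thesis by (rule that)
qed

lemma twin_coords:
  obtains z where "twin_wreath n V E z F A B"
proof (cases "n = 4")
  case True
  then show ?thesis using twin_coords4 that by blast
next
  case False
  have "twin_wreath n V E x F A B"
    by unfold_locales (use twin_aut[OF False] in \<open>simp add: map_aut_def\<close>)
  then show ?thesis by (rule that)
qed

end

theorem (in wreath) class201_normal_form:
  assumes "F \<in> class201_maps V E"
  obtains y c \<kappa> where "wreath n V E y" "F = map_quad n c \<kappa> y" "if c then 3 dvd n \<and> \<not> \<kappa> else even n" "n \<noteq> 4 \<or> \<kappa>"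
  | y where "wreath n V E y" "F = map_straight y" "n mod 4 = 2"
proof -
  have pm: "is_polytopal_map V E F" and cl: "class_2_01 V E F" using assms by (simp_all add: class201_maps_def)
  obtain A B where sp: "split_map V E F A B" by (rule class_2_01_imp_split[OF pm cl E_ne])
  interpret split_wreath n V E x F A B by unfold_locales (rule pm, rule sp)
  obtain z where "twin_wreath n V E z F A B" by (rule twin_coords)
  then show thesis using twin_wreath.normal_form that by blast
qed

section \<open>Counting\<close>

lemma face_img_map_quad: "face_img \<sigma> ` map_quad n c \<kappa> y = map_quad n c \<kappa> (\<lambda>i s. \<sigma> (y i s))"
  by (simp add: map_quad_def image_Un image_image face_img_quad face_img_pth)

lemma face_img_map_straight: "face_img \<sigma> ` map_straight y = map_straight (\<lambda>i s. \<sigma> (y i s))"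
  by (simp add: map_straight_def image_Un image_image face_img_pth)

context wreath
begin

lemma good_jump:
  assumes "if c then 3 dvd n \<and> \<not> \<kappa> else even n"
  shows "good_fam n c \<kappa> (\<lambda>i. \<kappa> \<and> jump n i)"
  using assms quasi_jump[of n \<kappa>] n3 by (simp add: good_fam_def)

lemma map_quad_class201:
  assumes "if c then 3 dvd n \<and> \<not> \<kappa> else even n" "n \<noteq> 4 \<or> \<kappa>"
  shows "map_quad n c \<kappa> x \<in> class201_maps V E"
  unfolding map_quad_def using quad_fam_class201[OF good_jump[OF assms(1)]] assms(2) n3 by auto

lemma map_straight_class201: "n mod 4 = 2 \<Longrightarrow> map_straight x \<in> class201_maps V E"
  unfolding map_straight_def by (rule fam_fam_class201)

lemma card_pth_fam:
  assumes "good_fam n c \<kappa> g"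
  shows "card ` pth x ` fam c g = {if \<kappa> then 2 * n else n}"
proof -
  have "card (pth x t) = (if \<kappa> then 2 * n else n)" if "t \<in> fam c g" for t
    by (rule card_pth(1)[OF quasi_fam[OF assms that]])
  then have "(\<lambda>t. card (pth x t)) ` fam c g = (\<lambda>_. if \<kappa> then 2 * n else n) ` fam c g" by (intro image_cong) auto
  moreover have "fam c g \<noteq> {}" using g_in_fam by blast
  ultimately show ?thesis by (simp add: image_image image_constant_conv)
qed

lemma card_map_quad:
  assumes "if c then 3 dvd n \<and> \<not> \<kappa> else even n"
  shows "card ` map_quad n c \<kappa> x = {4, if \<kappa> then 2 * n else n}"
proof -
  have "card ` range (quad x) = {4}" by (simp add: image_image card_quad)
  then show ?thesis unfolding map_quad_def image_Un card_pth_fam[OF good_jump[OF assms]] by auto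
qed

lemma card_map_straight:
  assumes "n mod 4 = 2"
  shows "card ` map_straight x = {n, 2 * n}"
proof -
  have en: "even n" using assms by presburger
  have "good_fam n False False (\<lambda>_. False)" using en by (simp add: good_fam_def quasi_def)
  moreover have "good_fam n False True q4" using en quasi_q4[OF en] assms by (simp add: good_fam_def)
  ultimately show ?thesis unfolding map_straight_def image_Un by (simp add: card_pth_fam insert_commute)
qed

text \<open>The first map has two disjoint faces of length n, whereas two Fibonacci sequences
  modulo 2 always agree somewhere.\<close>
lemma map_quad_not_iso:
  assumes n: "even n" "3 dvd n"
  shows "\<not> map_iso V E (map_quad n False False x) (map_quad n True False x)"
proof
  have n4: "n \<noteq> 4" using n(2) by auto
  assume "map_iso V E (map_quad n False False x) (map_quad n True False x)"
  then obtain \<sigma> where s: "graph_aut V E \<sigma>" "face_img \<sigma> ` map_quad n False False x = map_quad n True False x"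
    unfolding map_iso_def by blast
  define y where "y i s = \<sigma> (x i s)" for i s
  have eq: "map_quad n False False y = map_quad n True False x"
    using s(2) unfolding face_img_map_quad y_def .
  interpret y: wreath n V E y unfolding y_def by (rule coords_of_aut[OF s(1)])
  have c: "\<exists>d\<in>lin True. pth y (\<lambda>_. s) = pth x d" for s
  proof -
    have "(\<lambda>_. s) \<in> fam False (\<lambda>i. False \<and> jump n i)" by (simp add: fam_def lin_def)
    then have "pth y (\<lambda>_. s) \<in> map_quad n False False y" unfolding map_quad_def by blast
    then have m: "pth y (\<lambda>_. s) \<in> map_quad n True False x" unfolding eq .
    have "card (pth y (\<lambda>_. s)) = n" using y.card_pth(1)[of False "\<lambda>_. s"] by (simp add: quasi_def)
    \<comment> \<open>As 3 divides n, the length n is not 4, so this face of the first map must go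
      to a path of the second.\<close>
    then have "pth y (\<lambda>_. s) \<notin> range (quad x)" using card_quad n4 by auto
    then have "pth y (\<lambda>_. s) \<in> pth x ` fam True (\<lambda>i. False \<and> jump n i)" using m unfolding map_quad_def by blast
    then show ?thesis by (auto simp: fam_def)
  qed
  obtain d where d: "d \<in> lin True" "pth y (\<lambda>_. False) = pth x d" using c[of False] by blast
  obtain d' where d': "d' \<in> lin True" "pth y (\<lambda>_. True) = pth x d'" using c[of True] by blast
  \<comment> \<open>The sum d + d' is a Fibonacci sequence, and one of any three consecutive values
    is 0. There the two paths meet, whereas the constant sequences give disjoint ones.\<close>
  have "(d 2 \<noteq> d' 2) = ((d 0 \<noteq> d' 0) \<noteq> (d 1 \<noteq> d' 1))"
    using linD[OF lin_xor[OF d(1) d'(1)], of 0] by simp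
  then obtain i where i: "d i = d' i" by blast
  have "x i (d i) \<in> \<Union> (pth x d)" "x i (d' i) \<in> \<Union> (pth x d')" unfolding pth_def by blast+
  then have "x i (d i) \<in> \<Union> (pth y (\<lambda>_. False))" "x i (d i) \<in> \<Union> (pth y (\<lambda>_. True))"
    unfolding d(2) d'(2) i by blast+
  then obtain j k where "x i (d i) = y j False" "x i (d i) = y k True" unfolding pth_def by blast
  then show False by (simp add: y.x_eq_iff)
qed

end

text \<open>A name for the set in \<open>num_maps_len\<close>, so that simplification can evaluate
  it on an explicit list of maps.\<close>

definition of_lengths :: "nat set \<Rightarrow> 'v set set set set \<Rightarrow> 'v set set set set" where
  "of_lengths L S = {F \<in> S. card ` F = L}"

lemma of_lengths_simps:
  "of_lengths L {} = {}"
  "of_lengths L (insert F S) = (if card ` F = L then insert F (of_lengths L S) else of_lengths L S)"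
  by (auto simp: of_lengths_def)

text \<open>The normal forms by c and \<open>\<kappa>\<close>, then the map with two straight kinds.
  The first is left out for n = 4, where \<open>transp\<close> swaps its kinds of faces.\<close>

definition reps :: "nat \<Rightarrow> (int \<Rightarrow> bool \<Rightarrow> 'v) \<Rightarrow> 'v set set set set" where
  "reps n x = (if even n \<and> n \<noteq> 4 then {map_quad n False False x} else {}) \<union>
     (if even n then {map_quad n False True x} else {}) \<union>
     (if 3 dvd n then {map_quad n True False x} else {}) \<union>
     (if n mod 4 = 2 then {map_straight x} else {})"

section \<open>Representatives of the isomorphism classes\<close>

context wreath
begin

lemma reps_class201: "reps n x \<subseteq> class201_maps V E"
proof -
  have "n \<noteq> 4" if "3 dvd n" using that by auto
  then show ?thesis
    using map_quad_class201[of False False] map_quad_class201[of False True] map_quad_class201[of True False]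
      map_straight_class201 unfolding reps_def by auto
qed

lemma reps_iso:
  assumes "F \<in> class201_maps V E"
  shows "\<exists>R\<in>reps n x. map_iso V E F R"
  using assms
proof (cases rule: class201_normal_form)
  case (1 y c \<kappa>)
  obtain \<sigma> where s: "graph_aut V E \<sigma>" "\<And>i s. \<sigma> (y i s) = x i s"
    using wreath.iso_of_coords[OF 1(1) wreath_axioms] by blast
  have "face_img \<sigma> ` F = map_quad n c \<kappa> x" unfolding 1(2) face_img_map_quad s(2) ..
  then have "map_iso V E F (map_quad n c \<kappa> x)" unfolding map_iso_def using s(1) by blast
  moreover have "map_quad n c \<kappa> x \<in> reps n x" using 1(3,4) unfolding reps_def by (cases c; cases \<kappa>) auto
  ultimately show ?thesis by blast
next
  case (2 y)
  obtain \<sigma> where s: "graph_aut V E \<sigma>" "\<And>i s. \<sigma> (y i s) = x i s"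
    using wreath.iso_of_coords[OF 2(1) wreath_axioms] by blast
  have "face_img \<sigma> ` F = map_straight x" unfolding 2(2) face_img_map_straight s(2) ..
  then have "map_iso V E F (map_straight x)" unfolding map_iso_def using s(1) by blast
  moreover have "map_straight x \<in> reps n x" using 2(3) unfolding reps_def by auto
  ultimately show ?thesis by blast
qed

lemma class201_polytopal: "F \<in> class201_maps V E \<Longrightarrow> is_polytopal_map V E F"
  by (simp add: class201_maps_def)

lemma map_iso_card: "F \<in> class201_maps V E \<Longrightarrow> map_iso V E F F' \<Longrightarrow> card ` F' = card ` F"
  using map_iso_card_faces polytopal_faces(3)[OF class201_polytopal] by blast

lemma map_iso_sym:
  assumes "F \<in> class201_maps V E" "F' \<in> class201_maps V E" "map_iso V E F F'"
  shows "map_iso V E F' F"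
proof -
  have "equiv (class201_maps V E) {(F1, F2). F1 \<in> class201_maps V E \<and> F2 \<in> class201_maps V E \<and> map_iso V E F1 F2}"
    by (rule equiv_map_iso) (rule class201_polytopal)
  then have "sym {(F1, F2). F1 \<in> class201_maps V E \<and> F2 \<in> class201_maps V E \<and> map_iso V E F1 F2}" by (rule equivE)
  from symD[OF this, of F F'] show ?thesis using assms by simp
qed

lemma card_reps:
  shows "even n \<Longrightarrow> card ` map_quad n False False x = {4, n}"
    "even n \<Longrightarrow> card ` map_quad n False True x = {4, 2 * n}"
    "3 dvd n \<Longrightarrow> card ` map_quad n True False x = {4, n}"
    "n mod 4 = 2 \<Longrightarrow> card ` map_straight x = {n, 2 * n}"
  using card_map_quad[of False False] card_map_quad[of False True] card_map_quad[of True False] card_map_straight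
  by simp_all

lemma lengths_neq: "{4, n} \<noteq> {4, 2 * n}" "n mod 4 = 2 \<Longrightarrow> {4, n} \<noteq> {n, 2 * n}"
  "n mod 4 = 2 \<Longrightarrow> {4, 2 * n} \<noteq> {n, 2 * n}"
  using n3 by (auto simp: doubleton_eq_iff)

text \<open>Face lengths separate all pairs except c = 0 and c = 1 with \<open>\<kappa>\<close> = 0,
  which \<open>map_quad_not_iso\<close> settles.\<close>

lemma reps_not_iso:
  assumes R: "R \<in> reps n x" "R' \<in> reps n x" and iso: "map_iso V E R R'"
  shows "R = R'"
proof (rule ccontr)
  assume ne: "R \<noteq> R'"
  have cl: "R \<in> class201_maps V E" "R' \<in> class201_maps V E" using R reps_class201 by blast+
  have c: "card ` R' = card ` R" by (rule map_iso_card[OF cl(1) iso])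
  have mem: "(S = map_quad n False False x \<and> even n) \<or> (S = map_quad n False True x \<and> even n) \<or>
      (S = map_quad n True False x \<and> 3 dvd n) \<or> (S = map_straight x \<and> n mod 4 = 2)" if "S \<in> reps n x" for S
    using that unfolding reps_def by (auto split: if_splits)
  have "even n \<and> 3 dvd n \<and> ((R = map_quad n False False x \<and> R' = map_quad n True False x) \<or>
      (R' = map_quad n False False x \<and> R = map_quad n True False x))"
    using mem[OF R(1)] mem[OF R(2)] ne c
    by (elim disjE conjE) (simp_all add: card_reps lengths_neq lengths_neq[symmetric])
  then show False using map_quad_not_iso iso map_iso_sym[OF cl iso] by blast
qed

lemma card_iso_classes:
  "card (iso_classes V E (class201_maps V E)) = card (reps n x)"
  "card (iso_classes V E {F \<in> class201_maps V E. card ` F = L}) = card {F \<in> reps n x. card ` F = L}"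
proof -
  \<comment> \<open>The predicate P covers both counts: always true for all maps, equality with L
    for prescribed lengths.\<close>
  have *: "card (iso_classes V E {F \<in> class201_maps V E. P (card ` F)}) = card {F \<in> reps n x. P (card ` F)}"
    (is "card (iso_classes V E ?S) = card ?R") for P
    unfolding iso_classes_def
  proof (rule card_quotient_eq_card_reps)
    show "equiv ?S {(F1, F2). F1 \<in> ?S \<and> F2 \<in> ?S \<and> map_iso V E F1 F2}"
      by (rule equiv_map_iso) (simp add: class201_polytopal)
    show "?R \<subseteq> ?S" using reps_class201 by blast
    show "\<exists>R\<in>?R. (F, R) \<in> {(F1, F2). F1 \<in> ?S \<and> F2 \<in> ?S \<and> map_iso V E F1 F2}" if F: "F \<in> ?S" for F
    proof -
      have Fc: "F \<in> class201_maps V E" "P (card ` F)" using F by simp_all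
      obtain R where R: "R \<in> reps n x" "map_iso V E F R" using reps_iso[OF Fc(1)] by blast
      have "P (card ` R)" using map_iso_card[OF Fc(1) R(2)] Fc(2) by simp
      moreover have "R \<in> class201_maps V E" using R(1) reps_class201 by blast
      ultimately show ?thesis using R Fc by (intro bexI[of _ R]) simp_all
    qed
    show "R = R'" if "R \<in> ?R" "R' \<in> ?R" "(R, R') \<in> {(F1, F2). F1 \<in> ?S \<and> F2 \<in> ?S \<and> map_iso V E F1 F2}" for R R'
      using reps_not_iso[of R R'] that by simp
  qed
  show "card (iso_classes V E (class201_maps V E)) = card (reps n x)" using *[of "\<lambda>_. True"] by simp
  show "card (iso_classes V E {F \<in> class201_maps V E. card ` F = L}) = card {F \<in> reps n x. card ` F = L}"
    using *[of "\<lambda>c. c = L"] .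
qed

lemma reps_neq:
  "even n \<Longrightarrow> map_quad n False False x \<noteq> map_quad n False True x"
  "even n \<Longrightarrow> 3 dvd n \<Longrightarrow> map_quad n False False x \<noteq> map_quad n True False x"
  "even n \<Longrightarrow> 3 dvd n \<Longrightarrow> map_quad n False True x \<noteq> map_quad n True False x"
  "n mod 4 = 2 \<Longrightarrow> map_quad n False False x \<noteq> map_straight x"
  "n mod 4 = 2 \<Longrightarrow> map_quad n False True x \<noteq> map_straight x"
  "n mod 4 = 2 \<Longrightarrow> 3 dvd n \<Longrightarrow> map_quad n True False x \<noteq> map_straight x"
proof -
  have en: "even n" if "n mod 4 = 2" using that by presburger
  show "even n \<Longrightarrow> map_quad n False False x \<noteq> map_quad n False True x"
    using card_reps(1,2) lengths_neq(1) by metis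
  show "even n \<Longrightarrow> 3 dvd n \<Longrightarrow> map_quad n False True x \<noteq> map_quad n True False x"
    using card_reps(2,3) lengths_neq(1) by metis
  show "n mod 4 = 2 \<Longrightarrow> map_quad n False False x \<noteq> map_straight x"
    using card_reps(1,4) lengths_neq(2) en by metis
  show "n mod 4 = 2 \<Longrightarrow> map_quad n False True x \<noteq> map_straight x"
    using card_reps(2,4) lengths_neq(3) en by metis
  show "n mod 4 = 2 \<Longrightarrow> 3 dvd n \<Longrightarrow> map_quad n True False x \<noteq> map_straight x"
    using card_reps(3,4) lengths_neq(2) by metis
  show "even n \<Longrightarrow> 3 dvd n \<Longrightarrow> map_quad n False False x \<noteq> map_quad n True False x"
  proof
    assume n: "even n" "3 dvd n" and e: "map_quad n False False x = map_quad n True False x"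
    have "map_iso V E (map_quad n False False x) (map_quad n False False x)"
      using graph_aut_id[of V E] face_img_map_quad[of id n False False x]
      unfolding map_iso_def by (intro exI[of _ id]) simp
    then show False using map_quad_not_iso[OF n] e by simp
  qed
qed

end

theorem theorem3p3:
  fixes n :: nat
  assumes "n \<ge> 3"
  shows "(class201_maps (rw_vertices n) (rw_edges n 2 1) \<noteq> {} \<longleftrightarrow> gcd n 6 \<noteq> 1)
    \<and> (n = 4 \<longrightarrow> num_maps n = 1 \<and> num_maps_len n {4, 8} = 1)
    \<and> (n mod 12 \<in> {3, 9} \<longrightarrow> num_maps n = 1 \<and> num_maps_len n {4, n} = 1)
    \<and> (n mod 12 \<in> {4, 8} \<and> n \<noteq> 4 \<longrightarrow>
         num_maps n = 2 \<and> num_maps_len n {4, n} = 1 \<and> num_maps_len n {4, 2 * n} = 1)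
    \<and> (n mod 12 \<in> {2, 10} \<longrightarrow>
         num_maps n = 3 \<and> num_maps_len n {4, n} = 1 \<and> num_maps_len n {4, 2 * n} = 1
         \<and> num_maps_len n {n, 2 * n} = 1)
    \<and> (n mod 12 = 0 \<longrightarrow>
         num_maps n = 3 \<and> num_maps_len n {4, n} = 2 \<and> num_maps_len n {4, 2 * n} = 1)
    \<and> (n mod 12 = 6 \<longrightarrow>
         num_maps n = 4 \<and> num_maps_len n {4, n} = 2 \<and> num_maps_len n {4, 2 * n} = 1
         \<and> num_maps_len n {n, 2 * n} = 1)"
proof -
  define x :: "int \<Rightarrow> bool \<Rightarrow> bool \<times> nat"
    where "x = (\<lambda>i s. (s, nat ((i - (if s then 1 else 0)) mod int n)))"
  interpret wreath n "rw_vertices n" "rw_edges n 2 1" x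
    unfolding x_def by (rule wreath_rose_window[OF assms])
  have nm: "num_maps n = card (reps n x)" "num_maps_len n L = card (of_lengths L (reps n x))" for L
    unfolding num_maps_def num_maps_len_def of_lengths_def by (rule card_iso_classes)+
  have "coprime n 6 \<longleftrightarrow> odd n \<and> \<not> 3 dvd n"
  proof -
    have "coprime n 6 \<longleftrightarrow> coprime n 2 \<and> coprime n 3"
      using coprime_mult_right_iff[of n 2 3] by simp
    moreover have "coprime n 3 \<longleftrightarrow> \<not> 3 dvd n"
    proof
      assume "coprime n 3"
      then show "\<not> 3 dvd n" using coprime_common_divisor_nat[of n 3 3] by auto
    next
      assume "\<not> 3 dvd n"
      then have "n mod 3 = 1 \<or> n mod 3 = 2" by presburger
      then have "gcd 3 (n mod 3) = 1"
        by (elim disjE) (simp_all add: gcd_red_nat[of 3 2])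
      then have "gcd n 3 = 1" using gcd_red_nat[of n 3] by simp
      then show "coprime n 3" by (simp add: coprime_iff_gcd_eq_1)
    qed
    ultimately show ?thesis by simp
  qed
  then have g: "gcd n 6 \<noteq> 1 \<longleftrightarrow> even n \<or> 3 dvd n" by (simp add: coprime_iff_gcd_eq_1)
  \<comment> \<open>Although n = 4 lacks the first map, the second is present for every even
    n.\<close>
  have "reps n x \<noteq> {} \<longleftrightarrow> even n \<or> 3 dvd n"
    using n3 by (auto simp: reps_def) presburger?
  moreover have "class201_maps (rw_vertices n) (rw_edges n 2 1) \<noteq> {} \<longleftrightarrow> reps n x \<noteq> {}"
    using reps_class201 reps_iso by blast
  ultimately have ne: "class201_maps (rw_vertices n) (rw_edges n 2 1) \<noteq> {} \<longleftrightarrow> gcd n 6 \<noteq> 1" using g by simp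
  note [simp] = of_lengths_simps card_reps lengths_neq lengths_neq[symmetric] reps_neq reps_neq[symmetric]
  have i: "num_maps n = 1 \<and> num_maps_len n {4, 8} = 1" if n4: "n = 4"
  proof -
    have "reps n x = {map_quad n False True x}" using n4 by (simp add: reps_def)
    moreover have "card ` map_quad n False True x = {4, 8}" using card_reps(2) n4 by simp
    ultimately show ?thesis unfolding nm by simp
  qed
  have ii: "num_maps n = 1 \<and> num_maps_len n {4, n} = 1" if "n mod 12 \<in> {3, 9}"
  proof -
    have m: "n mod 12 = 3 \<or> n mod 12 = 9" using that by simp
    have d: "odd n" "3 dvd n" "n mod 4 \<noteq> 2" using m by presburger+
    then have "reps n x = {map_quad n True False x}" by (simp add: reps_def)
    then show ?thesis unfolding nm using d by simp
  qed
  have iii: "num_maps n = 2 \<and> num_maps_len n {4, n} = 1 \<and> num_maps_len n {4, 2 * n} = 1"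
    if "n mod 12 \<in> {4, 8}" "n \<noteq> 4"
  proof -
    have m: "n mod 12 = 4 \<or> n mod 12 = 8" using that(1) by simp
    have d: "even n" "\<not> 3 dvd n" "n mod 4 \<noteq> 2" using m by presburger+
    then have "reps n x = {map_quad n False False x, map_quad n False True x}"
      using that(2) by (simp add: reps_def insert_commute)
    then show ?thesis unfolding nm using d by simp
  qed
  have iv: "num_maps n = 3 \<and> num_maps_len n {4, n} = 1 \<and> num_maps_len n {4, 2 * n} = 1 \<and> num_maps_len n {n, 2 * n} = 1"
    if "n mod 12 \<in> {2, 10}"
  proof -
    have m: "n mod 12 = 2 \<or> n mod 12 = 10" using that by simp
    have d: "even n" "\<not> 3 dvd n" "n mod 4 = 2" "n \<noteq> 4" using m by presburger+
    have "reps n x = {map_quad n False False x, map_quad n False True x, map_straight x}"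
      unfolding reps_def using d by auto
    then show ?thesis unfolding nm using d(1,3) by simp
  qed
  have v: "num_maps n = 3 \<and> num_maps_len n {4, n} = 2 \<and> num_maps_len n {4, 2 * n} = 1" if "n mod 12 = 0"
  proof -
    have d: "even n" "3 dvd n" "n mod 4 \<noteq> 2" "n \<noteq> 4" using that by presburger+
    have "reps n x = {map_quad n False False x, map_quad n False True x, map_quad n True False x}"
      unfolding reps_def using d by auto
    then show ?thesis unfolding nm using d(1,2) by simp
  qed
  have vi: "num_maps n = 4 \<and> num_maps_len n {4, n} = 2 \<and> num_maps_len n {4, 2 * n} = 1 \<and> num_maps_len n {n, 2 * n} = 1"
    if "n mod 12 = 6"
  proof -
    have d: "even n" "3 dvd n" "n mod 4 = 2" "n \<noteq> 4" using that by presburger+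
    have "reps n x = {map_quad n False False x, map_quad n False True x, map_quad n True False x, map_straight x}"
      unfolding reps_def using d by auto
    then show ?thesis unfolding nm using d(1,2,3) by simp
  qed
  show ?thesis using ne i ii iii iv v vi by (intro conjI impI) (elim conjE | simp)+
qed

end
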